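(* Fix $L$, a positive integer. Let $\mu_0,\mu_1$ be such that for every strongly connected, directed graph $G$ there exists a random variable $A$ such that almost surely $A_u=A$ for all $u\in V$. Then there exists a sequence $q(n)=q(n,\mu_0,\mu_1)$ such that $q(n)\to1$ as $n\to\infty$, and $\mathbb{P}[A=\{S\}]\ge q(n)$, for any choice of $L$-locally strongly connected graph $G$ with $n$ agents.
   Context: A directed graph $G=(V,E)$ is $L$-locally strongly connected if, for each $(u,w)\in E$, there exists a path in $G$ of length at most $L$ from $w$ to $u$. Model. Let $\mu_0\neq\mu_1$ be mutually absolutely continuous probability measures on a measurable space $(\Omega,\mathcal{O})$. $V$ is a countable (finite or infinite) set of agents. The state of the world $S\in\{0,1\}$ and private signals $W_u\in\Omega$ ($u\in V$) have joint law $\frac12\delta_0\mu_0^V+\frac12\delta_1\mu_1^V$: $S$ is uniform on $\{0,1\}$ and, conditioned on $S$, the $W_u$ are i.i.d. with law $\mu_S$. The social network $G=(V,E)$ is a directed graph, assumed throughout (for every social network considered, including those in the conclusion) to be simple (no loops or parallel edges) and strongly connected. $N(u)=\{v:(u,v)\in E\}$ is the set of neighbors of $u$. For $t=1,2,\dots$ the information $\mathcal{F}_u(t)$ and action $A_u(t)\in\{0,1\}$ of agent $u$ are defined jointly by $\mathcal{F}_u(t)=\sigma(W_u,\{A_v(t'):v\in N(u),t'<t\})$ and $A_u(t)=0$ if $\mathbb{P}[S=1|\mathcal{F}_u(t)]<1/2$, $A_u(t)=1$ if $\mathbb{P}[S=1|\mathcal{F}_u(t)]>1/2$, and $A_u(t)\in\{0,1\}$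 if $\mathbb{P}[S=1|\mathcal{F}_u(t)]=1/2$. Equivalently, $A_u(t)$ is the MAP estimator of $S$ given $\mathcal{F}_u(t)$, i.e. an $\mathcal{F}_u(t)$-measurable estimator maximizing the probability of equaling $S$, with some tie-breaking rule. Nothing is assumed about how agents break ties. Let $\mathcal{F}_u$ be the $\sigma$-algebra generated by $\bigcup_t\mathcal{F}_u(t)$ and $X_u=\mathbb{P}[S=1|\mathcal{F}_u]$. The optimal action set $A_u$ of agent $u$ is $\{0\}$ if $X_u<1/2$, $\{1\}$ if $X_u>1/2$, and $\{0,1\}$ if $X_u=1/2$. *)

theory Defs
  imports "HOL-Probability.Probability" "Graph_Theory.Graph_Theory"
begin

text \<open>Agents are natural numbers, so that a countable (finite or infinite) set of agents is a set of
  type \<^typ>\<open>nat set\<close>. Arcs are pairs of agents, which rules out parallel edges.\<close>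

definition social_network :: "nat pair_pre_digraph \<Rightarrow> bool" where
  "social_network G \<longleftrightarrow> pair_loopfree_digraph G \<and> strongly_connected (with_proj G)"

definition locally_strongly_connected :: "nat \<Rightarrow> nat pair_pre_digraph \<Rightarrow> bool" where
  "locally_strongly_connected L G \<longleftrightarrow>
     (\<forall>(u, w) \<in> parcs G. \<exists>p. pre_digraph.apath (with_proj G) w p u \<and> length p \<le> L)"

definition neighbors :: "nat pair_pre_digraph \<Rightarrow> nat \<Rightarrow> nat set" where
  "neighbors G u = {v. (u, v) \<in> parcs G}"

text \<open>States and actions have type \<^typ>\<open>bool\<close>, with \<^term>\<open>False\<close> for 0 and \<^term>\<open>True\<close> for 1. An
  outcome is a pair \<open>(s, w)\<close> of the state of the world \<open>S = s\<close> and the family of private signals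
  \<open>W\<^sub>u = w u\<close>. The measure below on such pairs is
  \<open>1/2 \<delta>\<^sub>0 \<mu>\<^sub>0\<^sup>V + 1/2 \<delta>\<^sub>1 \<mu>\<^sub>1\<^sup>V\<close>; the arguments \<open>m0\<close> and \<open>m1\<close> are \<open>\<mu>\<^sub>0\<close> and \<open>\<mu>\<^sub>1\<close>, whose
  common \<open>\<sigma>\<close>-algebra is that of the signal space.\<close>

type_synonym 'w outcome = "bool \<times> (nat \<Rightarrow> 'w)"

type_synonym 'w actions = "nat \<Rightarrow> nat \<Rightarrow> 'w outcome \<Rightarrow> bool"

definition world :: "'w measure \<Rightarrow> 'w measure \<Rightarrow> nat set \<Rightarrow> 'w outcome measure" where
  "world m0 m1 V =
     measure_pmf (pmf_of_set (UNIV :: bool set)) \<bind>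
       (\<lambda>s. return (count_space UNIV) s \<Otimes>\<^sub>M (\<Pi>\<^sub>M u\<in>V. if s then m1 else m0))"

text \<open>\<open>\<F>\<^sub>u(t)\<close>, for an action process \<open>act\<close> with \<open>act v t' = A\<^sub>v(t')\<close>; times start at 1.\<close>

definition info ::
  "'w measure \<Rightarrow> 'w measure \<Rightarrow> nat pair_pre_digraph \<Rightarrow> 'w actions \<Rightarrow> nat \<Rightarrow> nat \<Rightarrow> 'w outcome measure"
where
  "info m0 m1 G act u t =
     (let \<Omega> = space (world m0 m1 (pverts G)) in
      sigma \<Omega>
        ({(\<lambda>(s, w). w u) -` B \<inter> \<Omega> | B. B \<in> sets m0} \<union>
         {act v t' -` C \<inter> \<Omega> | v t' C. v \<in> neighbors G u \<and> 1 \<le> t' \<and> t' < t}))"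

definition limit_info ::
  "'w measure \<Rightarrow> 'w measure \<Rightarrow> nat pair_pre_digraph \<Rightarrow> 'w actions \<Rightarrow> nat \<Rightarrow> 'w outcome measure"
where
  "limit_info m0 m1 G act u =
     sigma (space (world m0 m1 (pverts G))) (\<Union>t\<in>{1..}. sets (info m0 m1 G act u t))"

definition belief ::
  "'w measure \<Rightarrow> 'w measure \<Rightarrow> nat pair_pre_digraph \<Rightarrow> 'w outcome measure \<Rightarrow> 'w outcome \<Rightarrow> real"
where
  "belief m0 m1 G F = real_cond_exp (world m0 m1 (pverts G)) F (indicator {\<omega>. fst \<omega> = True})"

text \<open>The actions of all agents form a process consistent with the model, for some tie-breaking
  rule. Measurability lets the choice at a tie be any measurable function of the agent's information.\<close>

definition action_process ::
  "'w measure \<Rightarrow> 'w measure \<Rightarrow> nat pair_pre_digraph \<Rightarrow> 'w actions \<Rightarrow> bool"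
where
  "action_process m0 m1 G act \<longleftrightarrow>
     (\<forall>u\<in>pverts G. \<forall>t\<ge>1.
        act u t \<in> info m0 m1 G act u t \<rightarrow>\<^sub>M count_space UNIV \<and>
        (AE \<omega> in world m0 m1 (pverts G).
           (belief m0 m1 G (info m0 m1 G act u t) \<omega> < 1/2 \<longrightarrow> act u t \<omega> = False) \<and>
           (belief m0 m1 G (info m0 m1 G act u t) \<omega> > 1/2 \<longrightarrow> act u t \<omega> = True)))"

definition optimal_actions ::
  "'w measure \<Rightarrow> 'w measure \<Rightarrow> nat pair_pre_digraph \<Rightarrow> 'w actions \<Rightarrow> nat \<Rightarrow> 'w outcome \<Rightarrow> bool set"
where
  "optimal_actions m0 m1 G act u \<omega> =
     (let x = belief m0 m1 G (limit_info m0 m1 G act u) \<omega> in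
      if x < 1/2 then {False} else if x > 1/2 then {True} else {False, True})"

definition common_optimal_action_set ::
  "'w measure \<Rightarrow> 'w measure \<Rightarrow> nat pair_pre_digraph \<Rightarrow> 'w actions \<Rightarrow> ('w outcome \<Rightarrow> bool set) \<Rightarrow> bool"
where
  "common_optimal_action_set m0 m1 G act A \<longleftrightarrow>
     A \<in> world m0 m1 (pverts G) \<rightarrow>\<^sub>M count_space UNIV \<and>
     (AE \<omega> in world m0 m1 (pverts G). \<forall>u\<in>pverts G. optimal_actions m0 m1 G act u \<omega> = A \<omega>)"

end

theory Submission
  imports Defs "HOL-Complex_Analysis.Great_Picard"
begin

text \<open>The information in the history of an agent is measured by the Bhattacharyya coefficient of its two
  conditional laws, given \<open>S = 0\<close> and \<open>S = 1\<close>; it bounds the error probability of the agent. An agent with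
  many neighbours sees many first actions that are independent given \<open>S\<close>, so its coefficient is
  exponentially small in the degree. If the degrees are bounded, \<open>L\<close>-local strong connectivity makes
  rooted networks compact: along a subsequence, larger and larger networks that learn badly around their roots
  converge, together with the strategies, to an infinite network in equilibrium on which every coefficient stays
  large. There agreement applies. The agreed action set is almost a function of the signals near one agent,
  hence almost independent given \<open>S\<close> of the history of a distant agent; but it is almost surely a single
  action, at least as good as the best use of one signal, and the distant agent eventually plays it. So the
  coefficient can always be improved by a factor bounded away from 1, a contradiction.\<close>

subsection \<open>Limits of sequences of sets\<close>

text \<open>The coefficient is suited to the purpose because it multiplies over conditionally
  independent observations, decreases with information and depends continuously on the laws of
  finite histories. The main obstacle is the limit of strategies. Off the atoms of the law of the
  likelihood ratio, an action is a threshold rule and its decisions settle pointwise. At an atom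
  ties may be broken differently in each network, and the signal space need neither be standard nor
  offer independent randomness for mixing. Two facts help. On a level set of the ratio the two
  signal laws are proportional, so matching measures under one law matches them under the other. And
  along a subsequence the signals whose decisions do not settle carry no atom of the countably many
  decisions involved, so they can be cut into pieces of any smaller measure. Agreement concerns one
  network at a time and yields no rate; therefore each improvement of the bound is made uniform in
  size, time and radius by compactness before the next one is attempted.\<close>

lemma measure_Int_tendsto:
  assumes "finite_measure N" and [measurable]: "\<And>m. S m \<in> sets N" "S' \<in> sets N" "E \<in> sets N"
    and ev: "AE x in N. x \<in> E \<longrightarrow> eventually (\<lambda>m. x \<in> S m \<longleftrightarrow> x \<in> S') sequentially"
  shows "(\<lambda>m. measure N (S m \<inter> E)) \<longlonglongrightarrow> measure N (S' \<inter> E)"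
proof -
  interpret finite_measure N by fact
  have "(\<lambda>m. \<integral>x. indicator (S m \<inter> E) x \<partial>N) \<longlonglongrightarrow> (\<integral>x. indicator (S' \<inter> E) x \<partial>N :: real)"
  proof (rule integral_dominated_convergence[where w = "\<lambda>_. 1"])
    show "AE x in N. (\<lambda>m. indicator (S m \<inter> E) x) \<longlonglongrightarrow> (indicator (S' \<inter> E) x :: real)"
      using ev
    proof eventually_elim
      case (elim x)
      show ?case
      proof (cases "x \<in> E")
        case True
        with elim have "eventually (\<lambda>m. x \<in> S m \<longleftrightarrow> x \<in> S') sequentially" by simp
        then have "eventually (\<lambda>m. indicator (S m \<inter> E) x = (indicator (S' \<inter> E) x :: real)) sequentially"
          by eventually_elim (simp add: indicator_def)
        then show ?thesis by (rule tendsto_eventually)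
      qed simp
    qed
  qed (auto simp: indicator_def)
  then show ?thesis by simp
qed

text \<open>The distribution function of \<open>\<theta>\<close> on \<open>E\<close> is continuous
  by \<open>null\<close>, so the intermediate value theorem yields a sublevel set of
  \<open>\<theta>\<close> in \<open>E\<close> of the required measure. This is Sierpinski's theorem
  with the absence of atoms certified by one real function.\<close>

lemma (in finite_measure) exists_subset_measure_eq:
  fixes \<theta> :: "'a \<Rightarrow> real"
  assumes [measurable]: "\<theta> \<in> borel_measurable M" "E \<in> sets M"
    and null: "\<And>y. measure M (E \<inter> {x \<in> space M. \<theta> x = y}) = 0"
    and c: "0 \<le> c" "c \<le> measure M E"
  shows "\<exists>E' \<in> sets M. E' \<subseteq> E \<and> measure M E' = c"
proof -
  define N where "N = distr (restrict_space M E) borel \<theta>"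
  have sub: "E \<subseteq> space M" using assms(2) by (rule sets.sets_into_space)
  have fin: "finite_measure (restrict_space M E)"
    by (rule finite_measure_restrict_space) (auto simp: emeasure_eq_measure intro: finite_measure_axioms)
  have [measurable]: "\<theta> \<in> borel_measurable (restrict_space M E)"
    by (rule measurable_restrict_space1) simp
  have mN: "measure N A = measure M (E \<inter> {x \<in> space M. \<theta> x \<in> A})" if "A \<in> sets borel" for A
  proof -
    have [measurable]: "A \<in> sets borel" by fact
    have "measure N A = measure (restrict_space M E) (\<theta> -` A \<inter> space (restrict_space M E))"
      unfolding N_def by (rule measure_distr) auto
    also have "\<theta> -` A \<inter> space (restrict_space M E) = E \<inter> {x \<in> space M. \<theta> x \<in> A}"
      using sub by (auto simp: space_restrict_space)
    also have "measure (restrict_space M E) \<dots> = measure M \<dots>"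
      by (rule measure_restrict_space) (use sub in auto)
    finally show ?thesis .
  qed
  interpret N: finite_borel_measure N
  proof -
    interpret R: finite_measure "restrict_space M E" by fact
    show "finite_borel_measure N"
      unfolding finite_borel_measure_def finite_borel_measure_axioms_def N_def
      by (auto intro!: R.finite_measure_distr)
  qed
  have cont: "isCont (cdf N) x" for x
    unfolding N.isCont_cdf using mN[of "{x}"] null[of x] by simp
  have cdfE: "cdf N x = measure M (E \<inter> {y \<in> space M. \<theta> y \<in> {..x}})" for x
    unfolding cdf_def by (rule mN) simp
  have tot: "measure N (space N) = measure M E"
    using mN[of UNIV] sub by (simp add: N.borel_UNIV Int_absorb2)
  \<comment> \<open>The two extreme values are set apart since the distribution function may
    approach them only at infinity.\<close>
  consider "c = 0" | "c = measure M E" | "0 < c" "c < measure M E" using c by fastforce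
  then show ?thesis
  proof cases
    case 1 then show ?thesis by (intro bexI[of _ "{}"]) auto
  next
    case 2 then show ?thesis by (intro bexI[of _ E]) auto
  next
    case 3
    have "eventually (\<lambda>x. cdf N x < c) at_bot"
      using order_tendstoD(2)[OF N.cdf_lim_at_bot 3(1)] .
    then obtain a where a: "\<And>x. x \<le> a \<Longrightarrow> cdf N x < c" by (auto simp: eventually_at_bot_linorder)
    have "eventually (\<lambda>x. cdf N x > c) at_top"
      using order_tendstoD(1)[OF N.cdf_lim_at_top] 3(2) tot by simp
    then obtain b where b: "\<And>x. x \<ge> b \<Longrightarrow> cdf N x > c" by (auto simp: eventually_at_top_linorder)
    have "\<exists>x\<ge>min a b. x \<le> max a b \<and> cdf N x = c"
      by (rule IVT) (use a[of "min a b"] b[of "max a b"] cont in auto)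
    then obtain x where "cdf N x = c" by blast
    then show ?thesis by (intro bexI[of _ "E \<inter> {y \<in> space M. \<theta> y \<in> {..x}}"]) (auto simp: cdfE)
  qed
qed

text \<open>The atoms of the distribution of \<open>\<theta>\<close> are events on which every \<open>B i\<close> is constant; on the remaining
  part every event has subevents of all intermediate measures.\<close>

lemma ternary_code:
  fixes B :: "nat \<Rightarrow> 'a set"
  assumes "\<And>i. B i \<in> sets M"
  shows "\<exists>\<theta> :: 'a \<Rightarrow> real. \<theta> \<in> borel_measurable M \<and> (\<forall>x y i. \<theta> x = \<theta> y \<longrightarrow> (x \<in> B i \<longleftrightarrow> y \<in> B i))"
proof -
  define \<theta> where "\<theta> = (\<lambda>x. \<Sum>i. indicator (B i) x * (1/3) ^ i :: real)"
  have geo: "summable (\<lambda>i. (1/3::real) ^ i)" by (simp add: summable_geometric)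
  have sm: "summable (\<lambda>i. indicator (B i) x * (1/3) ^ i :: real)" for x
    by (rule summable_comparison_test'[OF geo]) (auto simp: indicator_def)
  have "x \<in> B i \<longleftrightarrow> y \<in> B i" if eq: "\<theta> x = \<theta> y" for x y i
  proof (rule ccontr)
    assume "\<not> (x \<in> B i \<longleftrightarrow> y \<in> B i)"
    then have ex: "\<exists>i. (x \<in> B i) \<noteq> (y \<in> B i)" by blast
    \<comment> \<open>At the first disagreement the term has size \<open>(1/3) ^ n\<close>, while
      all later terms add up to at most half of that; base 3 thus rules out the double expansions of
      base 2.\<close>
    define n where "n = (LEAST i. (x \<in> B i) \<noteq> (y \<in> B i))"
    have n: "(x \<in> B n) \<noteq> (y \<in> B n)" unfolding n_def using ex by (rule LeastI_ex)
    have less: "(x \<in> B j) = (y \<in> B j)" if "j < n" for j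
      using not_less_Least[of j "\<lambda>i. (x \<in> B i) \<noteq> (y \<in> B i)"] that unfolding n_def by blast
    define d where "d = (\<lambda>i. (indicator (B i) x - indicator (B i) y) * (1/3::real) ^ i)"
    have sd: "summable d"
      unfolding d_def left_diff_distrib by (intro summable_diff sm)
    have "suminf d = \<theta> x - \<theta> y"
      unfolding d_def left_diff_distrib \<theta>_def by (rule suminf_diff[symmetric]; rule sm)
    then have "suminf d = 0" using eq by simp
    moreover have "suminf d = (\<Sum>i. d (i + Suc n)) + (\<Sum>i<Suc n. d i)"
      by (rule suminf_split_initial_segment[OF sd])
    moreover have "(\<Sum>i<Suc n. d i) = d n"
      using less by (simp add: d_def indicator_def)
    moreover have "\<bar>d n\<bar> = (1/3) ^ n" using n by (auto simp: d_def indicator_def)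
    moreover have "\<bar>\<Sum>i. d (i + Suc n)\<bar> \<le> (\<Sum>i. (1/3) ^ (i + Suc n))"
    proof -
      have s: "summable (\<lambda>i. (1/3::real) ^ (i + Suc n))"
        using geo by (subst summable_iff_shift)
      have le: "\<bar>d i\<bar> \<le> (1/3) ^ i" for i by (auto simp: d_def indicator_def)
      have sa: "summable (\<lambda>i. \<bar>d (i + Suc n)\<bar>)"
        by (rule summable_comparison_test'[OF s, of 0]) (simp only: real_norm_def abs_abs le)
      have "\<bar>\<Sum>i. d (i + Suc n)\<bar> \<le> (\<Sum>i. \<bar>d (i + Suc n)\<bar>)"
        by (rule summable_rabs[OF sa])
      also have "\<dots> \<le> (\<Sum>i. (1/3) ^ (i + Suc n))"
        by (rule suminf_le[OF _ sa s]) (rule le)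
      finally show ?thesis .
    qed
    moreover have "(\<Sum>i. (1/3::real) ^ (i + Suc n)) = (1/3) ^ Suc n * (3/2)"
    proof -
      have "(\<Sum>i. (1/3::real) ^ i * (1/3) ^ Suc n) = (\<Sum>i. (1/3) ^ i) * (1/3) ^ Suc n"
        by (rule suminf_mult2[OF geo, symmetric])
      then show ?thesis
        unfolding power_add using suminf_geometric[of "1/3::real"] by simp
    qed
    moreover have "(1/3::real) ^ n > 0" by simp
    moreover have "False" if "t = 0" "t = a + b" "b = b'" "\<bar>b'\<bar> = p" "\<bar>a\<bar> \<le> S" "S = (1/3 * p) * (3/2)" "p > 0"
      for t a b b' p S :: real using that by linarith
    ultimately show False unfolding power_Suc by blast
  qed
  moreover have "\<theta> \<in> borel_measurable M"
    unfolding \<theta>_def using assms by measurable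
  ultimately show ?thesis by blast
qed

text \<open>The list grows at its head, so the head decides membership in the set with the largest
  index, and reading by index needs \<open>rev\<close>. This order lets \<open>pattern\<close> and
  \<open>split_cell\<close> follow the same recursion.\<close>

fun pattern :: "'a set \<Rightarrow> (nat \<Rightarrow> 'a set) \<Rightarrow> bool list \<Rightarrow> 'a set" where
  "pattern X B [] = X"
| "pattern X B (b # \<sigma>) = {x \<in> pattern X B \<sigma>. (x \<in> B (length \<sigma>)) = b}"

text \<open>A binary tree of sets parallel to \<open>pattern\<close>, but with prescribed measures:
  the selector \<open>sp\<close> cuts from a cell a piece meant to have measure
  \<open>k (True # \<sigma>)\<close>, and the \<open>False\<close> child is what remains.\<close>

fun split_cell :: "('a set \<Rightarrow> real \<Rightarrow> 'a set) \<Rightarrow> 'a set \<Rightarrow> (bool list \<Rightarrow> real) \<Rightarrow> bool list \<Rightarrow> 'a set" where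
  "split_cell sp Z k [] = Z"
| "split_cell sp Z k (b # \<sigma>) =
     (let C = split_cell sp Z k \<sigma>; E = sp C (k (True # \<sigma>)) in if b then E else C - E)"

lemma sets_pattern:
  assumes "X \<in> sets M" "\<And>i. B i \<in> sets M" shows "pattern X B \<sigma> \<in> sets M"
proof (induction \<sigma>)
  case (Cons b \<sigma>)
  have "pattern X B (b # \<sigma>) = (if b then pattern X B \<sigma> \<inter> B (length \<sigma>) else pattern X B \<sigma> - B (length \<sigma>))"
    by auto
  then show ?case using Cons assms by auto
qed (use assms in simp)

lemma pattern_eq: "pattern X B \<sigma> = {x \<in> X. \<forall>i < length \<sigma>. (x \<in> B i) = rev \<sigma> ! i}"
  by (induction \<sigma>) (auto simp: nth_append less_Suc_eq)

lemma mem_pattern_cong: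
  assumes "\<And>i. i < length \<sigma> \<Longrightarrow> (x \<in> B i) = (x \<in> B' i)"
  shows "x \<in> pattern X B \<sigma> \<longleftrightarrow> x \<in> pattern X B' \<sigma>"
  using assms by (auto simp: pattern_eq)


lemma split_cell_Cons_subset:
  assumes "\<And>C c. sp C c \<subseteq> C"
  shows "split_cell sp Z k (b # \<sigma>) \<subseteq> split_cell sp Z k \<sigma>"
proof (cases b)
  case True
  then show ?thesis using assms by (simp add: Let_def)
qed (simp add: Let_def)

text \<open>Siblings are disjoint and children lie in their parents. Disjointness at equal depth
  later allows one set per depth, the union of all \<open>True\<close> children, to recover every
  cell.\<close>

lemma split_cell_disjoint:
  assumes "x \<in> split_cell sp Z k \<sigma>" "x \<in> split_cell sp Z k \<tau>" "length \<sigma> = length \<tau>"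
    and sp: "\<And>C c. sp C c \<subseteq> C"
  shows "\<sigma> = \<tau>"
  using assms(1-3)
proof (induction \<sigma> arbitrary: \<tau>)
  case (Cons b \<sigma>)
  then obtain b' \<tau>' where \<tau>: "\<tau> = b' # \<tau>'" by (cases \<tau>) auto
  have "x \<in> split_cell sp Z k \<sigma>" "x \<in> split_cell sp Z k \<tau>'"
    using Cons.prems(1,2) split_cell_Cons_subset[of sp, OF sp] unfolding \<tau> by blast+
  then have eq: "\<sigma> = \<tau>'" by (rule Cons.IH) (use Cons.prems(3) \<tau> in simp)
  have "b = b'"
  proof (rule ccontr)
    assume "b \<noteq> b'"
    then show False
      using Cons.prems(1,2) unfolding \<tau> eq by (cases b; cases b') (simp_all add: Let_def)
  qed
  with eq show ?case unfolding \<tau> by simp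
qed simp

text \<open>Almost everywhere off the atoms of the law of \<open>l\<close>, membership in \<open>B m i\<close> settles, which defines the limit
  sets there. On a level set of positive measure only the measures of the patterns converge along a subsequence;
  there the limit sets are obtained by successively splitting the non-settling part into pieces of the limiting measures.\<close>

lemma realize_limit:
  fixes M :: "'w measure" and l :: "'w \<Rightarrow> real" and B :: "nat \<Rightarrow> nat \<Rightarrow> 'w set"
  assumes fin: "finite_measure M" and l[measurable]: "l \<in> borel_measurable M"
    and B: "\<And>m i. B m i \<in> sets M"
    and conv: "AE x in M. measure M {y \<in> space M. l y = l x} = 0 \<longrightarrow>
      (\<forall>i. \<exists>n. (\<forall>m\<ge>n. x \<in> B m i) \<or> (\<forall>m\<ge>n. x \<notin> B m i))"
  shows "\<exists>(r :: nat \<Rightarrow> nat) B'. strict_mono r \<and> (\<forall>i. B' i \<in> sets M) \<and>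
    (\<forall>N a \<sigma> J. finite_measure N \<longrightarrow> sets N = sets M \<longrightarrow> absolutely_continuous M N \<longrightarrow>
       (\<forall>c S. S \<in> sets M \<longrightarrow> S \<subseteq> {x \<in> space M. l x = c} \<longrightarrow> measure N S = a c * measure M S) \<longrightarrow>
       J \<in> sets borel \<longrightarrow>
       (\<lambda>m. measure N (pattern {x \<in> space M. l x \<in> J} (B (r m)) \<sigma>))
         \<longlonglongrightarrow> measure N (pattern {x \<in> space M. l x \<in> J} B' \<sigma>))"
proof -
  interpret finite_measure M by fact
  define L where "L = (\<lambda>c. {x \<in> space M. l x = c})"
  have L[measurable]: "L c \<in> sets M" for c unfolding L_def by measurable
  define At where "At = {c. measure M (L c) \<noteq> 0}"
  have level: "countable {y. measure M {x \<in> space M. g x = y} \<noteq> 0}"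
    if [measurable]: "g \<in> borel_measurable M" for g :: "'w \<Rightarrow> real"
  proof -
    interpret D: finite_measure "distr M borel g" by (rule finite_measure_distr) fact
    have "measure (distr M borel g) {y} = measure M {x \<in> space M. g x = y}" for y
      by (subst measure_distr) (auto intro!: arg_cong[where f = "measure M"])
    then show ?thesis using D.countable_support by simp
  qed
  have cAt: "countable At" unfolding At_def L_def by (rule level) fact
  \<comment> \<open>One real function codes all the sets \<open>B m i\<close> at once: points of a
    level set of \<open>\<theta>\<close> are treated alike by all of them.\<close>
  obtain \<theta> :: "'w \<Rightarrow> real" where \<theta>[measurable]: "\<theta> \<in> borel_measurable M"
    and \<theta>B: "\<And>x y m i. \<theta> x = \<theta> y \<Longrightarrow> x \<in> B m i \<longleftrightarrow> y \<in> B m i"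
  proof -
    define Bk where "Bk = (\<lambda>k. case prod_decode k of (m, i) \<Rightarrow> B m i)"
    have "Bk k \<in> sets M" for k using B by (auto simp: Bk_def split: prod.splits)
    then obtain \<theta> :: "'w \<Rightarrow> real" where \<theta>: "\<theta> \<in> borel_measurable M"
      and *: "\<And>x y i. \<theta> x = \<theta> y \<Longrightarrow> x \<in> Bk i \<longleftrightarrow> y \<in> Bk i"
      using ternary_code[of Bk M] by blast
    have "x \<in> B m i \<longleftrightarrow> y \<in> B m i" if "\<theta> x = \<theta> y" for x y m i
      using *[OF that, of "prod_encode (m, i)"] by (simp add: Bk_def)
    with \<theta> show ?thesis by (rule that)
  qed
  define D where "D = {y. measure M {x \<in> space M. \<theta> x = y} \<noteq> 0}"
  have cD: "countable D" unfolding D_def by (rule level) fact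
  have "\<exists>x \<in> space M. \<theta> x = y" if "y \<in> D" for y
  proof (rule ccontr)
    assume "\<not> ?thesis"
    then have "{x \<in> space M. \<theta> x = y} = {}" by blast
    then have "measure M {x \<in> space M. \<theta> x = y} = 0" by (simp only: measure_empty)
    then show False using that by (simp add: D_def)
  qed
  then obtain w where w: "\<And>y. y \<in> D \<Longrightarrow> \<theta> (w y) = y" by metis
  \<comment> \<open>Countably many bounded sequences are to converge along one subsequence: the
    decisions at a representative of each atom of \<open>\<theta>\<close>, and the measures of all
    patterns on each level set of \<open>l\<close> of positive measure.\<close>
  define S :: "(nat \<times> real + bool list \<times> real) set" where "S = Inl ` (UNIV \<times> D) \<union> Inr ` (UNIV \<times> At)"
  define f :: "nat \<Rightarrow> nat \<times> real + bool list \<times> real \<Rightarrow> real" where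
    "f = (\<lambda>m. case_sum (\<lambda>(i, y). indicator (B m i) (w y)) (\<lambda>(\<sigma>, c). measure M (pattern (L c) (B m) \<sigma>)))"
  have "countable S" unfolding S_def by (intro countable_Un countable_image countable_SIGMA cD cAt) auto
  moreover have "norm (f m x) \<le> max 1 (measure M (space M))" for m x
    by (auto simp: f_def indicator_def bounded_measure le_max_iff_disj split: sum.splits)
  ultimately obtain r :: "nat \<Rightarrow> nat" where r: "strict_mono r"
    and rlim: "\<And>x. x \<in> S \<Longrightarrow> \<exists>y. (\<lambda>n. f (r n) x) \<longlonglongrightarrow> y"
    using function_convergent_subsequence[of S f "max 1 (measure M (space M))"] by metis
  define C where "C = (\<lambda>m. B (r m))"
  have C[measurable]: "C m i \<in> sets M" for m i unfolding C_def by (rule B)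
  have bits: "(\<exists>n. \<forall>m\<ge>n. w y \<in> C m i) \<or> (\<exists>n. \<forall>m\<ge>n. w y \<notin> C m i)" if "y \<in> D" for y i
  proof -
    have "Inl (i, y) \<in> S" using that by (auto simp: S_def)
    from rlim[OF this] obtain b where b: "(\<lambda>n. indicator (C n i) (w y)) \<longlonglongrightarrow> (b :: real)"
      by (auto simp: f_def C_def)
    have "eventually (\<lambda>n. dist (indicator (C n i) (w y)) b < 1/2) sequentially"
      using b by (rule tendstoD) simp
    then obtain n where n: "\<And>m. m \<ge> n \<Longrightarrow> dist (indicator (C m i) (w y)) b < 1/2"
      by (auto simp: eventually_sequentially)
    show ?thesis
    proof (cases "w y \<in> C n i")
      case True
      then have "w y \<in> C m i" if "m \<ge> n" for m
        using n[OF that] n[of n] by (cases "w y \<in> C m i") (auto simp: dist_real_def abs_if split: if_splits)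
      then show ?thesis by blast
    next
      case False
      then have "w y \<notin> C m i" if "m \<ge> n" for m
        using n[OF that] n[of n] by (cases "w y \<in> C m i") (auto simp: dist_real_def abs_if split: if_splits)
      then show ?thesis by blast
    qed
  qed
  \<comment> \<open>\<open>W\<close> holds the points whose memberships all settle, \<open>I\<close>
    records the limits, and \<open>Z\<close> is the rest.\<close>
  define W where "W = {x \<in> space M. \<forall>i. (\<exists>n. \<forall>m\<ge>n. x \<in> C m i) \<or> (\<exists>n. \<forall>m\<ge>n. x \<notin> C m i)}"
  define I where "I = (\<lambda>i. {x \<in> space M. \<exists>n. \<forall>m\<ge>n. x \<in> C m i})"
  have W[measurable]: "W \<in> sets M" unfolding W_def by measurable
  have I[measurable]: "I i \<in> sets M" for i unfolding I_def by measurable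
  define Z where "Z = space M - W"
  have Z[measurable]: "Z \<in> sets M" unfolding Z_def by measurable
  have evI: "eventually (\<lambda>m. x \<in> C m i \<longleftrightarrow> x \<in> I i) sequentially" if "x \<in> W" for x i
  proof -
    from that have x: "x \<in> space M" and "(\<exists>n. \<forall>m\<ge>n. x \<in> C m i) \<or> (\<exists>n. \<forall>m\<ge>n. x \<notin> C m i)"
      by (auto simp: W_def)
    then show ?thesis
    proof (elim disjE exE)
      fix n assume "\<forall>m\<ge>n. x \<in> C m i"
      then have "x \<in> I i" using x by (auto simp: I_def)
      then show ?thesis using \<open>\<forall>m\<ge>n. x \<in> C m i\<close> by (auto simp: eventually_sequentially)
    next
      fix n assume n: "\<forall>m\<ge>n. x \<notin> C m i"
      have "x \<notin> I i" unfolding I_def using n by (auto simp: not_all) (metis max.cobounded1 max.cobounded2)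
      then show ?thesis using n by (auto simp: eventually_sequentially)
    qed
  qed
  have evpat: "eventually (\<lambda>m. x \<in> pattern X (C m) \<sigma> \<longleftrightarrow> x \<in> pattern X I \<sigma>) sequentially" if "x \<in> W" for x X \<sigma>
  proof -
    have "eventually (\<lambda>m. \<forall>i\<in>{..<length \<sigma>}. x \<in> C m i \<longleftrightarrow> x \<in> I i) sequentially"
      by (intro eventually_ball_finite) (use evI[OF that] in auto)
    then show ?thesis by eventually_elim (rule mem_pattern_cong, simp)
  qed
  have patC[measurable]: "pattern X (C m) \<sigma> \<in> sets M" if "X \<in> sets M" for X m \<sigma>
    using that by (rule sets_pattern) simp
  \<comment> \<open>Every point of an atom of \<open>\<theta>\<close> behaves like its
    representative, which settles along the subsequence. The atom therefore lies in
    \<open>W\<close>, and \<open>\<theta>\<close> has no atom on \<open>Z\<close>.\<close>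
  have null: "measure M (Z \<inter> {x \<in> space M. \<theta> x = y}) = 0" for y
  proof (cases "y \<in> D")
    case True
    have "x \<in> W" if "x \<in> space M" "\<theta> x = y" for x
    proof -
      have "x \<in> C m i \<longleftrightarrow> w y \<in> C m i" for m i
        unfolding C_def by (rule \<theta>B) (simp add: w[OF True] that)
      then show ?thesis using bits[OF True] that(1) by (simp add: W_def)
    qed
    then have "Z \<inter> {x \<in> space M. \<theta> x = y} = {}" by (auto simp: Z_def)
    then show ?thesis by simp
  next
    case False
    then have "measure M {x \<in> space M. \<theta> x = y} = 0" by (simp add: D_def)
    moreover have "measure M (Z \<inter> {x \<in> space M. \<theta> x = y}) \<le> measure M {x \<in> space M. \<theta> x = y}"
      by (intro finite_measure_mono) auto
    ultimately show ?thesis using measure_nonneg[of M] by (metis order_antisym)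
  qed
  define Zc where "Zc = (\<lambda>c. Z \<inter> L c)"
  have Zc[measurable]: "Zc c \<in> sets M" for c unfolding Zc_def by measurable
  \<comment> \<open>On the whole level set the measure converges by the choice of \<open>r\<close>,
    on its part in \<open>W\<close> because memberships settle there; the difference is the part in
    \<open>Z\<close>.\<close>
  have "\<exists>k. (\<lambda>m. measure M (pattern (Zc c) (C m) \<sigma>)) \<longlonglongrightarrow> k" if "c \<in> At" for c \<sigma>
  proof -
    have "Inr (\<sigma>, c) \<in> S" using that by (auto simp: S_def)
    from rlim[OF this] obtain a where a: "(\<lambda>m. measure M (pattern (L c) (C m) \<sigma>)) \<longlonglongrightarrow> a"
      by (auto simp: f_def C_def)
    have b: "(\<lambda>m. measure M (pattern (L c) (C m) \<sigma> \<inter> W)) \<longlonglongrightarrow> measure M (pattern (L c) I \<sigma> \<inter> W)"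
      by (rule measure_Int_tendsto[OF fin]) (use evpat in \<open>auto intro: sets_pattern\<close>)
    have "measure M (pattern (Zc c) (C m) \<sigma>) = measure M (pattern (L c) (C m) \<sigma>) - measure M (pattern (L c) (C m) \<sigma> \<inter> W)" for m
    proof -
      have "pattern (Zc c) (C m) \<sigma> = pattern (L c) (C m) \<sigma> - pattern (L c) (C m) \<sigma> \<inter> W"
        by (auto simp: pattern_eq Zc_def Z_def L_def)
      then show ?thesis by (simp add: finite_measure_Diff)
    qed
    then show ?thesis using tendsto_diff[OF a b] by auto
  qed
  then obtain k where k: "\<And>c \<sigma>. c \<in> At \<Longrightarrow> (\<lambda>m. measure M (pattern (Zc c) (C m) \<sigma>)) \<longlonglongrightarrow> k c \<sigma>"
    by metis
  have k_nonneg: "k c \<sigma> \<ge> 0" if "c \<in> At" for c \<sigma>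
    by (rule LIMSEQ_le_const[OF k[OF that]]) auto
  have k_split: "k c \<sigma> = k c (True # \<sigma>) + k c (False # \<sigma>)" if "c \<in> At" for c \<sigma>
  proof -
    have "measure M (pattern (Zc c) (C m) \<sigma>) =
        measure M (pattern (Zc c) (C m) (True # \<sigma>)) + measure M (pattern (Zc c) (C m) (False # \<sigma>))" for m
    proof -
      have "measure M (pattern (Zc c) (C m) (True # \<sigma>) \<union> pattern (Zc c) (C m) (False # \<sigma>)) =
          measure M (pattern (Zc c) (C m) (True # \<sigma>)) + measure M (pattern (Zc c) (C m) (False # \<sigma>))"
        by (intro finite_measure_Union patC Zc) auto
      moreover have "pattern (Zc c) (C m) (True # \<sigma>) \<union> pattern (Zc c) (C m) (False # \<sigma>) = pattern (Zc c) (C m) \<sigma>"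
        by auto
      ultimately show ?thesis by simp
    qed
    then have "(\<lambda>m. measure M (pattern (Zc c) (C m) \<sigma>)) \<longlonglongrightarrow> k c (True # \<sigma>) + k c (False # \<sigma>)"
      using tendsto_add[OF k[OF that, of "True # \<sigma>"] k[OF that, of "False # \<sigma>"]] by (simp only:)
    with k[OF that] show ?thesis by (rule LIMSEQ_unique)
  qed
  have k_Nil: "k c [] = measure M (Zc c)" if "c \<in> At" for c
    using k[OF that, of "[]"] by (simp add: LIMSEQ_const_iff)
  \<comment> \<open>The value \<open>{}\<close> in the impossible case keeps the selected piece
    measurable and inside \<open>E\<close> for all arguments.\<close>
  define sp where "sp = (\<lambda>E c. if \<exists>E' \<in> sets M. E' \<subseteq> E \<and> measure M E' = c
      then SOME E'. E' \<in> sets M \<and> E' \<subseteq> E \<and> measure M E' = c else {})"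
  have sp: "sp E c \<in> sets M \<and> sp E c \<subseteq> E" for E c
    using someI_ex[of "\<lambda>E'. E' \<in> sets M \<and> E' \<subseteq> E \<and> measure M E' = c"] unfolding sp_def Bex_def by simp
  have sp_measure: "measure M (sp E c) = c" if "E \<in> sets M" "E \<subseteq> Z" "0 \<le> c" "c \<le> measure M E" for E c
  proof -
    have "measure M (E \<inter> {x \<in> space M. \<theta> x = y}) = 0" for y
    proof -
      have "measure M (E \<inter> {x \<in> space M. \<theta> x = y}) \<le> measure M (Z \<inter> {x \<in> space M. \<theta> x = y})"
        using that by (intro finite_measure_mono) auto
      then show ?thesis using null[of y] measure_nonneg[of M] by (metis order_antisym)
    qed
    then have "\<exists>E' \<in> sets M. E' \<subseteq> E \<and> measure M E' = c"
      using that by (intro exists_subset_measure_eq[OF \<theta>]) auto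
    then show ?thesis
      using someI_ex[of "\<lambda>E'. E' \<in> sets M \<and> E' \<subseteq> E \<and> measure M E' = c"] unfolding sp_def Bex_def by simp
  qed
  define cell where "cell = (\<lambda>c \<sigma>. split_cell sp (Zc c) (k c) \<sigma>)"
  have cell_sets: "cell c \<sigma> \<in> sets M \<and> cell c \<sigma> \<subseteq> Zc c" for c \<sigma>
  proof (induction \<sigma>)
    case (Cons b \<sigma>)
    then show ?case using sp[of "cell c \<sigma>" "k c (True # \<sigma>)"]
      by (auto simp: cell_def Let_def)
  qed (auto simp: cell_def)
  have cell_measure: "measure M (cell c \<sigma>) = k c \<sigma>" if "c \<in> At" for c \<sigma>
  proof (induction \<sigma>)
    case Nil
    then show ?case using k_Nil[OF that] by (simp add: cell_def)
  next
    case (Cons b \<sigma>)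
    have T: "measure M (sp (cell c \<sigma>) (k c (True # \<sigma>))) = k c (True # \<sigma>)"
      using cell_sets[of c \<sigma>] k_nonneg[OF that] k_split[OF that, of \<sigma>] Cons
      by (intro sp_measure) (auto simp: Zc_def)
    then have "measure M (cell c \<sigma> - sp (cell c \<sigma>) (k c (True # \<sigma>))) = k c (False # \<sigma>)"
      using sp[of "cell c \<sigma>" "k c (True # \<sigma>)"] cell_sets[of c \<sigma>] k_split[OF that, of \<sigma>] Cons
      by (subst finite_measure_Diff) auto
    with T show ?case by (cases b) (auto simp: cell_def Let_def)
  qed
  \<comment> \<open>On \<open>W\<close> membership is the pointwise limit. Elsewhere it is the
    branch taken at depth \<open>i\<close> of the tree over the level set to which the point
    belongs.\<close>
  define B' where "B' = (\<lambda>i. (W \<inter> I i) \<union> (\<Union>c\<in>At. \<Union>\<sigma>\<in>{\<sigma>. length \<sigma> = i}. cell c (True # \<sigma>)))"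
  have B'[measurable]: "B' i \<in> sets M" for i
  proof -
    have "finite {\<sigma> :: bool list. length \<sigma> = i}" using finite_lists_length_eq[of "UNIV :: bool set" i] by simp
    then show ?thesis unfolding B'_def
      using cell_sets by (intro sets.Un sets.countable_UN''[OF cAt] sets.finite_UN) auto
  qed
  have B'W: "x \<in> B' i \<longleftrightarrow> x \<in> I i" if "x \<in> W" for x i
    using that cell_sets by (auto simp: B'_def Zc_def Z_def)
  have pat_cell: "pattern (Zc c) B' \<sigma> = cell c \<sigma>" if c: "c \<in> At" for c \<sigma>
  proof (induction \<sigma>)
    case Nil
    then show ?case by (simp add: cell_def)
  next
    case (Cons b \<sigma>)
    have mem: "x \<in> B' (length \<sigma>) \<longleftrightarrow> x \<in> cell c (True # \<sigma>)" if x: "x \<in> cell c \<sigma>" for x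
    proof
      assume "x \<in> B' (length \<sigma>)"
      moreover have "x \<notin> W" and lx: "l x = c" using x cell_sets[of c \<sigma>] by (auto simp: Zc_def Z_def L_def)
      ultimately obtain d \<tau> where \<tau>: "length \<tau> = length \<sigma>" "x \<in> cell d (True # \<tau>)"
        by (auto simp: B'_def)
      then have "d = c" using cell_sets[of d "True # \<tau>"] lx by (auto simp: Zc_def L_def)
      have "x \<in> cell c \<tau>"
        using \<tau>(2) split_cell_Cons_subset[of sp "Zc c" "k c" True \<tau>] sp unfolding cell_def \<open>d = c\<close> by blast
      then have "\<tau> = \<sigma>"
        using x \<tau>(1) sp unfolding cell_def by (intro split_cell_disjoint) auto
      with \<tau> \<open>d = c\<close> show "x \<in> cell c (True # \<sigma>)" by simp
    next
      assume "x \<in> cell c (True # \<sigma>)"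
      then show "x \<in> B' (length \<sigma>)" using c by (auto simp: B'_def)
    qed
    have "cell c (b # \<sigma>) = {x \<in> cell c \<sigma>. (x \<in> cell c (True # \<sigma>)) = b}"
      using sp[of "cell c \<sigma>" "k c (True # \<sigma>)"] by (cases b) (auto simp: cell_def Let_def)
    then show ?case using Cons mem by auto
  qed
  \<comment> \<open>On \<open>W\<close> memberships settle. On \<open>Z\<close> only measures under
    \<open>M\<close> are controlled, and \<open>N\<close> is a multiple of \<open>M\<close> on each
    level set with a factor depending on the level; hence the summation over levels.\<close>
  have main: "(\<lambda>m. measure N (pattern {x \<in> space M. l x \<in> J} (C m) \<sigma>))
         \<longlonglongrightarrow> measure N (pattern {x \<in> space M. l x \<in> J} B' \<sigma>)"
    if N: "finite_measure N" "sets N = sets M" "absolutely_continuous M N"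
      and a: "\<And>c S. S \<in> sets M \<Longrightarrow> S \<subseteq> L c \<Longrightarrow> measure N S = a c * measure M S"
      and J[measurable]: "J \<in> sets borel" for N a \<sigma> J
  proof -
    interpret N: finite_measure N by fact
    note N(2)[measurable_cong]
    have spN: "space N = space M" using N(2) by (rule sets_eq_imp_space_eq)
    define X where "X = {x \<in> space M. l x \<in> J}"
    have X[measurable]: "X \<in> sets M" unfolding X_def by measurable
    have patB'[measurable]: "pattern X B' \<sigma> \<in> sets M" by (rule sets_pattern) auto
    have "AE x in M. x \<in> Z \<longrightarrow> l x \<in> At"
      using conv AE_space
    proof eventually_elim
      case (elim x)
      show ?case
      proof (rule impI, rule ccontr)
        assume x: "x \<in> Z" "l x \<notin> At"
        then have "\<forall>i. \<exists>n. (\<forall>m\<ge>n. x \<in> B m i) \<or> (\<forall>m\<ge>n. x \<notin> B m i)"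
          using elim by (simp add: At_def L_def)
        then have "x \<in> W"
          unfolding W_def C_def using elim(2) seq_suble[OF r] by (auto) (metis order_trans)
        with x show False by (simp add: Z_def)
      qed
    qed
    then have AEN: "AE x in N. x \<in> Z \<longrightarrow> l x \<in> At"
      by (rule absolutely_continuous_AE[OF N(2,3)])
    have WB': "x \<in> pattern X B' \<sigma> \<longleftrightarrow> x \<in> pattern X I \<sigma>" if "x \<in> W" for x
      by (rule mem_pattern_cong) (rule B'W[OF that])
    have 1: "(\<lambda>m. measure N (pattern X (C m) \<sigma> \<inter> W)) \<longlonglongrightarrow> measure N (pattern X B' \<sigma> \<inter> W)"
      by (rule measure_Int_tendsto[OF N(1)]) (use evpat WB' in \<open>auto simp: N(2)\<close>)
    define e where "e = to_nat_on At"
    have e_inj: "inj_on e At" unfolding e_def by (rule inj_on_to_nat_on[OF cAt])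
    define Q where "Q = (\<lambda>n. {x \<in> Z. l x \<in> At \<and> e (l x) = n})"
    have Q1: "Q (e c) = Zc c" if "c \<in> At" for c
      using that e_inj by (auto simp: Q_def Zc_def L_def Z_def dest: inj_onD)
    have Q2: "Q n = {}" if "n \<notin> e ` At" for n using that by (auto simp: Q_def)
    have Q[measurable]: "Q n \<in> sets M" for n
      by (cases "n \<in> e ` At") (auto simp: Q1 Q2)
    have disj: "disjoint_family (\<lambda>n. S \<inter> Q n)" for S by (auto simp: disjoint_family_on_def Q_def)
    have sums: "(\<lambda>n. measure N (S \<inter> Q n)) sums measure N (S \<inter> Z)" if [measurable]: "S \<in> sets M" for S
    proof -
      have "(\<lambda>n. measure N (S \<inter> Q n)) sums measure N (\<Union>n. S \<inter> Q n)"
        by (rule N.finite_measure_UNION[OF _ disj]) (auto simp: N(2))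
      also have "measure N (\<Union>n. S \<inter> Q n) = measure N (S \<inter> Z)"
      proof (rule N.finite_measure_eq_AE)
        show "AE x in N. (x \<in> (\<Union>n. S \<inter> Q n)) = (x \<in> S \<inter> Z)"
          using AEN by eventually_elim (auto simp: Q_def)
      qed (auto simp: N(2) intro!: sets.countable_UN)
      finally show ?thesis .
    qed
    have patQ: "pattern X D \<sigma> \<inter> Q (e c) = (if c \<in> J then pattern (Zc c) D \<sigma> else {})"
      if "c \<in> At" for c D
      using that by (auto simp: Q1 pattern_eq X_def Zc_def L_def Z_def)
    have lim: "(\<lambda>m. measure N (pattern X (C m) \<sigma> \<inter> Q n)) \<longlonglongrightarrow> measure N (pattern X B' \<sigma> \<inter> Q n)" for n
    proof (cases "n \<in> e ` At")
      case True
      then obtain c where c: "c \<in> At" "n = e c" by blast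
      have sub: "pattern (Zc c) D \<sigma> \<subseteq> L c" for D by (auto simp: pattern_eq Zc_def)
      have "(\<lambda>m. a c * measure M (pattern (Zc c) (C m) \<sigma>)) \<longlonglongrightarrow> a c * k c \<sigma>"
        by (intro tendsto_mult_left k c)
      then have "(\<lambda>m. measure N (pattern (Zc c) (C m) \<sigma>)) \<longlonglongrightarrow> measure N (pattern (Zc c) B' \<sigma>)"
        using a[OF _ sub] cell_measure[OF c(1)] cell_sets[of c \<sigma>] pat_cell[OF c(1), of \<sigma>]
        by (simp add: sets_pattern) (metis sub)
      then show ?thesis unfolding c(2) patQ[OF c(1)] by simp
    qed (simp add: Q2)
    have bound: "norm (measure N (pattern X (C m) \<sigma> \<inter> Q n)) \<le> measure N (space M \<inter> Q n)" for m n
      using sets.sets_into_space[OF patC[OF X, of m \<sigma>]]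
      by (auto simp: N(2) intro!: N.finite_measure_mono)
    have sm: "summable (\<lambda>n. measure N (space M \<inter> Q n))"
      using sums[OF sets.top] by (rule sums_summable)
    \<comment> \<open>The terms are dominated by the summable measures of the level pieces, so limit
      and series may be exchanged by Tannery's theorem.\<close>
    have 2: "(\<lambda>m. measure N (pattern X (C m) \<sigma> \<inter> Z)) \<longlonglongrightarrow> measure N (pattern X B' \<sigma> \<inter> Z)"
    proof -
      have "eventually (\<lambda>(n, m). norm (measure N (pattern X (C m) \<sigma> \<inter> Q n)) \<le> measure N (space M \<inter> Q n))
          (sequentially \<times>\<^sub>F sequentially)"
        by (rule always_eventually) (use bound in auto)
      from tannerys_theorem[OF lim this sm]
      have "(\<lambda>m. \<Sum>n. measure N (pattern X (C m) \<sigma> \<inter> Q n)) \<longlonglongrightarrow> (\<Sum>n. measure N (pattern X B' \<sigma> \<inter> Q n))"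
        by simp
      then show ?thesis
        unfolding sums_unique[OF sums[OF patC[OF X]], symmetric] sums_unique[OF sums[OF patB'], symmetric] .
    qed
    have split: "measure N (S \<inter> W) + measure N (S \<inter> Z) = measure N S" if [measurable]: "S \<in> sets M" for S
    proof -
      have "measure N (S \<inter> W \<union> S \<inter> Z) = measure N (S \<inter> W) + measure N (S \<inter> Z)"
        by (rule N.finite_measure_Union) (auto simp: N(2) Z_def)
      moreover have "S \<inter> W \<union> S \<inter> Z = S"
        using sets.sets_into_space[OF that] by (auto simp: Z_def)
      ultimately show ?thesis by simp
    qed
    show ?thesis
      using tendsto_add[OF 1 2] unfolding split[OF patC[OF X]] split[OF patB'] X_def[symmetric] .
  qed
  show ?thesis
    by (intro exI[of _ r] exI[of _ B'] conjI allI impI r B' main[unfolded C_def L_def]) blast+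
qed

text \<open>A condition on the first \<open>n\<close> memberships splits its solution set in
  \<open>X\<close> into finitely many disjoint patterns of length \<open>n\<close>.\<close>

lemma tendsto_measure_of_patterns:
  assumes N: "finite_measure N" and [simp]: "sets N = sets M"
    and X: "X \<in> sets M" and C: "\<And>m i. C m i \<in> sets M" and B: "\<And>i. B i \<in> sets M"
    and lim: "\<And>\<sigma>. (\<lambda>m. measure N (pattern X (C m) \<sigma>)) \<longlonglongrightarrow> measure N (pattern X B \<sigma>)"
    and \<Phi>: "\<And>f g. (\<And>i. i < n \<Longrightarrow> f i = g i) \<Longrightarrow> \<Phi> f = \<Phi> g"
  shows "(\<lambda>m. measure N {x \<in> X. \<Phi> (\<lambda>i. x \<in> C m i)}) \<longlonglongrightarrow> measure N {x \<in> X. \<Phi> (\<lambda>i. x \<in> B i)}"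
proof -
  interpret N: finite_measure N by fact
  define S where "S = {\<sigma>. length \<sigma> = n \<and> \<Phi> (\<lambda>i. rev \<sigma> ! i)}"
  have "finite {\<sigma> :: bool list. length \<sigma> = n}" using finite_lists_length_eq[of "UNIV :: bool set" n] by simp
  then have fS: "finite S" unfolding S_def by (rule rev_finite_subset) auto
  have eq: "measure N {x \<in> X. \<Phi> (\<lambda>i. x \<in> D i)} = (\<Sum>\<sigma>\<in>S. measure N (pattern X D \<sigma>))"
    if D: "\<And>i. D i \<in> sets M" for D
  proof -
    have "{x \<in> X. \<Phi> (\<lambda>i. x \<in> D i)} = (\<Union>\<sigma>\<in>S. pattern X D \<sigma>)"
    proof (intro equalityI subsetI)
      fix x assume x: "x \<in> {x \<in> X. \<Phi> (\<lambda>i. x \<in> D i)}"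
      define \<sigma> where "\<sigma> = rev (map (\<lambda>i. x \<in> D i) [0..<n])"
      have "\<Phi> (\<lambda>i. rev \<sigma> ! i) = \<Phi> (\<lambda>i. x \<in> D i)" by (rule \<Phi>) (simp add: \<sigma>_def)
      then have "\<sigma> \<in> S" using x by (simp add: S_def \<sigma>_def)
      moreover have "x \<in> pattern X D \<sigma>" using x by (simp add: pattern_eq \<sigma>_def)
      ultimately show "x \<in> (\<Union>\<sigma>\<in>S. pattern X D \<sigma>)" by blast
    next
      fix x assume "x \<in> (\<Union>\<sigma>\<in>S. pattern X D \<sigma>)"
      then obtain \<sigma> where \<sigma>: "\<sigma> \<in> S" and x: "x \<in> X" "\<And>i. i < length \<sigma> \<Longrightarrow> (x \<in> D i) = rev \<sigma> ! i"
        by (auto simp: pattern_eq)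
      have "\<Phi> (\<lambda>i. x \<in> D i) = \<Phi> (\<lambda>i. rev \<sigma> ! i)" by (rule \<Phi>) (use \<sigma> x in \<open>simp add: S_def\<close>)
      with \<sigma> x(1) show "x \<in> {x \<in> X. \<Phi> (\<lambda>i. x \<in> D i)}" by (simp add: S_def)
    qed
    moreover have "disjoint_family_on (pattern X D) S"
      unfolding disjoint_family_on_def
    proof (intro ballI impI)
      fix \<sigma> \<tau> assume *: "\<sigma> \<in> S" "\<tau> \<in> S" "\<sigma> \<noteq> \<tau>"
      have "rev \<sigma> = rev \<tau>" if "x \<in> pattern X D \<sigma>" "x \<in> pattern X D \<tau>" for x
        using that *(1,2) by (intro nth_equalityI) (auto simp: pattern_eq S_def)
      then show "pattern X D \<sigma> \<inter> pattern X D \<tau> = {}" using * by auto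
    qed
    ultimately show ?thesis
      using N.finite_measure_finite_Union[OF fS, of "pattern X D"] sets_pattern[where B = D, OF X D] by auto
  qed
  show ?thesis
    unfolding eq[OF B] eq[OF C] by (intro tendsto_sum lim)
qed

subsection \<open>States, signals and the gain of an event\<close>

locale signals =
  fixes m0 m1 :: "'w measure"
  assumes prob0: "prob_space m0" and prob1: "prob_space m1" and sets_m1: "sets m1 = sets m0"
    and ac01: "absolutely_continuous m0 m1" and ac10: "absolutely_continuous m1 m0"
begin

definition mu :: "bool \<Rightarrow> 'w measure" where "mu s = (if s then m1 else m0)"

lemma prob_mu: "prob_space (mu s)" using prob0 prob1 by (simp add: mu_def)

lemma sets_mu [simp, measurable_cong]: "sets (mu s) = sets m0" using sets_m1 by (simp add: mu_def)

lemma space_mu [simp]: "space (mu s) = space m0" by (rule sets_eq_imp_space_eq) simp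

definition signal_law :: "nat set \<Rightarrow> bool \<Rightarrow> (nat \<Rightarrow> 'w) measure" where
  "signal_law V s = (\<Pi>\<^sub>M u\<in>V. mu s)"

lemma product_prob_space_mu: "product_prob_space (\<lambda>_ :: nat. mu s)"
  by (intro product_prob_spaceI prob_mu)

lemma prob_signal_law: "prob_space (signal_law V s)"
proof -
  interpret product_prob_space "\<lambda>_ :: nat. mu s" V by (rule product_prob_space_mu)
  show ?thesis unfolding signal_law_def by unfold_locales
qed

lemma sets_signal_law [measurable_cong]: "sets (signal_law V s) = sets (\<Pi>\<^sub>M u\<in>V. m0)"
  unfolding signal_law_def by (intro sets_PiM_cong) auto

lemma space_signal_law: "space (signal_law V s) = (\<Pi>\<^sub>E u\<in>V. space m0)"
  by (simp add: signal_law_def space_PiM)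

abbreviation state_kernel :: "nat set \<Rightarrow> bool \<Rightarrow> 'w outcome measure" where
  "state_kernel V s \<equiv> return (count_space UNIV) s \<Otimes>\<^sub>M signal_law V s"

lemma sets_state_kernel: "sets (state_kernel V s) = sets (count_space (UNIV :: bool set) \<Otimes>\<^sub>M (\<Pi>\<^sub>M u\<in>V. m0))"
  by (intro sets_pair_measure_cong sets_signal_law) simp

lemma world_eq: "world m0 m1 V = measure_pmf (pmf_of_set (UNIV :: bool set)) \<bind> state_kernel V"
  unfolding world_def signal_law_def mu_def by simp

lemma prob_state_kernel: "prob_space (state_kernel V s)"
  by (intro prob_space_pair prob_space_return prob_signal_law) simp

lemma state_kernel_measurable:
  "state_kernel V \<in> measurable (measure_pmf (pmf_of_set (UNIV :: bool set)))
     (subprob_algebra (count_space (UNIV :: bool set) \<Otimes>\<^sub>M (\<Pi>\<^sub>M u\<in>V. m0)))"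
proof -
  have "state_kernel V s \<in> space (subprob_algebra (count_space (UNIV :: bool set) \<Otimes>\<^sub>M (\<Pi>\<^sub>M u\<in>V. m0)))" for s
    using prob_state_kernel[of s V]
    by (simp add: space_subprob_algebra sets_state_kernel prob_space_imp_subprob_space)
  then show ?thesis by simp
qed

lemma sets_world [measurable_cong]:
  "sets (world m0 m1 V) = sets (count_space (UNIV :: bool set) \<Otimes>\<^sub>M (\<Pi>\<^sub>M u\<in>V. m0))"
  unfolding world_eq by (rule sets_bind[OF sets_kernel[OF state_kernel_measurable]]) simp_all

lemma space_world: "space (world m0 m1 V) = UNIV \<times> (\<Pi>\<^sub>E u\<in>V. space m0)"
  using sets_eq_imp_space_eq[OF sets_world] by (simp add: space_pair_measure space_PiM)

lemma prob_world: "prob_space (world m0 m1 V)"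
  unfolding world_eq using prob_state_kernel
  by (intro measure_pmf.prob_space_bind[OF _ state_kernel_measurable]) auto

lemma measure_world:
  assumes E: "E \<in> sets (world m0 m1 V)"
  shows "measure (world m0 m1 V) E =
    (\<Sum>s\<in>UNIV. measure (signal_law V s) {w \<in> space (signal_law V s). (s, w) \<in> E}) / 2"
proof -
  have "emeasure (state_kernel V s) E = emeasure (signal_law V s) {w \<in> space (signal_law V s). (s, w) \<in> E}" for s
  proof -
    interpret S: prob_space "signal_law V s" by (rule prob_signal_law)
    have E': "E \<in> sets (state_kernel V s)" using E by (simp add: sets_state_kernel sets_world)
    have "emeasure (state_kernel V s) E = (\<integral>\<^sup>+x. emeasure (signal_law V s) (Pair x -` E) \<partial>return (count_space UNIV) s)"
      by (rule S.emeasure_pair_measure_alt[OF E'])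
    also have "\<dots> = emeasure (signal_law V s) (Pair s -` E)"
      by (subst nn_integral_return) auto
    also have "Pair s -` E = {w \<in> space (signal_law V s). (s, w) \<in> E}"
      using sets.sets_into_space[OF E] by (auto simp: space_world space_signal_law)
    finally show ?thesis .
  qed
  note k = this
  interpret W: prob_space "world m0 m1 V" by (rule prob_world)
  have "emeasure (world m0 m1 V) E = (\<integral>\<^sup>+s. emeasure (state_kernel V s) E \<partial>measure_pmf (pmf_of_set UNIV))"
    unfolding world_eq
    by (rule emeasure_bind[OF _ state_kernel_measurable]) (use E in \<open>simp_all add: sets_world\<close>)
  also have "\<dots> = (\<Sum>s\<in>UNIV. emeasure (signal_law V s) {w \<in> space (signal_law V s). (s, w) \<in> E}) / 2"
    by (subst nn_integral_pmf_of_set) (simp_all add: k)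
  also have "\<dots> = ennreal ((\<Sum>s\<in>UNIV. measure (signal_law V s) {w \<in> space (signal_law V s). (s, w) \<in> E}) / 2)"
  proof -
    have "emeasure (signal_law V s) A = ennreal (measure (signal_law V s) A)" for s A
    proof -
      interpret S: prob_space "signal_law V s" by (rule prob_signal_law)
      show ?thesis by (rule S.emeasure_eq_measure)
    qed
    then show ?thesis
      by (simp add: UNIV_bool ennreal_plus[symmetric] divide_ennreal[symmetric] del: ennreal_plus)
  qed
  finally show ?thesis
    by (simp add: W.emeasure_eq_measure sum_nonneg)
qed

text \<open>A joint, not a conditional, probability: each state has total mass 1/2, whence the
  factors 2 in the product formulas.\<close>

definition mass :: "nat set \<Rightarrow> bool \<Rightarrow> 'w outcome set \<Rightarrow> real" where
  "mass V s E = measure (world m0 m1 V) {\<omega> \<in> E. fst \<omega> = s}"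

text \<open>The increase in the probability of acting correctly when action 1 replaces action 0 on
  \<open>E\<close>.\<close>

definition gain :: "nat set \<Rightarrow> 'w outcome set \<Rightarrow> real" where
  "gain V E = mass V True E - mass V False E"

lemma fst_state_sets [measurable]: "{\<omega> \<in> space (world m0 m1 V). fst \<omega> = s} \<in> sets (world m0 m1 V)"
proof -
  have "fst \<in> world m0 m1 V \<rightarrow>\<^sub>M count_space UNIV"
    unfolding measurable_cong_sets[OF sets_world refl] by (rule measurable_fst)
  then show ?thesis by measurable
qed

lemma state_sets:
  assumes "E \<in> sets (world m0 m1 V)" shows "{\<omega> \<in> E. fst \<omega> = s} \<in> sets (world m0 m1 V)"
proof -
  have "{\<omega> \<in> E. fst \<omega> = s} = E \<inter> {\<omega> \<in> space (world m0 m1 V). fst \<omega> = s}"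
    using sets.sets_into_space[OF assms] by auto
  then show ?thesis using assms fst_state_sets by auto
qed

lemma mass_eq:
  assumes E: "E \<in> sets (world m0 m1 V)"
  shows "mass V s E = measure (signal_law V s) {w \<in> space (signal_law V s). (s, w) \<in> E} / 2"
proof -
  have "measure (signal_law V s') {w \<in> space (signal_law V s'). (s', w) \<in> {\<omega> \<in> E. fst \<omega> = s}} =
      (if s' = s then measure (signal_law V s) {w \<in> space (signal_law V s). (s, w) \<in> E} else 0)" for s'
    by auto
  then show ?thesis
    unfolding mass_def measure_world[OF state_sets[OF E]] by (simp add: sum.delta)
qed

lemma mass_nonneg: "mass V s E \<ge> 0" by (simp add: mass_def)

lemma mass_mono: "E \<subseteq> E' \<Longrightarrow> E' \<in> sets (world m0 m1 V) \<Longrightarrow> mass V s E \<le> mass V s E'"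
proof -
  interpret W: prob_space "world m0 m1 V" by (rule prob_world)
  assume "E \<subseteq> E'" "E' \<in> sets (world m0 m1 V)"
  then show ?thesis unfolding mass_def by (intro W.finite_measure_mono state_sets) auto
qed

lemma mass_space: "mass V s (space (world m0 m1 V)) = 1 / 2"
proof -
  interpret S: prob_space "signal_law V s" by (rule prob_signal_law)
  have "{w \<in> space (signal_law V s). (s, w) \<in> space (world m0 m1 V)} = space (signal_law V s)"
    by (auto simp: space_world space_signal_law)
  then show ?thesis by (subst mass_eq) (auto simp: S.prob_space)
qed

lemma mass_le_half: "E \<in> sets (world m0 m1 V) \<Longrightarrow> mass V s E \<le> 1 / 2"
  using mass_mono[of E "space (world m0 m1 V)" V s] sets.sets_into_space mass_space by auto

lemma mass_Un:
  assumes "A \<in> sets (world m0 m1 V)" "B \<in> sets (world m0 m1 V)" "A \<inter> B = {}"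
  shows "mass V s (A \<union> B) = mass V s A + mass V s B"
proof -
  interpret W: prob_space "world m0 m1 V" by (rule prob_world)
  have "{\<omega> \<in> A \<union> B. fst \<omega> = s} = {\<omega> \<in> A. fst \<omega> = s} \<union> {\<omega> \<in> B. fst \<omega> = s}" by auto
  then show ?thesis unfolding mass_def
    using W.finite_measure_Union[OF state_sets state_sets, of A B s s] assms by auto
qed

lemma mass_UN:
  assumes "finite I" "\<And>i. i \<in> I \<Longrightarrow> A i \<in> sets (world m0 m1 V)" "disjoint_family_on A I"
  shows "mass V s (\<Union>i\<in>I. A i) = (\<Sum>i\<in>I. mass V s (A i))"
proof -
  interpret W: prob_space "world m0 m1 V" by (rule prob_world)
  have "{\<omega> \<in> \<Union>i\<in>I. A i. fst \<omega> = s} = (\<Union>i\<in>I. {\<omega> \<in> A i. fst \<omega> = s})" by auto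
  then show ?thesis unfolding mass_def
    using assms state_sets
    by (simp only:) (intro W.finite_measure_finite_Union; fastforce simp: disjoint_family_on_def)
qed

lemma mass_Diff:
  assumes "A \<in> sets (world m0 m1 V)" "B \<in> sets (world m0 m1 V)" "B \<subseteq> A"
  shows "mass V s (A - B) = mass V s A - mass V s B"
proof -
  have "A - B \<union> B = A" "(A - B) \<inter> B = {}" using assms(3) by blast+
  then show ?thesis using mass_Un[of "A - B" V B s] assms(1,2) by simp
qed

lemma measure_eq_mass:
  assumes "E \<in> sets (world m0 m1 V)"
  shows "measure (world m0 m1 V) E = mass V False E + mass V True E"
  unfolding measure_world[OF assms] mass_eq[OF assms] by (simp add: UNIV_bool)

lemma mass_cong_AE:
  assumes "A \<in> sets (world m0 m1 V)" "B \<in> sets (world m0 m1 V)" "AE \<omega> in world m0 m1 V. \<omega> \<in> A \<longleftrightarrow> \<omega> \<in> B"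
  shows "mass V s A = mass V s B"
proof -
  interpret W: prob_space "world m0 m1 V" by (rule prob_world)
  show ?thesis unfolding mass_def
    by (rule W.finite_measure_eq_AE) (use assms state_sets in auto)
qed

lemma mass_diff_le:
  assumes [measurable]: "A \<in> sets (world m0 m1 V)" "B \<in> sets (world m0 m1 V)"
  shows "\<bar>mass V s A - mass V s B\<bar> \<le> measure (world m0 m1 V) (sym_diff A B)"
proof -
  have "A \<inter> B \<union> (A - B) = A" "(A \<inter> B) \<inter> (A - B) = {}" "A \<inter> B \<union> (B - A) = B" "(A \<inter> B) \<inter> (B - A) = {}"
    by blast+
  then have "mass V s A = mass V s (A \<inter> B) + mass V s (A - B)" "mass V s B = mass V s (A \<inter> B) + mass V s (B - A)"
    using mass_Un[of "A \<inter> B" V "A - B" s] mass_Un[of "A \<inter> B" V "B - A" s] assms by (simp_all only: sets.Int sets.Diff)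
  moreover have "measure (world m0 m1 V) (sym_diff A B) \<ge> mass V s (sym_diff A B)"
    using mass_nonneg[of V "\<not> s" "sym_diff A B"] by (cases s) (simp_all add: measure_eq_mass)
  moreover have "mass V s (sym_diff A B) = mass V s (A - B) + mass V s (B - A)"
    by (rule mass_Un) auto
  ultimately show ?thesis using mass_nonneg[of V s "A - B"] mass_nonneg[of V s "B - A"] by linarith
qed

end

text \<open>The events that can be approximated form a \<sigma>-algebra. Complements keep the
  symmetric difference; a countable union is close to a finite one, whose members are approximated
  separately and then, by directedness, within a single member of the family.\<close>

lemma sigma_union_approx:
  assumes "prob_space M" and sub: "\<And>t. t \<in> T \<Longrightarrow> sets (F t) \<subseteq> sets M" and sp: "\<And>t. t \<in> T \<Longrightarrow> space (F t) = space M"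
    and dir: "\<And>t t'. t \<in> T \<Longrightarrow> t' \<in> T \<Longrightarrow> \<exists>u\<in>T. sets (F t) \<subseteq> sets (F u) \<and> sets (F t') \<subseteq> sets (F u)"
    and ne: "T \<noteq> {}"
    and E: "E \<in> sigma_sets (space M) (\<Union>t\<in>T. sets (F t))" and "\<epsilon> > 0"
  shows "\<exists>t\<in>T. \<exists>E'\<in>sets (F t). measure M (sym_diff E E') < \<epsilon>"
  using E \<open>\<epsilon> > 0\<close>
proof (induction arbitrary: \<epsilon> rule: sigma_sets.induct)
  case (Basic a)
  then obtain t where t: "t \<in> T" "a \<in> sets (F t)" by blast
  have "measure M (sym_diff a a) < \<epsilon>" using Basic(2) by simp
  with t show ?case by blast
next
  case Empty
  obtain t where t: "t \<in> T" using ne by blast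
  have "measure M (sym_diff {} {}) < \<epsilon>" using Empty by simp
  with t show ?case by blast
next
  case (Compl a)
  from Compl(2)[OF Compl(3)] obtain t E' where t: "t \<in> T" "E' \<in> sets (F t)" "measure M (sym_diff a E') < \<epsilon>" by blast
  have "space M - E' \<in> sets (F t)" using t sp[OF t(1)] by (metis sets.compl_sets)
  moreover have "E' \<subseteq> space M" using sets.sets_into_space[OF t(2)] sp[OF t(1)] by simp
  moreover have "a \<subseteq> space M"
  proof (rule sigma_sets_into_sp[OF _ Compl(1)])
    show "(\<Union>t\<in>T. sets (F t)) \<subseteq> Pow (space M)" using sub sets.sets_into_space by blast
  qed
  ultimately have "space M - E' \<in> sets (F t)" "sym_diff (space M - a) (space M - E') = sym_diff a E'" by blast+
  then show ?case using t by metis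
next
  case (Union a)
  interpret prob_space M by fact
  have am: "a i \<in> sets M" for i
    using Union(1)[of i] sub sets.sigma_sets_subset[of "\<Union>t\<in>T. sets (F t)" M] by (meson UN_least subsetD)
  have "(\<lambda>n. measure M (\<Union>i<n. a i)) \<longlonglongrightarrow> measure M (\<Union>n. \<Union>i<n. a i)"
  proof (rule finite_Lim_measure_incseq)
    show "incseq (\<lambda>n. \<Union>i<n. a i)" unfolding incseq_def by (intro allI impI UN_mono) auto
  qed (use am in auto)
  moreover have "(\<Union>n. \<Union>i<n. a i) = (\<Union>i. a i)" by blast
  ultimately have lim: "(\<lambda>n. measure M (\<Union>i<n. a i)) \<longlonglongrightarrow> measure M (\<Union>i. a i)" by simp
  from tendstoD[OF lim, of "\<epsilon> / 2"] Union(3) obtain n where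
    n: "dist (measure M (\<Union>i<n. a i)) (measure M (\<Union>i. a i)) < \<epsilon> / 2"
    by (auto simp: eventually_sequentially)
  \<comment> \<open>At most \<open>n\<close> errors of this size add up to
    \<open>\<epsilon> / 2\<close>; the other half pays for truncating the union.\<close>
  define \<delta> where "\<delta> = \<epsilon> / (2 * (real n + 1))"
  have \<delta>: "\<delta> > 0" using Union(3) by (simp add: \<delta>_def)
  have "\<exists>t\<in>T. \<exists>E'\<in>sets (F t). measure M (sym_diff (a i) E') < \<delta>" for i by (rule Union(2)[OF \<delta>])
  then obtain t E' where t: "\<And>i. t i \<in> T" "\<And>i. E' i \<in> sets (F (t i))" "\<And>i. measure M (sym_diff (a i) (E' i)) < \<delta>"
    by metis
  have "\<exists>u\<in>T. \<forall>i<k. sets (F (t i)) \<subseteq> sets (F u)" for k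
  proof (induction k)
    case (Suc k)
    then obtain u where u: "u \<in> T" "\<forall>i<k. sets (F (t i)) \<subseteq> sets (F u)" by blast
    from dir[OF u(1) t(1)[of k]] obtain v where "v \<in> T" "sets (F u) \<subseteq> sets (F v)" "sets (F (t k)) \<subseteq> sets (F v)" by blast
    then show ?case using u(2) by (intro bexI[of _ v]) (auto simp: less_Suc_eq)
  qed (use ne in auto)
  then obtain u where u: "u \<in> T" "\<forall>i<n. sets (F (t i)) \<subseteq> sets (F u)" by blast
  define U where "U = (\<Union>i<n. E' i)"
  have U: "U \<in> sets (F u)" unfolding U_def using u t(2) by (intro sets.finite_UN) auto
  have E'm: "E' i \<in> sets M" for i using t sub by blast
  have "measure M (sym_diff (\<Union>i. a i) U) \<le> measure M ((\<Union>i. a i) - (\<Union>i<n. a i)) + measure M (\<Union>i<n. sym_diff (a i) (E' i))"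
  proof (rule order_trans[OF finite_measure_mono measure_Un_le])
    show "sym_diff (\<Union>i. a i) U \<subseteq> ((\<Union>i. a i) - (\<Union>i<n. a i)) \<union> (\<Union>i<n. sym_diff (a i) (E' i))"
      unfolding U_def by blast
  qed (use am E'm in measurable)
  also have "measure M ((\<Union>i. a i) - (\<Union>i<n. a i)) < \<epsilon> / 2"
    using n by (subst finite_measure_Diff) (auto simp: am dist_real_def abs_if split: if_splits)
  also have "measure M (\<Union>i<n. sym_diff (a i) (E' i)) \<le> (\<Sum>i<n. measure M (sym_diff (a i) (E' i)))"
    by (intro finite_measure_subadditive_finite) (use am E'm in auto)
  also have "(\<Sum>i<n. measure M (sym_diff (a i) (E' i))) \<le> (\<Sum>i<n. \<delta>)"
    using t(3) by (intro sum_mono less_imp_le)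
  also have "\<dots> \<le> \<epsilon> / 2" using Union(3) by (simp add: \<delta>_def field_simps)
  finally show ?case using u(1) U by (intro bexI) auto
qed

section \<open>Gains and conditional expectations of the state\<close>

context signals
begin

text \<open>By the averaging property of conditional expectation, the mass of \<open>E\<close> under
  \<open>True\<close> is the integral of \<open>X\<close> over \<open>E\<close>. The gain is twice
  this mass minus the measure of \<open>E\<close>.\<close>

lemma gain_eq_integral:
  assumes sub: "subalgebra (world m0 m1 V) F" and E: "E \<in> sets F"
  defines "X \<equiv> real_cond_exp (world m0 m1 V) F (indicator {\<omega>. fst \<omega> = True})"
  shows "gain V E = (\<integral>\<omega>. indicator E \<omega> * (2 * X \<omega> - 1) \<partial>world m0 m1 V)"
    and "integrable (world m0 m1 V) X"
proof -
  interpret W: prob_space "world m0 m1 V" by (rule prob_world)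
  interpret F: finite_measure_subalgebra "world m0 m1 V" F by unfold_locales fact
  have EW[measurable]: "E \<in> sets (world m0 m1 V)" using E sub by (auto simp: subalgebra_def)
  define S where "S = {\<omega> \<in> space (world m0 m1 V). fst \<omega> = True}"
  have S[measurable]: "S \<in> sets (world m0 m1 V)" unfolding S_def by (rule fst_state_sets)
  have ind: "integrable (world m0 m1 V) (indicator {\<omega>. fst \<omega> = True} :: _ \<Rightarrow> real)"
  proof (subst Bochner_Integration.integrable_cong[OF refl])
    show "integrable (world m0 m1 V) (indicator S :: _ \<Rightarrow> real)"
      by (rule W.integrable_const_bound[where B = 1]) auto
  qed (auto simp: S_def indicator_def)
  show X: "integrable (world m0 m1 V) X" unfolding X_def by (rule F.real_cond_exp_int(1)[OF ind])
  have "mass V True E = (\<integral>\<omega>\<in>E. indicator {\<omega>. fst \<omega> = True} \<omega> \<partial>world m0 m1 V)"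
  proof -
    have "(\<integral>\<omega>\<in>E. indicator {\<omega>. fst \<omega> = True} \<omega> \<partial>world m0 m1 V) = (\<integral>\<omega>. indicator {\<omega> \<in> E. fst \<omega> = True} \<omega> \<partial>world m0 m1 V :: real)"
      unfolding set_lebesgue_integral_def by (intro Bochner_Integration.integral_cong) (auto simp: indicator_def)
    then show ?thesis using state_sets[OF EW, of True] by (simp add: mass_def)
  qed
  also have "\<dots> = (\<integral>\<omega>\<in>E. X \<omega> \<partial>world m0 m1 V)"
    unfolding X_def by (rule F.real_cond_exp_intA[OF ind E])
  finally have T: "mass V True E = (\<integral>\<omega>. indicator E \<omega> * X \<omega> \<partial>world m0 m1 V)"
    by (simp add: set_lebesgue_integral_def)
  have iX: "integrable (world m0 m1 V) (\<lambda>\<omega>. indicator E \<omega> * X \<omega>)"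
    using integrable_mult_indicator[OF EW X] by simp
  have iE: "integrable (world m0 m1 V) (indicator E :: _ \<Rightarrow> real)"
    by (rule W.integrable_const_bound[where B = 1]) auto
  have "(\<integral>\<omega>. indicator E \<omega> * (2 * X \<omega> - 1) \<partial>world m0 m1 V) =
      (\<integral>\<omega>. 2 * (indicator E \<omega> * X \<omega>) - indicator E \<omega> \<partial>world m0 m1 V)"
    by (intro Bochner_Integration.integral_cong) (auto simp: algebra_simps)
  also have "\<dots> = 2 * mass V True E - measure (world m0 m1 V) E"
    using iX iE by (simp add: T)
  finally show "gain V E = (\<integral>\<omega>. indicator E \<omega> * (2 * X \<omega> - 1) \<partial>world m0 m1 V)"
    by (simp add: gain_def measure_eq_mass[OF EW])
qed

lemma gain_integrable:
  assumes sub: "subalgebra (world m0 m1 V) F" and E: "E \<in> sets F"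
  shows "integrable (world m0 m1 V)
    (\<lambda>\<omega>. indicator E \<omega> * (2 * real_cond_exp (world m0 m1 V) F (indicator {\<omega>. fst \<omega> = True}) \<omega> - 1))"
proof -
  interpret W: prob_space "world m0 m1 V" by (rule prob_world)
  have "E \<in> sets (world m0 m1 V)" using E sub by (auto simp: subalgebra_def)
  moreover have "integrable (world m0 m1 V)
    (\<lambda>\<omega>. 2 * real_cond_exp (world m0 m1 V) F (indicator {\<omega>. fst \<omega> = True}) \<omega> - 1)"
    using gain_eq_integral(2)[OF sub E] by simp
  ultimately have "integrable (world m0 m1 V)
    (\<lambda>\<omega>. indicator E \<omega> *\<^sub>R (2 * real_cond_exp (world m0 m1 V) F (indicator {\<omega>. fst \<omega> = True}) \<omega> - 1))"
    by (rule integrable_mult_indicator)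
  then show ?thesis by simp
qed

text \<open>The factor \<open>2 * X - 1\<close> is almost surely nonnegative where the action is 1
  and nonpositive where it is 0. The integrated form no longer mentions conditional expectations,
  and it is the form that can be passed to limits.\<close>

lemma gain_optimal:
  assumes sub: "subalgebra (world m0 m1 V) F" and A: "A \<in> sets F" and E: "E \<in> sets F"
    and AE: "AE \<omega> in world m0 m1 V.
      (real_cond_exp (world m0 m1 V) F (indicator {\<omega>. fst \<omega> = True}) \<omega> < 1 / 2 \<longrightarrow> \<omega> \<notin> A) \<and>
      (real_cond_exp (world m0 m1 V) F (indicator {\<omega>. fst \<omega> = True}) \<omega> > 1 / 2 \<longrightarrow> \<omega> \<in> A)"
  shows "gain V (E \<inter> A) \<ge> 0" and "gain V (E - A) \<le> 0"
proof -
  have s: "E \<inter> A \<in> sets F" "E - A \<in> sets F" using A E by auto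
  show "gain V (E \<inter> A) \<ge> 0"
    unfolding gain_eq_integral(1)[OF sub s(1)]
    by (intro integral_nonneg_AE) (use AE in \<open>eventually_elim; auto simp: indicator_def\<close>)
  have "(\<integral>\<omega>. - (indicator (E - A) \<omega> * (2 * real_cond_exp (world m0 m1 V) F (indicator {\<omega>. fst \<omega> = True}) \<omega> - 1)) \<partial>world m0 m1 V) \<ge> 0"
    by (intro integral_nonneg_AE) (use AE in \<open>eventually_elim; auto simp: indicator_def\<close>)
  then show "gain V (E - A) \<le> 0"
    unfolding gain_eq_integral(1)[OF sub s(2)] by simp
qed

text \<open>Converse of \<open>gain_optimal\<close>. Testing with \<open>{X < 1/2}\<close> and
  \<open>{X > 1/2}\<close> makes the integral of a function of constant sign over the mistakes
  vanish, so the mistakes form a null set.\<close>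

lemma AE_optimal:
  assumes sub: "subalgebra (world m0 m1 V) F" and A: "A \<in> sets F"
    and pos: "\<And>E. E \<in> sets F \<Longrightarrow> gain V (E \<inter> A) \<ge> 0" and neg: "\<And>E. E \<in> sets F \<Longrightarrow> gain V (E - A) \<le> 0"
  shows "AE \<omega> in world m0 m1 V.
      (real_cond_exp (world m0 m1 V) F (indicator {\<omega>. fst \<omega> = True}) \<omega> < 1 / 2 \<longrightarrow> \<omega> \<notin> A) \<and>
      (real_cond_exp (world m0 m1 V) F (indicator {\<omega>. fst \<omega> = True}) \<omega> > 1 / 2 \<longrightarrow> \<omega> \<in> A)"
proof -
  define X where "X = real_cond_exp (world m0 m1 V) F (indicator {\<omega>. fst \<omega> = True})"
  have X[measurable]: "X \<in> borel_measurable F" unfolding X_def by (rule borel_measurable_cond_exp)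
  have spF: "space F = space (world m0 m1 V)" using sub by (simp add: subalgebra_def)
  note A[measurable]
  define L where "L = {\<omega> \<in> space F. X \<omega> < 1 / 2}"
  define R where "R = {\<omega> \<in> space F. X \<omega> > 1 / 2}"
  have L: "L \<in> sets F" unfolding L_def by measurable
  have R: "R \<in> sets F" unfolding R_def by measurable
  have LA: "L \<inter> A \<in> sets F" and RA: "R - A \<in> sets F" using L R A by auto
  have "(\<integral>\<omega>. - (indicator (L \<inter> A) \<omega> * (2 * X \<omega> - 1)) \<partial>world m0 m1 V) = 0"
  proof (rule order_antisym)
    show "(\<integral>\<omega>. - (indicator (L \<inter> A) \<omega> * (2 * X \<omega> - 1)) \<partial>world m0 m1 V) \<le> 0"
      using pos[OF L] gain_eq_integral(1)[OF sub LA] by (simp add: X_def)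
  qed (intro Bochner_Integration.integral_nonneg, auto simp: indicator_def L_def)
  moreover have "integrable (world m0 m1 V) (\<lambda>\<omega>. - (indicator (L \<inter> A) \<omega> * (2 * X \<omega> - 1)))"
    using gain_integrable[OF sub LA] by (simp add: X_def)
  ultimately have 1: "AE \<omega> in world m0 m1 V. - (indicator (L \<inter> A) \<omega> * (2 * X \<omega> - 1)) = 0"
    by (subst (asm) integral_nonneg_eq_0_iff_AE) (auto simp: indicator_def L_def)
  have "(\<integral>\<omega>. indicator (R - A) \<omega> * (2 * X \<omega> - 1) \<partial>world m0 m1 V) = 0"
  proof (rule order_antisym)
    show "(\<integral>\<omega>. indicator (R - A) \<omega> * (2 * X \<omega> - 1) \<partial>world m0 m1 V) \<le> 0"
      using neg[OF R] gain_eq_integral(1)[OF sub RA] by (simp add: X_def)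
  qed (intro Bochner_Integration.integral_nonneg, auto simp: indicator_def R_def)
  moreover have "integrable (world m0 m1 V) (\<lambda>\<omega>. indicator (R - A) \<omega> * (2 * X \<omega> - 1))"
    using gain_integrable[OF sub RA] by (simp add: X_def)
  ultimately have 2: "AE \<omega> in world m0 m1 V. indicator (R - A) \<omega> * (2 * X \<omega> - 1) = 0"
    by (subst (asm) integral_nonneg_eq_0_iff_AE) (auto simp: indicator_def R_def)
  show ?thesis
    using 1 2 AE_space unfolding X_def[symmetric]
    by eventually_elim (auto simp: indicator_def L_def R_def spF split: if_splits)
qed

text \<open>A rule loses \<open>\<bar>2 * X - 1\<bar>\<close> at each point where it departs from
  the optimal one; departures at ties cost nothing.\<close>

lemma gain_Diff_eq:
  assumes sub: "subalgebra (world m0 m1 V) F" and A: "A \<in> sets F"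
  defines "X \<equiv> real_cond_exp (world m0 m1 V) F (indicator {\<omega>. fst \<omega> = True})"
  defines "Y \<equiv> {\<omega> \<in> space (world m0 m1 V). X \<omega> > 1 / 2}"
  shows "gain V Y - gain V A = (\<integral>\<omega>. indicator (sym_diff Y A) \<omega> * \<bar>2 * X \<omega> - 1\<bar> \<partial>world m0 m1 V)"
    and "Y \<in> sets F"
    and "integrable (world m0 m1 V) (\<lambda>\<omega>. indicator (sym_diff Y A) \<omega> * \<bar>2 * X \<omega> - 1\<bar>)"
proof -
  have spF: "space F = space (world m0 m1 V)" using sub by (simp add: subalgebra_def)
  have X[measurable]: "X \<in> borel_measurable F" unfolding X_def by (rule borel_measurable_cond_exp)
  show Y: "Y \<in> sets F" unfolding Y_def spF[symmetric] by measurable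
  have AW: "A \<subseteq> space (world m0 m1 V)" using sets.sets_into_space[OF A] spF by simp
  have eq: "indicator (sym_diff Y A) \<omega> * \<bar>2 * X \<omega> - 1\<bar> =
      indicator Y \<omega> * (2 * X \<omega> - 1) - indicator A \<omega> * (2 * X \<omega> - 1)"
    for \<omega> using AW by (auto simp: indicator_def Y_def abs_if)
  note i = gain_integrable[OF sub Y, folded X_def] gain_integrable[OF sub A, folded X_def]
  show "integrable (world m0 m1 V) (\<lambda>\<omega>. indicator (sym_diff Y A) \<omega> * \<bar>2 * X \<omega> - 1\<bar>)"
    unfolding eq by (rule Bochner_Integration.integrable_diff) (rule i)+
  show "gain V Y - gain V A = (\<integral>\<omega>. indicator (sym_diff Y A) \<omega> * \<bar>2 * X \<omega> - 1\<bar> \<partial>world m0 m1 V)"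
    unfolding eq using i
    by (simp add: gain_eq_integral(1)[OF sub Y] gain_eq_integral(1)[OF sub A] X_def)
qed

end

subsection \<open>Histories and independence of distant events\<close>

text \<open>Balls along the direction of observation: the agents that \<open>u\<close> can hear of
  through at most \<open>k\<close> successive observations.\<close>

fun nb :: "(nat \<Rightarrow> nat set) \<Rightarrow> nat \<Rightarrow> nat \<Rightarrow> nat set" where
  "nb N 0 u = {u}"
| "nb N (Suc k) u = (\<Union>v\<in>nb N k u. insert v (N v))"

lemma nb_self: "u \<in> nb N k u" by (induction k) auto

lemma nb_mono: "k \<le> l \<Longrightarrow> nb N k u \<subseteq> nb N l u"
  by (induction l rule: nat_induct_at_least) auto

lemma nb_trans: "x \<in> nb N a y \<Longrightarrow> y \<in> nb N b z \<Longrightarrow> x \<in> nb N (b + a) z"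
  by (induction a arbitrary: x) auto

lemma nb_subset: "u \<in> V \<Longrightarrow> (\<And>v. v \<in> V \<Longrightarrow> N v \<subseteq> V) \<Longrightarrow> nb N k u \<subseteq> V"
  by (induction k) auto

lemma nb_finite: "u \<in> V \<Longrightarrow> (\<And>v. v \<in> V \<Longrightarrow> N v \<subseteq> V) \<Longrightarrow> (\<And>v. v \<in> V \<Longrightarrow> finite (N v)) \<Longrightarrow> finite (nb N k u)"
proof (induction k)
  case (Suc k)
  then show ?case using nb_subset[of u V N k] by (auto intro!: finite_UN_I)
qed simp

text \<open>The own actions of \<open>u\<close> are included; being functions of the rest, they carry no further information.\<close>

definition past :: "(nat \<Rightarrow> nat set) \<Rightarrow> nat \<Rightarrow> nat \<Rightarrow> (nat \<times> nat) set" where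
  "past N u t = insert u (N u) \<times> {1..<t}"

definition hist :: "(nat \<Rightarrow> nat set) \<Rightarrow> 'w actions \<Rightarrow> nat \<Rightarrow> nat \<Rightarrow> 'w outcome \<Rightarrow> (nat \<times> nat) set" where
  "hist N act u t \<omega> = {(v, t') \<in> past N u t. act v t' \<omega>}"

lemma hist_subset: "hist N act u t \<omega> \<subseteq> past N u t" by (auto simp: hist_def)

lemma finite_past: "finite (N u) \<Longrightarrow> finite (past N u t)" by (simp add: past_def)

context signals
begin

text \<open>The coordinates are independent under a product measure, and so are disjoint blocks of
  them. The two blocks are indexed by \<open>bool\<close> because independence is a notion for
  families.\<close>

lemma signal_law_indep:
  assumes J: "J False \<subseteq> V" "J True \<subseteq> V" "J False \<inter> J True = {}" and V: "V \<noteq> {}"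
    and X: "\<And>b. X b \<in> sets (\<Pi>\<^sub>M u\<in>J b. m0)"
  shows "measure (signal_law V s) {w \<in> space (signal_law V s). restrict w (J False) \<in> X False \<and> restrict w (J True) \<in> X True} =
    measure (signal_law V s) {w \<in> space (signal_law V s). restrict w (J False) \<in> X False} *
    measure (signal_law V s) {w \<in> space (signal_law V s). restrict w (J True) \<in> X True}"
proof -
  interpret product_prob_space "\<lambda>_ :: nat. mu s" V by (rule product_prob_space_mu)
  let ?P = "\<Pi>\<^sub>M u\<in>V. mu s"
  have "P.indep_vars (\<lambda>_. mu s) (\<lambda>i w. w i) V"
  proof (subst P.indep_vars_iff_distr_eq_PiM'[OF V])
    have "distr ?P ?P (\<lambda>x. \<lambda>i\<in>V. x i) = distr ?P ?P (\<lambda>x. x)"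
      by (intro distr_cong) (auto simp: space_PiM intro: PiE_restrict)
    moreover have "Pi\<^sub>M V (\<lambda>i. distr ?P (mu s) (\<lambda>w. w i)) = ?P"
      by (intro PiM_cong PiM_component) auto
    ultimately show "distr ?P ?P (\<lambda>x. \<lambda>i\<in>V. x i) = Pi\<^sub>M V (\<lambda>i. distr ?P (mu s) (\<lambda>w. w i))"
      by simp
  qed simp
  moreover have "J j \<subseteq> V" for j using J by (cases j) auto
  ultimately have "P.indep_vars (\<lambda>j. PiM (J j) (\<lambda>_. mu s)) (\<lambda>j \<omega>. restrict (\<lambda>i. \<omega> i) (J j)) UNIV"
    by (rule P.indep_vars_restrict) (use J in \<open>simp_all add: disjoint_family_on_def UNIV_bool Int_commute all_bool_eq\<close>)
  then have "P.prob (\<Inter>j\<in>UNIV. (\<lambda>\<omega>. restrict \<omega> (J j)) -` X j \<inter> space ?P) = (\<Prod>j\<in>UNIV. P.prob ((\<lambda>\<omega>. restrict \<omega> (J j)) -` X j \<inter> space ?P))"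
    by (rule P.indep_varsD) (use X in \<open>auto cong: sets_PiM_cong\<close>)
  moreover have "(\<Inter>j\<in>UNIV. (\<lambda>\<omega>. restrict \<omega> (J j)) -` X j \<inter> space ?P) = {w \<in> space ?P. restrict w (J False) \<in> X False \<and> restrict w (J True) \<in> X True}"
    by (auto simp: UNIV_bool)
  moreover have "(\<lambda>\<omega>. restrict \<omega> (J j)) -` X j \<inter> space ?P = {w \<in> space ?P. restrict w (J j) \<in> X j}" for j
    by auto
  ultimately show ?thesis by (simp add: signal_law_def UNIV_bool)
qed

text \<open>The two outcomes compared may have different states, so such an event is also blind to
  \<open>S\<close>.\<close>

definition local_event :: "nat set \<Rightarrow> nat set \<Rightarrow> 'w outcome set \<Rightarrow> bool" where
  "local_event V J E \<longleftrightarrow> (\<forall>\<omega>\<in>space (world m0 m1 V). \<forall>\<omega>'\<in>space (world m0 m1 V).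
     (\<forall>v\<in>J. snd \<omega> v = snd \<omega>' v) \<longrightarrow> (\<omega> \<in> E \<longleftrightarrow> \<omega>' \<in> E))"

text \<open>Disjoint groups of signals are independent given the state; the factor 2 makes up for
  the normalisation of joint masses.\<close>

lemma mass_indep:
  assumes E: "E1 \<in> sets (world m0 m1 V)" "E2 \<in> sets (world m0 m1 V)"
    and L: "local_event V J1 E1" "local_event V J2 E2"
    and J: "J1 \<subseteq> V" "J2 \<subseteq> V" "J1 \<inter> J2 = {}" and V: "V \<noteq> {}"
  shows "mass V s (E1 \<inter> E2) = 2 * mass V s E1 * mass V s E2"
proof -
  interpret S: prob_space "signal_law V s" by (rule prob_signal_law)
  obtain w0 where w0: "w0 \<in> space (signal_law V s)" using S.not_empty by blast
  \<comment> \<open>Coordinates outside \<open>J\<close> are frozen at a fixed point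
    \<open>w0\<close>. This turns an event that depends on \<open>J\<close> only into a measurable
    event of the block.\<close>
  define ext where "ext = (\<lambda>J x. \<lambda>v\<in>V. if v \<in> J then x v else w0 v)"
  define X where "X = (\<lambda>J E. {x \<in> space (\<Pi>\<^sub>M u\<in>J. m0). (s, ext J x) \<in> E})"
  have ext: "ext J \<in> (\<Pi>\<^sub>M u\<in>J. m0) \<rightarrow>\<^sub>M (\<Pi>\<^sub>M u\<in>V. m0)" for J
    unfolding ext_def
  proof (rule measurable_restrict)
    fix v assume v: "v \<in> V"
    then have "w0 v \<in> space m0" using w0 by (auto simp: space_signal_law)
    then show "(\<lambda>x. if v \<in> J then x v else w0 v) \<in> (\<Pi>\<^sub>M u\<in>J. m0) \<rightarrow>\<^sub>M m0"
      by (cases "v \<in> J") auto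
  qed
  have Xs: "X J E \<in> sets (\<Pi>\<^sub>M u\<in>J. m0)" if "E \<in> sets (world m0 m1 V)" for J E
  proof -
    have "(\<lambda>x. (s, ext J x)) \<in> (\<Pi>\<^sub>M u\<in>J. m0) \<rightarrow>\<^sub>M (count_space UNIV \<Otimes>\<^sub>M (\<Pi>\<^sub>M u\<in>V. m0))"
      using ext by (intro measurable_Pair) auto
    from measurable_sets[OF this, of E] that show ?thesis
      by (simp add: sets_world X_def vimage_def Int_def conj_commute)
  qed
  have eq: "(s, w) \<in> E \<longleftrightarrow> restrict w J \<in> X J E" if w: "w \<in> space (signal_law V s)" and "local_event V J E" "J \<subseteq> V" for w J E
  proof -
    have r: "restrict w J \<in> space (\<Pi>\<^sub>M u\<in>J. m0)" using w that(3) by (auto simp: space_signal_law space_PiM)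
    then have "ext J (restrict w J) \<in> space (\<Pi>\<^sub>M u\<in>V. m0)" using ext[of J] by (rule measurable_space[rotated])
    then have sp: "(s, ext J (restrict w J)) \<in> space (world m0 m1 V)" "(s, w) \<in> space (world m0 m1 V)"
      using w by (auto simp: space_world space_signal_law space_PiM)
    have "(s, w) \<in> E \<longleftrightarrow> (s, ext J (restrict w J)) \<in> E"
    proof -
      have "\<forall>v\<in>J. snd (s, w) v = snd (s, ext J (restrict w J)) v" using that(3) by (auto simp: ext_def)
      then show ?thesis using that(2) sp unfolding local_event_def by blast
    qed
    then show ?thesis using r by (simp add: X_def)
  qed
  have "measure (signal_law V s) {w \<in> space (signal_law V s). restrict w J1 \<in> X J1 E1 \<and> restrict w J2 \<in> X J2 E2} =
    measure (signal_law V s) {w \<in> space (signal_law V s). restrict w J1 \<in> X J1 E1} *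
    measure (signal_law V s) {w \<in> space (signal_law V s). restrict w J2 \<in> X J2 E2}"
    using signal_law_indep[of "\<lambda>b. if b then J2 else J1" V "\<lambda>b. if b then X J2 E2 else X J1 E1" s] J V Xs E by simp
  moreover have "{w \<in> space (signal_law V s). restrict w J1 \<in> X J1 E1 \<and> restrict w J2 \<in> X J2 E2} =
      {w \<in> space (signal_law V s). (s, w) \<in> E1 \<inter> E2}"
    using eq[OF _ L(1) J(1)] eq[OF _ L(2) J(2)] by auto
  moreover have "{w \<in> space (signal_law V s). restrict w J1 \<in> X J1 E1} = {w \<in> space (signal_law V s). (s, w) \<in> E1}"
    using eq[OF _ L(1) J(1)] by auto
  moreover have "{w \<in> space (signal_law V s). restrict w J2 \<in> X J2 E2} = {w \<in> space (signal_law V s). (s, w) \<in> E2}"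
    using eq[OF _ L(2) J(2)] by auto
  ultimately show ?thesis using E by (simp add: mass_eq)
qed

lemma coord_sets:
  assumes "u \<in> V" "S \<in> sets m0"
  shows "{\<omega> \<in> space (world m0 m1 V). snd \<omega> u \<in> S} \<in> sets (world m0 m1 V)"
proof -
  have "(\<lambda>\<omega>. snd \<omega> u) \<in> world m0 m1 V \<rightarrow>\<^sub>M m0"
    unfolding measurable_cong_sets[OF sets_world refl] using assms(1) by measurable
  from measurable_sets[OF this assms(2)] show ?thesis by (simp add: vimage_def Int_def conj_commute)
qed

lemma mass_signals:
  assumes "finite J" "J \<subseteq> V" "\<And>v. v \<in> J \<Longrightarrow> S v \<in> sets m0"
  shows "mass V s {\<omega> \<in> space (world m0 m1 V). \<forall>v\<in>J. snd \<omega> v \<in> S v} = (\<Prod>v\<in>J. measure (mu s) (S v)) / 2"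
proof -
  interpret product_prob_space "\<lambda>_ :: nat. mu s" V by (rule product_prob_space_mu)
  have E: "{\<omega> \<in> space (world m0 m1 V). \<forall>v\<in>J. snd \<omega> v \<in> S v} \<in> sets (world m0 m1 V)"
    using assms coord_sets[of _ V] by (intro sets.sets_Collect_finite_All) auto
  have "{w \<in> space (signal_law V s). (s, w) \<in> {\<omega> \<in> space (world m0 m1 V). \<forall>v\<in>J. snd \<omega> v \<in> S v}} =
      prod_emb V (\<lambda>_. mu s) J (Pi\<^sub>E J S)"
    using assms(2) by (auto simp: space_world space_signal_law prod_emb_def)
  then show ?thesis
    using measure_PiM_emb[OF assms(2,1), of S] assms(3) by (simp add: mass_eq[OF E] signal_law_def)
qed

end

subsection \<open>Actions as functions of signals and histories\<close>

text \<open>If \<open>v\<close> acts at time \<open>t\<close> according to \<open>x \<in> B v t h\<close>, where \<open>x\<close> is its signal and \<open>h\<close> its history, then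
  the cell contains the signals with which \<open>v\<close> acts on \<open>D\<close> as prescribed by the configuration \<open>\<alpha>\<close>.\<close>

definition cell :: "'w measure \<Rightarrow> (nat \<Rightarrow> nat \<Rightarrow> (nat \<times> nat) set \<Rightarrow> 'w set) \<Rightarrow> (nat \<Rightarrow> nat set) \<Rightarrow> nat \<Rightarrow>
    (nat \<times> nat) set \<Rightarrow> (nat \<times> nat) set \<Rightarrow> 'w set" where
  "cell M B N v D \<alpha> = {x \<in> space M. \<forall>t. (v, t) \<in> D \<longrightarrow> (x \<in> B v t (\<alpha> \<inter> past N v t) \<longleftrightarrow> (v, t) \<in> \<alpha>)}"

text \<open>The cone of influence: an action at time \<open>t'\<close> needs one time step per arc
  to affect the history of \<open>u\<close> at time \<open>t\<close>. The cone contains the past of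
  each of its members, so a configuration on it can be checked agent by agent.\<close>

definition horizon :: "(nat \<Rightarrow> nat set) \<Rightarrow> nat \<Rightarrow> nat \<Rightarrow> (nat \<times> nat) set" where
  "horizon N u t = {(v, t'). 1 \<le> t' \<and> t' < t \<and> v \<in> nb N (t - t') u}"

lemma past_subset_horizon: "past N u t \<subseteq> horizon N u t"
proof
  fix x assume "x \<in> past N u t"
  then obtain v t' where x: "x = (v, t')" "v \<in> insert u (N u)" "1 \<le> t'" "t' < t" by (auto simp: past_def)
  have "v \<in> nb N 1 u" using x by simp
  moreover have "nb N 1 u \<subseteq> nb N (t - t') u" by (rule nb_mono) (use x in simp)
  ultimately have "v \<in> nb N (t - t') u" by blast
  then show "x \<in> horizon N u t" using x by (simp add: horizon_def)
qed

lemma past_horizon_closed: "(v, t') \<in> horizon N u t \<Longrightarrow> past N v t' \<subseteq> horizon N u t"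
proof
  fix x assume vt: "(v, t') \<in> horizon N u t" and "x \<in> past N v t'"
  then obtain w t'' where x: "x = (w, t'')" "w \<in> insert v (N v)" "1 \<le> t''" "t'' < t'" by (auto simp: past_def)
  have "w \<in> nb N (Suc (t - t')) u" using vt x by (auto simp: horizon_def)
  moreover have "Suc (t - t') \<le> t - t''" using vt x by (auto simp: horizon_def)
  ultimately have "w \<in> nb N (t - t'') u" using nb_mono by blast
  then show "x \<in> horizon N u t" using x vt by (simp add: horizon_def)
qed

lemma horizon_subset: "horizon N u t \<subseteq> nb N t u \<times> {1..<t}"
proof
  fix x assume "x \<in> horizon N u t"
  then obtain v t' where x: "x = (v, t')" "1 \<le> t'" "t' < t" "v \<in> nb N (t - t') u" by (auto simp: horizon_def)
  then have "v \<in> nb N t u" using nb_mono[of "t - t'" t N u] by auto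
  then show "x \<in> nb N t u \<times> {1..<t}" using x by simp
qed

lemma hist_eq_iff:
  assumes "g \<subseteq> past N u t"
  shows "hist N act u t \<omega> = g \<longleftrightarrow> (\<forall>p\<in>past N u t. act (fst p) (snd p) \<omega> = (p \<in> g))"
proof -
  have "hist N act u t \<omega> = {p \<in> past N u t. act (fst p) (snd p) \<omega>}" by (auto simp: hist_def)
  then show ?thesis using assms by blast
qed

text \<open>Kept apart from \<open>network\<close> because actions generated by given strategies
  must first be proved measurable, by \<open>strategy_measurable\<close>.\<close>

locale prenetwork = signals m0 m1 for m0 m1 :: "'w measure" +
  fixes G :: "nat pair_pre_digraph" and act :: "'w actions"
  assumes wf: "\<And>u v. u \<in> pverts G \<Longrightarrow> v \<in> neighbors G u \<Longrightarrow> v \<in> pverts G"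
    and finN: "\<And>u. u \<in> pverts G \<Longrightarrow> finite (neighbors G u)"
    and ne: "pverts G \<noteq> {}"
begin

abbreviation "V \<equiv> pverts G"
abbreviation "N \<equiv> neighbors G"
abbreviation "W \<equiv> world m0 m1 (pverts G)"
abbreviation "infm u t \<equiv> info m0 m1 G act u t"
abbreviation "hst u t \<equiv> hist (neighbors G) act u t"

lemma N_sub: "u \<in> V \<Longrightarrow> N u \<subseteq> V" using wf by blast

lemma nbV: "u \<in> V \<Longrightarrow> nb N k u \<subseteq> V" by (rule nb_subset) (simp_all add: N_sub)

lemma nb_fin: "u \<in> V \<Longrightarrow> finite (nb N k u)" by (rule nb_finite[of _ V]) (simp_all add: N_sub finN)

lemma past_fin: "u \<in> V \<Longrightarrow> finite (past N u t)" using finN by (intro finite_past)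

lemma horizon_fin: "u \<in> V \<Longrightarrow> finite (horizon N u t)"
  by (rule finite_subset[OF horizon_subset]) (simp add: nb_fin)

abbreviation gens :: "nat \<Rightarrow> nat \<Rightarrow> 'w outcome set set" where
  "gens u t \<equiv> {(\<lambda>(s, w). w u) -` B \<inter> space W | B. B \<in> sets m0} \<union>
         {act v t' -` C \<inter> space W | v t' C. v \<in> N u \<and> 1 \<le> t' \<and> t' < t}"

lemma space_info: "space (infm u t) = space W"
  unfolding info_def Let_def by (rule space_measure_of) auto

lemma sets_info: "sets (infm u t) = sigma_sets (space W) (gens u t)"
  unfolding info_def Let_def by (rule sets_measure_of) auto

lemma info_mono: "t \<le> t' \<Longrightarrow> sets (infm u t) \<subseteq> sets (infm u t')"
  unfolding sets_info
proof (rule sigma_sets_mono', rule Un_mono)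
  assume t: "t \<le> t'"
  show "{act v s -` C \<inter> space W |v s C. v \<in> N u \<and> 1 \<le> s \<and> s < t} \<subseteq> {act v s -` C \<inter> space W |v s C. v \<in> N u \<and> 1 \<le> s \<and> s < t'}"
    using order_less_le_trans[OF _ t] by blast
qed (rule order_refl)

lemma coord_info: "S \<in> sets m0 \<Longrightarrow> {\<omega> \<in> space W. snd \<omega> u \<in> S} \<in> sets (infm u t)"
proof -
  assume S: "S \<in> sets m0"
  have "{\<omega> \<in> space W. snd \<omega> u \<in> S} = (\<lambda>(s, w). w u) -` S \<inter> space W" by (auto simp: case_prod_beta)
  then show ?thesis unfolding sets_info using S by (auto intro!: sigma_sets.Basic)
qed

text \<open>A history records the own actions of \<open>u\<close>, which are not among the
  generators of its information. The hypothesis \<open>own\<close> comes from induction on time in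
  \<open>strategy_measurable\<close>, and from \<open>act_info\<close> in
  \<open>network\<close>.\<close>

lemma hist_event_own:
  assumes u: "u \<in> V" and own: "\<And>t' b. 1 \<le> t' \<Longrightarrow> t' < t \<Longrightarrow> {\<omega> \<in> space W. act u t' \<omega> = b} \<in> sets (infm u t)"
  shows "{\<omega> \<in> space W. hst u t \<omega> = g} \<in> sets (infm u t)"
proof (cases "g \<subseteq> past N u t")
  case True
  have ev: "{\<omega> \<in> space W. act v t' \<omega> = b} \<in> sets (infm u t)" if vt: "(v, t') \<in> past N u t" for v t' b
  proof (cases "v = u")
    case True
    then show ?thesis using own[of t' b] vt by (simp add: past_def)
  next
    case False
    then have "act v t' -` {b} \<inter> space W \<in> gens u t" using vt by (auto simp: past_def)
    moreover have "{\<omega> \<in> space W. act v t' \<omega> = b} = act v t' -` {b} \<inter> space W" by auto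
    ultimately show ?thesis unfolding sets_info by (auto intro: sigma_sets.Basic)
  qed
  have "{\<omega> \<in> space W. hst u t \<omega> = g} = {\<omega> \<in> space W. \<forall>p\<in>past N u t. act (fst p) (snd p) \<omega> = (p \<in> g)}"
    using hist_eq_iff[OF True, of act] by auto
  also have "\<dots> \<in> sets (infm u t)"
    unfolding space_info[symmetric, of u t]
    by (rule sets.sets_Collect_finite_All) (use ev past_fin[OF u] in \<open>auto simp: space_info\<close>)
  finally show ?thesis .
next
  case False
  then have "{\<omega> \<in> space W. hst u t \<omega> = g} = {}" using False hist_subset[of N act u t] by blast
  then show ?thesis by (simp only: sets.empty_sets)
qed

lemma strategy_event_own:
  assumes u: "u \<in> V" and S: "\<And>g. S g \<in> sets m0"
    and own: "\<And>t' b. 1 \<le> t' \<Longrightarrow> t' < t \<Longrightarrow> {\<omega> \<in> space W. act u t' \<omega> = b} \<in> sets (infm u t)"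
  shows "{\<omega> \<in> space W. snd \<omega> u \<in> S (hst u t \<omega>)} \<in> sets (infm u t)"
proof -
  have "{\<omega> \<in> space W. snd \<omega> u \<in> S (hst u t \<omega>)} =
      (\<Union>g\<in>Pow (past N u t). {\<omega> \<in> space W. hst u t \<omega> = g} \<inter> {\<omega> \<in> space W. snd \<omega> u \<in> S g})"
    by (auto intro: subsetD[OF hist_subset])
  also have "\<dots> \<in> sets (infm u t)"
    using past_fin[OF u] hist_event_own[OF u own] coord_info[OF S] by (intro sets.finite_UN sets.Int) auto
  finally show ?thesis .
qed

text \<open>Strong induction on time: the own earlier actions are known by induction hypothesis, and
  the history takes finitely many values.\<close>

lemma strategy_measurable:
  assumes B: "\<And>u t g. B u t g \<in> sets m0"
    and act: "\<And>u t \<omega>. u \<in> V \<Longrightarrow> t \<ge> 1 \<Longrightarrow> \<omega> \<in> space W \<Longrightarrow> act u t \<omega> \<longleftrightarrow> snd \<omega> u \<in> B u t (hst u t \<omega>)"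
    and u: "u \<in> V" and t: "t \<ge> 1"
  shows "act u t \<in> infm u t \<rightarrow>\<^sub>M count_space UNIV"
proof -
  have ev: "{\<omega> \<in> space W. act u t \<omega> = b} \<in> sets (infm u t)" if "t \<ge> 1" for t b
    using that
  proof (induction t arbitrary: b rule: less_induct)
    case (less t)
    have own: "{\<omega> \<in> space W. act u t' \<omega> = b} \<in> sets (infm u t)" if "1 \<le> t'" "t' < t" for t' b
      using less.IH[OF that(2,1)] info_mono[of t' t u] that(2) by auto
    have T: "{\<omega> \<in> space W. snd \<omega> u \<in> B u t (hst u t \<omega>)} \<in> sets (infm u t)"
      by (rule strategy_event_own[OF u B own])
    have "{\<omega> \<in> space W. act u t \<omega> = b} = (if b then {\<omega> \<in> space W. snd \<omega> u \<in> B u t (hst u t \<omega>)}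
        else space (infm u t) - {\<omega> \<in> space W. snd \<omega> u \<in> B u t (hst u t \<omega>)})"
      using act[OF u less.prems] by (auto simp: space_info)
    then show ?case using T by auto
  qed
  show ?thesis
  proof (rule measurableI)
    fix A :: "bool set"
    have "act u t -` A \<inter> space (infm u t) = (\<Union>b\<in>A. {\<omega> \<in> space W. act u t \<omega> = b})"
      by (auto simp: space_info)
    then show "act u t -` A \<inter> space (infm u t) \<in> sets (infm u t)"
      using ev[OF t] by (auto intro!: sets.finite_UN)
  qed simp
qed

end

locale network = prenetwork m0 m1 G act for m0 m1 :: "'w measure" and G act +
  assumes act_info: "\<And>u t. u \<in> pverts G \<Longrightarrow> t \<ge> 1 \<Longrightarrow> act u t \<in> info m0 m1 G act u t \<rightarrow>\<^sub>M count_space UNIV"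
begin

lemma gens_cases:
  assumes "E \<in> gens u t"
  obtains (signal) B where "E = {\<omega> \<in> space W. snd \<omega> u \<in> B}" "B \<in> sets m0"
    | (action) v t' C where "E = act v t' -` C \<inter> space W" "v \<in> N u" "1 \<le> t'" "t' < t"
  using assms
proof (elim UnE CollectE exE conjE)
  fix B assume "E = (\<lambda>(s, w). w u) -` B \<inter> space W" "B \<in> sets m0"
  then show thesis by (intro signal[of B]) (auto simp: case_prod_beta)
next
  fix v t' C assume "E = act v t' -` C \<inter> space W" "v \<in> N u" "1 \<le> t'" "t' < t"
  then show thesis by (rule action)
qed

text \<open>Induction on time: an observed action is measurable with respect to the information of
  the observed agent at a strictly earlier time.\<close>

lemma info_sub: "u \<in> V \<Longrightarrow> t \<ge> 1 \<Longrightarrow> sets (infm u t) \<subseteq> sets W"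
proof (induction t arbitrary: u rule: less_induct)
  case (less t)
  have "gens u t \<subseteq> sets W"
  proof
    fix E assume "E \<in> gens u t"
    then show "E \<in> sets W"
    proof (cases rule: gens_cases)
      case (signal B)
      then show ?thesis using coord_sets[OF less.prems(1), of B] by simp
    next
      case 2: (action v t' C)
      have v: "v \<in> V" using 2 N_sub less.prems by blast
      have "E \<in> sets (infm v t')"
        using measurable_sets[OF act_info[OF v 2(3)], of C] 2 by (simp add: space_info)
      then show ?thesis using less.IH[OF 2(4) v 2(3)] by blast
    qed
  qed
  then show ?case unfolding sets_info by (rule sets.sigma_sets_subset)
qed

lemma info_subalgebra: "u \<in> V \<Longrightarrow> t \<ge> 1 \<Longrightarrow> subalgebra W (infm u t)"
  by (simp add: subalgebra_def info_sub space_info)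

lemma act_event_info: "u \<in> V \<Longrightarrow> t \<ge> 1 \<Longrightarrow> {\<omega> \<in> space W. act u t \<omega> = b} \<in> sets (infm u t)"
proof -
  assume "u \<in> V" "t \<ge> 1"
  from measurable_sets[OF act_info[OF this], of "{b}"] show ?thesis
    by (simp add: space_info vimage_def Int_def conj_commute)
qed

lemma own_event_info:
  "u \<in> V \<Longrightarrow> 1 \<le> t' \<Longrightarrow> t' < t \<Longrightarrow> {\<omega> \<in> space W. act u t' \<omega> = b} \<in> sets (infm u t)"
  using act_event_info[of u t' b] info_mono[of t' t u] by auto

lemma hist_event_info: "u \<in> V \<Longrightarrow> {\<omega> \<in> space W. hst u t \<omega> = g} \<in> sets (infm u t)"
  by (rule hist_event_own) (simp_all add: own_event_info)

text \<open>A Doob-Dynkin representation by induction over the generated \<sigma>-algebra. The agent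
  knows its signal and a history, so each known event amounts to a signal set selected by the
  history.\<close>

lemma info_strategy:
  assumes u: "u \<in> V" and E: "E \<in> sets (infm u t)"
  shows "\<exists>S. (\<forall>g. S g \<in> sets m0) \<and> E = {\<omega> \<in> space W. snd \<omega> u \<in> S (hst u t \<omega>)}"
  using E unfolding sets_info
proof (induction rule: sigma_sets.induct)
  case (Basic E)
  then show ?case
  proof (cases rule: gens_cases)
    case (signal B)
    then show ?thesis by (intro exI[of _ "\<lambda>_. B"]) simp
  next
    case 2: (action v t' C)
    have p: "(v, t') \<in> past N u t" using 2 by (simp add: past_def)
    have "snd \<omega> u \<in> space m0" if "\<omega> \<in> space W" for \<omega> using that u by (auto simp: space_world)
    then show ?thesis using 2(1) p
      by (intro exI[of _ "\<lambda>g. if ((v, t') \<in> g) \<in> C then space m0 else {}"]) (auto simp: hist_def)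
  qed
next
  case Empty
  show ?case by (intro exI[of _ "\<lambda>_. {}"]) auto
next
  case (Compl E)
  then obtain S where S: "\<forall>g. S g \<in> sets m0" "E = {\<omega> \<in> space W. snd \<omega> u \<in> S (hst u t \<omega>)}" by blast
  have "snd \<omega> u \<in> space m0" if "\<omega> \<in> space W" for \<omega> using that u by (auto simp: space_world)
  then show ?case using S by (intro exI[of _ "\<lambda>g. space m0 - S g"]) auto
next
  case (Union E)
  define P where "P = (\<lambda>i S. (\<forall>g. S g \<in> sets m0) \<and> E i = {\<omega> \<in> space W. snd \<omega> u \<in> S (hst u t \<omega>)})"
  have "\<forall>i. \<exists>S. P i S" unfolding P_def using Union(2) by blast
  then have "\<exists>S. \<forall>i. P i (S i)" by (rule choice)
  then obtain S where "\<forall>i. P i (S i)" ..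
  then have P: "P i (S i)" for i ..
  have S1: "S i g \<in> sets m0" for i g using P[of i] by (simp only: P_def)
  have S2: "E i = {\<omega> \<in> space W. snd \<omega> u \<in> S i (hst u t \<omega>)}" for i using P[of i] by (simp only: P_def)
  have "(\<Union>i. S i g) \<in> sets m0" for g by (intro sets.countable_UN) (use S1 in blast)
  moreover have "(\<Union>i. E i) = {\<omega> \<in> space W. snd \<omega> u \<in> (\<Union>i. S i (hst u t \<omega>))}"
    unfolding S2 by blast
  ultimately show ?case by (intro exI[of _ "\<lambda>g. \<Union>i. S i g"]) simp
qed

lemma act_strategy:
  "\<exists>B. (\<forall>u t g. B u t g \<in> sets m0) \<and>
    (\<forall>u\<in>V. \<forall>t\<ge>1. \<forall>\<omega>\<in>space W. act u t \<omega> \<longleftrightarrow> snd \<omega> u \<in> B u t (hst u t \<omega>))"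
proof -
  have "\<exists>S. (\<forall>g. S g \<in> sets m0) \<and> (u \<in> V \<longrightarrow> t \<ge> 1 \<longrightarrow> {\<omega> \<in> space W. act u t \<omega> = True} = {\<omega> \<in> space W. snd \<omega> u \<in> S (hst u t \<omega>)})" for u t
  proof (cases "u \<in> V \<and> t \<ge> 1")
    case True
    then show ?thesis using info_strategy[of u _ t] act_event_info[of u t True] by blast
  qed (auto intro: exI[of _ "\<lambda>_. {}"])
  note ex = this
  define P where "P = (\<lambda>u t S. (\<forall>g. S g \<in> sets m0) \<and> (u \<in> V \<longrightarrow> t \<ge> 1 \<longrightarrow>
    {\<omega> \<in> space W. act u t \<omega> = True} = {\<omega> \<in> space W. snd \<omega> u \<in> S (hst u t \<omega>)}))"
  have "\<forall>u. \<forall>t. \<exists>S. P u t S" unfolding P_def using ex by blast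
  then have "\<exists>B. \<forall>u t. P u t (B u t)" by (simp only: choice_iff)
  then obtain B where B: "\<And>u t g. B u t g \<in> sets m0"
    "\<And>u t. u \<in> V \<Longrightarrow> t \<ge> 1 \<Longrightarrow> {\<omega> \<in> space W. act u t \<omega> = True} = {\<omega> \<in> space W. snd \<omega> u \<in> B u t (hst u t \<omega>)}"
    unfolding P_def by blast
  have "act u t \<omega> \<longleftrightarrow> snd \<omega> u \<in> B u t (hst u t \<omega>)" if "u \<in> V" "t \<ge> 1" "\<omega> \<in> space W" for u t \<omega>
    using B(2)[OF that(1,2)] that(3) by blast
  with B(1) show ?thesis by blast
qed

text \<open>Information travels at most one arc per unit of time. The independence of distant agents
  at fixed times rests on this.\<close>

lemma info_local:
  assumes "u \<in> V" "t \<ge> 1" "E \<in> sets (infm u t)"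
  shows "local_event V (nb N t u) E"
  using assms
proof (induction t arbitrary: u E rule: less_induct)
  case (less t)
  obtain S where S: "E = {\<omega> \<in> space W. snd \<omega> u \<in> S (hst u t \<omega>)}"
    using info_strategy[OF less.prems(1,3)] by blast
  have "hst u t \<omega> = hst u t \<omega>'"
    if \<omega>: "\<omega> \<in> space W" "\<omega>' \<in> space W" and eq: "\<forall>v\<in>nb N t u. snd \<omega> v = snd \<omega>' v" for \<omega> \<omega>'
  proof -
    have "act v t' \<omega> = act v t' \<omega>'" if vt: "(v, t') \<in> past N u t" for v t'
    proof -
      have v: "v \<in> insert u (N u)" "1 \<le> t'" "t' < t" using vt by (auto simp: past_def)
      then have vV: "v \<in> V" using N_sub less.prems(1) by auto
      have "nb N t' v \<subseteq> nb N t u"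
      proof
        fix x assume "x \<in> nb N t' v"
        moreover have "v \<in> nb N 1 u" using v(1) by simp
        ultimately have "x \<in> nb N (1 + t') u" by (rule nb_trans)
        then show "x \<in> nb N t u" using nb_mono[of "1 + t'" t N u] v(3) by auto
      qed
      moreover have "local_event V (nb N t' v) {\<omega> \<in> space W. act v t' \<omega> = True}"
        by (rule less.IH[OF v(3) vV v(2) act_event_info[OF vV v(2)]])
      ultimately show ?thesis using \<omega> eq unfolding local_event_def by blast
    qed
    then show ?thesis by (auto simp: hist_def)
  qed
  then show ?case
    unfolding local_event_def
  proof (intro ballI impI)
    fix \<omega> \<omega>' assume *: "\<omega> \<in> space W" "\<omega>' \<in> space W" "\<forall>v\<in>nb N t u. snd \<omega> v = snd \<omega>' v"
      and h: "\<And>\<omega> \<omega>'. \<omega> \<in> space W \<Longrightarrow> \<omega>' \<in> space W \<Longrightarrow> \<forall>v\<in>nb N t u. snd \<omega> v = snd \<omega>' v \<Longrightarrow> hst u t \<omega> = hst u t \<omega>'"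
    have "snd \<omega> u = snd \<omega>' u" using *(3) nb_self[of u N t] by blast
    then show "\<omega> \<in> E \<longleftrightarrow> \<omega>' \<in> E" unfolding S using * h[OF *] by simp
  qed
qed

end

subsection \<open>The law of the histories\<close>

context signals begin

text \<open>Given the state, a history of \<open>u\<close> has the probability of a cell of \<open>u\<close> times this factor, which does
  not involve the signal of \<open>u\<close>.\<close>

definition others :: "(nat \<Rightarrow> nat \<Rightarrow> (nat \<times> nat) set \<Rightarrow> 'w set) \<Rightarrow> (nat \<Rightarrow> nat set) \<Rightarrow> bool \<Rightarrow> nat \<Rightarrow> nat \<Rightarrow>
    (nat \<times> nat) set \<Rightarrow> real" where
  "others B N s u t g = (\<Sum>\<alpha>\<in>{\<alpha> \<in> Pow (horizon N u t). \<alpha> \<inter> past N u t = g}.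
     \<Prod>v\<in>nb N t u - {u}. measure (mu s) (cell m0 B N v (horizon N u t) \<alpha>))"

lemma others_nonneg: "others B N s u t g \<ge> 0"
  unfolding others_def by (intro sum_nonneg prod_nonneg) auto

lemma cell_sets:
  assumes "\<And>u t g. B u t g \<in> sets m0" "finite D"
  shows "cell m0 B N v D \<alpha> \<in> sets m0"
proof -
  have "{t. (v, t) \<in> D} = snd ` (D \<inter> {v} \<times> UNIV)" by force
  then have fin: "finite {t. (v, t) \<in> D}" using assms(2) by simp
  have "cell m0 B N v D \<alpha> = {x \<in> space m0. \<forall>t\<in>{t. (v, t) \<in> D}. (x \<in> B v t (\<alpha> \<inter> past N v t)) = ((v, t) \<in> \<alpha>)}"
    by (auto simp: cell_def)
  also have "\<dots> \<in> sets m0"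
  proof (rule sets.sets_Collect_finite_All[OF _ fin])
    fix t
    have "{x \<in> space m0. (x \<in> B v t (\<alpha> \<inter> past N v t)) = ((v, t) \<in> \<alpha>)} =
      (if (v, t) \<in> \<alpha> then B v t (\<alpha> \<inter> past N v t) else space m0 - B v t (\<alpha> \<inter> past N v t))"
      using sets.sets_into_space[OF assms(1)[of v t "\<alpha> \<inter> past N v t"]] by auto
    then show "{x \<in> space m0. (x \<in> B v t (\<alpha> \<inter> past N v t)) = ((v, t) \<in> \<alpha>)} \<in> sets m0"
      using assms(1) by auto
  qed
  finally show ?thesis .
qed

end

lemma past_mono: "t \<le> t' \<Longrightarrow> past N u t \<subseteq> past N u t'" by (auto simp: past_def)

lemma hist_restrict: "t \<le> t' \<Longrightarrow> hist N act u t' \<omega> \<inter> past N u t = hist N act u t \<omega>"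
  by (auto simp: hist_def past_def)

lemma cell_past_eq:
  "cell M B N u (past N u t) g = {x \<in> space M. \<forall>t'\<in>{1..<t}. (x \<in> B u t' (g \<inter> past N u t')) = ((u, t') \<in> g)}"
  by (auto simp: cell_def past_def)

text \<open>Induction on time: a signal that has passed all tests before time \<open>n\<close>
  already lies in the cell with which \<open>B\<close> is intersected at time \<open>n\<close>, so
  the intersection does not change the test there.\<close>

lemma cell_Int_cell:
  assumes "\<And>t g. B' u t g = B u t g \<inter> cell M B N u (past N u t) g"
  shows "cell M B' N u (past N u t) g = cell M B N u (past N u t) g"
proof -
  have "(\<forall>t'\<in>{1..<n}. (x \<in> B' u t' (g \<inter> past N u t')) = ((u, t') \<in> g)) \<longleftrightarrow>
      (\<forall>t'\<in>{1..<n}. (x \<in> B u t' (g \<inter> past N u t')) = ((u, t') \<in> g))" if x: "x \<in> space M" for x n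
  proof (induction n)
    case (Suc n)
    have sub: "g \<inter> past N u n \<inter> past N u t' = g \<inter> past N u t'" if "t' < n" for t'
      using past_mono[of t' n N u] that by auto
    have "x \<in> B' u n (g \<inter> past N u n) \<longleftrightarrow> x \<in> B u n (g \<inter> past N u n)"
      if h: "\<forall>t'\<in>{1..<n}. (x \<in> B u t' (g \<inter> past N u t')) = ((u, t') \<in> g)"
    proof -
      have "(u, t') \<in> past N u n" if "t' \<in> {1..<n}" for t' using that by (simp add: past_def)
      then have "x \<in> cell M B N u (past N u n) (g \<inter> past N u n)"
        unfolding cell_past_eq using x h sub by auto
      then show ?thesis unfolding assms by simp
    qed
    note step = this
    have suc: "(\<forall>t'\<in>{1..<Suc n}. P t') \<longleftrightarrow> (\<forall>t'\<in>{1..<n}. P t') \<and> (1 \<le> n \<longrightarrow> P n)" for P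
      by (auto simp: less_Suc_eq)
    show ?case
    proof (cases "\<forall>t'\<in>{1..<n}. (x \<in> B u t' (g \<inter> past N u t')) = ((u, t') \<in> g)")
      case True
      then show ?thesis using Suc step[OF True] unfolding suc by (simp only:)
    next
      case False
      then show ?thesis using Suc unfolding suc by (simp only:) simp
    qed
  qed simp
  then show ?thesis unfolding cell_past_eq by blast
qed

context network begin

text \<open>The representation is required almost surely only, which leaves room to trim the sets at
  histories of probability 0 and outside the own cell.\<close>

definition profile :: "(nat \<Rightarrow> nat \<Rightarrow> (nat \<times> nat) set \<Rightarrow> 'w set) \<Rightarrow> bool" where
  "profile B \<longleftrightarrow> (\<forall>u t g. B u t g \<in> sets m0) \<and>
    (AE \<omega> in W. \<forall>u\<in>V. \<forall>t\<ge>1. act u t \<omega> \<longleftrightarrow> snd \<omega> u \<in> B u t (hst u t \<omega>))"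

lemma act_event: "u \<in> V \<Longrightarrow> t \<ge> 1 \<Longrightarrow> {\<omega> \<in> space W. act u t \<omega> = b} \<in> sets W"
  using act_event_info info_sub by blast

text \<open>On a set closed under pasts, a configuration occurs almost surely exactly when each
  agent's signal lies in its own cell, because every agent may be tested against the configuration
  instead of the actual play. This decouples the agents, and independence of signals gives the
  product.\<close>

lemma config_law:
  assumes B: "profile B" and D: "finite D" "D \<subseteq> V \<times> {1..}" "\<And>v t. (v, t) \<in> D \<Longrightarrow> past N v t \<subseteq> D"
    and J: "finite J" "J \<subseteq> V" "fst ` D \<subseteq> J" and S: "\<And>v. v \<in> J \<Longrightarrow> S v \<in> sets m0"
  shows "mass V s {\<omega> \<in> space W. (\<forall>p\<in>D. act (fst p) (snd p) \<omega> = (p \<in> \<alpha>)) \<and> (\<forall>v\<in>J. snd \<omega> v \<in> S v)} =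
    (\<Prod>v\<in>J. measure (mu s) (cell m0 B N v D \<alpha> \<inter> S v)) / 2"
proof -
  have Bs: "\<And>u t g. B u t g \<in> sets m0" and rep: "AE \<omega> in W. \<forall>u\<in>V. \<forall>t\<ge>1. act u t \<omega> \<longleftrightarrow> snd \<omega> u \<in> B u t (hst u t \<omega>)"
    using B by (auto simp: profile_def)
  have cS: "cell m0 B N v D \<alpha> \<inter> S v \<in> sets m0" if "v \<in> J" for v
    using cell_sets[of B, OF Bs D(1)] S[OF that] by auto
  have Dev: "{\<omega> \<in> space W. \<forall>p\<in>D. act (fst p) (snd p) \<omega> = (p \<in> \<alpha>)} \<in> sets W"
    by (rule sets.sets_Collect_finite_All[OF _ D(1)]) (use D(2) act_event in auto)
  have Jev: "{\<omega> \<in> space W. \<forall>v\<in>J. snd \<omega> v \<in> T v} \<in> sets W" if "\<And>v. v \<in> J \<Longrightarrow> T v \<in> sets m0" for T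
    by (rule sets.sets_Collect_finite_All[OF _ J(1)]) (use J(2) coord_sets that in blast)
  have "mass V s {\<omega> \<in> space W. (\<forall>p\<in>D. act (fst p) (snd p) \<omega> = (p \<in> \<alpha>)) \<and> (\<forall>v\<in>J. snd \<omega> v \<in> S v)} =
    mass V s {\<omega> \<in> space W. \<forall>v\<in>J. snd \<omega> v \<in> cell m0 B N v D \<alpha> \<inter> S v}"
  proof (rule mass_cong_AE)
    show "{\<omega> \<in> space W. (\<forall>p\<in>D. act (fst p) (snd p) \<omega> = (p \<in> \<alpha>)) \<and> (\<forall>v\<in>J. snd \<omega> v \<in> S v)} \<in> sets W"
      using sets.Int[OF Dev Jev[of S, OF S]] by (simp add: Int_def conj_ac cong: conj_cong)
    show "{\<omega> \<in> space W. \<forall>v\<in>J. snd \<omega> v \<in> cell m0 B N v D \<alpha> \<inter> S v} \<in> sets W"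
      by (rule Jev) (rule cS)
    show "AE \<omega> in W. (\<omega> \<in> {\<omega> \<in> space W. (\<forall>p\<in>D. act (fst p) (snd p) \<omega> = (p \<in> \<alpha>)) \<and> (\<forall>v\<in>J. snd \<omega> v \<in> S v)}) =
      (\<omega> \<in> {\<omega> \<in> space W. \<forall>v\<in>J. snd \<omega> v \<in> cell m0 B N v D \<alpha> \<inter> S v})"
      using rep AE_space
    proof eventually_elim
      case (elim \<omega>)
      have actB: "act v t \<omega> \<longleftrightarrow> snd \<omega> v \<in> B v t (hst v t \<omega>)" if "(v, t) \<in> D" for v t
        using elim(1) that D(2) by auto
      have h: "hst v t \<omega> = \<alpha> \<inter> past N v t" if "(v, t) \<in> D" "\<And>p. p \<in> past N v t \<Longrightarrow> act (fst p) (snd p) \<omega> = (p \<in> \<alpha>)" for v t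
        using that(2) by (auto simp: hist_def)
      have "(\<forall>p\<in>D. act (fst p) (snd p) \<omega> = (p \<in> \<alpha>)) \<longleftrightarrow> (\<forall>v\<in>J. snd \<omega> v \<in> cell m0 B N v D \<alpha>)"
      proof
        assume a: "\<forall>p\<in>D. act (fst p) (snd p) \<omega> = (p \<in> \<alpha>)"
        show "\<forall>v\<in>J. snd \<omega> v \<in> cell m0 B N v D \<alpha>"
        proof
          fix v assume "v \<in> J"
          then have "snd \<omega> v \<in> space m0" using elim(2) J(2) by (auto simp: space_world)
          moreover have "(snd \<omega> v \<in> B v t (\<alpha> \<inter> past N v t)) = ((v, t) \<in> \<alpha>)" if "(v, t) \<in> D" for t
            using actB[OF that] h[OF that] a D(3)[OF that] that by fastforce
          ultimately show "snd \<omega> v \<in> cell m0 B N v D \<alpha>" by (simp add: cell_def)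
        qed
      next
        \<comment> \<open>In this direction the play follows \<open>\<alpha>\<close> by induction on
          time: the history seen by an agent has already been shown to agree with
          \<open>\<alpha>\<close>.\<close>
        assume a: "\<forall>v\<in>J. snd \<omega> v \<in> cell m0 B N v D \<alpha>"
        have "(v, t) \<in> D \<Longrightarrow> act v t \<omega> = ((v, t) \<in> \<alpha>)" for v t
        proof (induction t arbitrary: v rule: less_induct)
          case (less t)
          have "hst v t \<omega> = \<alpha> \<inter> past N v t"
          proof (rule h[OF less.prems])
            fix p assume p: "p \<in> past N v t"
            then have "snd p < t" by (auto simp: past_def)
            moreover have "(fst p, snd p) \<in> D" using p D(3)[OF less.prems] by auto
            ultimately show "act (fst p) (snd p) \<omega> = (p \<in> \<alpha>)" using less.IH[of "snd p" "fst p"] by simp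
          qed
          moreover have "v \<in> J" using less.prems J(3) by force
          then have "snd \<omega> v \<in> cell m0 B N v D \<alpha>" using a by blast
          ultimately show ?case using actB[OF less.prems] less.prems by (simp add: cell_def)
        qed
        then show "\<forall>p\<in>D. act (fst p) (snd p) \<omega> = (p \<in> \<alpha>)" by simp
      qed
      then show ?case by auto
    qed
  qed
  also have "\<dots> = (\<Prod>v\<in>J. measure (mu s) (cell m0 B N v D \<alpha> \<inter> S v)) / 2"
    by (rule mass_signals[OF J(1,2) cS])
  finally show ?thesis .
qed

text \<open>Sum of \<open>config_law\<close> over the configurations on the horizon that extend
  \<open>g\<close>. The own cell of \<open>u\<close> depends on \<open>g\<close> alone and factors
  out of the sum.\<close>

lemma hist_law:
  assumes B: "profile B" and u: "u \<in> V" and g: "g \<subseteq> past N u t" and S: "S \<in> sets m0"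
  shows "mass V s {\<omega> \<in> space W. hst u t \<omega> = g \<and> snd \<omega> u \<in> S} =
    others B N s u t g * measure (mu s) (cell m0 B N u (past N u t) g \<inter> S) / 2"
proof -
  let ?D = "horizon N u t" and ?J = "nb N t u"
  let ?A = "{\<alpha> \<in> Pow ?D. \<alpha> \<inter> past N u t = g}"
  define S' where "S' = (\<lambda>v. if v = u then S else space m0)"
  have S': "S' v \<in> sets m0" for v using S by (simp add: S'_def)
  define Ev where "Ev = (\<lambda>\<alpha>. {\<omega> \<in> space W. (\<forall>p\<in>?D. act (fst p) (snd p) \<omega> = (p \<in> \<alpha>)) \<and> (\<forall>v\<in>?J. snd \<omega> v \<in> S' v)})"
  have Bs: "\<And>u t g. B u t g \<in> sets m0" using B by (auto simp: profile_def)
  have DV: "?D \<subseteq> V \<times> {1..}" using horizon_subset[of N u t] nbV[OF u, of t] by fastforce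
  have D: "finite ?D" by (rule horizon_fin[OF u])
  have fJ: "fst ` ?D \<subseteq> ?J" using horizon_subset[of N u t] by fastforce
  have law: "mass V s (Ev \<alpha>) = (\<Prod>v\<in>?J. measure (mu s) (cell m0 B N v ?D \<alpha> \<inter> S' v)) / 2" for \<alpha>
    unfolding Ev_def by (rule config_law[OF B D DV past_horizon_closed nb_fin[OF u] nbV[OF u] fJ S'])
  have Evs: "Ev \<alpha> \<in> sets W" for \<alpha>
  proof -
    have "{\<omega> \<in> space W. \<forall>p\<in>?D. act (fst p) (snd p) \<omega> = (p \<in> \<alpha>)} \<in> sets W"
      by (rule sets.sets_Collect_finite_All[OF _ D]) (use DV act_event in auto)
    moreover have "{\<omega> \<in> space W. \<forall>v\<in>?J. snd \<omega> v \<in> S' v} \<in> sets W"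
      by (rule sets.sets_Collect_finite_All[OF _ nb_fin[OF u]]) (use nbV[OF u] coord_sets S' in blast)
    ultimately show ?thesis unfolding Ev_def by (intro sets.sets_Collect_conj)
  qed
  have eq: "{\<omega> \<in> space W. hst u t \<omega> = g \<and> snd \<omega> u \<in> S} = (\<Union>\<alpha>\<in>?A. Ev \<alpha>)"
  proof (intro equalityI subsetI)
    fix \<omega> assume \<omega>: "\<omega> \<in> {\<omega> \<in> space W. hst u t \<omega> = g \<and> snd \<omega> u \<in> S}"
    define \<alpha> where "\<alpha> = {p \<in> ?D. act (fst p) (snd p) \<omega>}"
    have "\<alpha> \<inter> past N u t = hst u t \<omega>"
      using past_subset_horizon[of N u t] by (auto simp: \<alpha>_def hist_def)
    then have "\<alpha> \<in> ?A" using \<omega> by (auto simp: \<alpha>_def)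
    moreover have "snd \<omega> v \<in> space m0" if "v \<in> ?J" for v
      using \<omega> nbV[OF u, of t] that by (auto simp: space_world)
    then have "\<forall>v\<in>?J. snd \<omega> v \<in> S' v" using \<omega> by (simp add: S'_def)
    then have "\<omega> \<in> Ev \<alpha>" using \<omega> by (simp add: Ev_def \<alpha>_def)
    ultimately show "\<omega> \<in> (\<Union>\<alpha>\<in>?A. Ev \<alpha>)" by blast
  next
    fix \<omega> assume "\<omega> \<in> (\<Union>\<alpha>\<in>?A. Ev \<alpha>)"
    then obtain \<alpha> where \<alpha>: "\<alpha> \<in> ?A" "\<omega> \<in> Ev \<alpha>" by blast
    have "\<forall>p\<in>past N u t. act (fst p) (snd p) \<omega> = (p \<in> g)"
    proof
      fix p assume p: "p \<in> past N u t"
      then have "p \<in> ?D" using past_subset_horizon[of N u t] by (rule subsetD[rotated])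
      then have "act (fst p) (snd p) \<omega> = (p \<in> \<alpha>)" using \<alpha>(2) by (simp add: Ev_def)
      also have "\<dots> = (p \<in> g)" using \<alpha>(1) p by auto
      finally show "act (fst p) (snd p) \<omega> = (p \<in> g)" .
    qed
    then have "hst u t \<omega> = g" using hist_eq_iff[OF g, of act] by blast
    moreover have "snd \<omega> u \<in> S" using \<alpha>(2) nb_self[of u N t] by (auto simp: Ev_def S'_def)
    ultimately show "\<omega> \<in> {\<omega> \<in> space W. hst u t \<omega> = g \<and> snd \<omega> u \<in> S}" using \<alpha>(2) by (simp add: Ev_def)
  qed
  have "mass V s (\<Union>\<alpha>\<in>?A. Ev \<alpha>) = (\<Sum>\<alpha>\<in>?A. mass V s (Ev \<alpha>))"
  proof (rule mass_UN[OF _ Evs])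
    show "finite ?A" using D by simp
    show "disjoint_family_on Ev ?A"
      unfolding disjoint_family_on_def
    proof (intro ballI impI)
      fix \<alpha> \<beta> assume ab: "\<alpha> \<in> ?A" "\<beta> \<in> ?A" "\<alpha> \<noteq> \<beta>"
      then obtain p where p: "(p \<in> \<alpha>) \<noteq> (p \<in> \<beta>)" by blast
      then have pD: "p \<in> ?D" using ab(1,2) by blast
      show "Ev \<alpha> \<inter> Ev \<beta> = {}"
      proof (rule equals0I)
        fix \<omega> assume "\<omega> \<in> Ev \<alpha> \<inter> Ev \<beta>"
        then have "act (fst p) (snd p) \<omega> = (p \<in> \<alpha>)" "act (fst p) (snd p) \<omega> = (p \<in> \<beta>)"
          using bspec[OF _ pD] unfolding Ev_def by blast+
        with p show False by simp
      qed
    qed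
  qed
  also have "\<dots> = (\<Sum>\<alpha>\<in>?A. (\<Prod>v\<in>?J - {u}. measure (mu s) (cell m0 B N v ?D \<alpha>)) *
      (measure (mu s) (cell m0 B N u (past N u t) g \<inter> S) / 2))"
  proof (rule sum.cong[OF refl])
    fix \<alpha> assume \<alpha>: "\<alpha> \<in> ?A"
    have "cell m0 B N u ?D \<alpha> = cell m0 B N u (past N u t) g"
    proof -
      \<comment> \<open>Since \<open>u\<close> belongs to every ball around itself, its own actions
        in the horizon are exactly those in its past.\<close>
      have 1: "(u, t') \<in> ?D \<longleftrightarrow> (u, t') \<in> past N u t" for t'
        using nb_self[of u N "t - t'"] by (auto simp: horizon_def past_def)
      have 2: "g \<inter> past N u t' = \<alpha> \<inter> past N u t'" "(u, t') \<in> g \<longleftrightarrow> (u, t') \<in> \<alpha>" if "(u, t') \<in> past N u t" for t'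
        using \<alpha> that past_mono[of t' t N u] by (auto simp: past_def)
      show ?thesis unfolding cell_def by (simp add: 1 2 cong: imp_cong conj_cong)
    qed
    moreover have "cell m0 B N v ?D \<alpha> \<inter> space m0 = cell m0 B N v ?D \<alpha>" for v by (auto simp: cell_def)
    ultimately show "mass V s (Ev \<alpha>) = (\<Prod>v\<in>?J - {u}. measure (mu s) (cell m0 B N v ?D \<alpha>)) *
      (measure (mu s) (cell m0 B N u (past N u t) g \<inter> S) / 2)"
      unfolding law by (subst prod.remove[OF nb_fin[OF u] nb_self]) (simp add: S'_def)
  qed
  finally show ?thesis unfolding eq by (simp add: others_def sum_distrib_right)
qed

text \<open>The trimming prepares the passage to limits. Inside the own cell the threshold rule of
  \<open>profile_threshold\<close> governs the whole set; at histories of probability 0, where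
  optimality says nothing, the set is empty.\<close>

lemma normal_profile:
  "\<exists>B. profile B \<and> (\<forall>u\<in>V. \<forall>t\<ge>1. \<forall>g. B u t g \<subseteq> cell m0 B N u (past N u t) g \<and>
    (measure W {\<omega> \<in> space W. hst u t \<omega> = g} = 0 \<longrightarrow> B u t g = {}))"
proof -
  interpret WP: prob_space W by (rule prob_world)
  obtain B0 where B0: "\<And>u t g. B0 u t g \<in> sets m0"
    "\<And>u t \<omega>. u \<in> V \<Longrightarrow> t \<ge> 1 \<Longrightarrow> \<omega> \<in> space W \<Longrightarrow> act u t \<omega> \<longleftrightarrow> snd \<omega> u \<in> B0 u t (hst u t \<omega>)"
    using act_strategy by blast
  define null where "null = (\<lambda>u t g. measure W {\<omega> \<in> space W. hst u t \<omega> = g} = 0)"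
  define B1 where "B1 = (\<lambda>u t g. if null u t g then {} else B0 u t g)"
  \<comment> \<open>The cell is formed from \<open>B1\<close>; for agents of the network,
    \<open>cell_Int_cell\<close> shows that forming it from \<open>B\<close> itself gives the same
    set.\<close>
  define B where "B = (\<lambda>u t g. if u \<in> V then B1 u t g \<inter> cell m0 B1 N u (past N u t) g else {})"
  have B1s: "B1 u t g \<in> sets m0" for u t g using B0(1) by (simp add: B1_def)
  have Bs: "B u t g \<in> sets m0" for u t g
    unfolding B_def using B1s cell_sets[of B1, OF B1s past_fin] by auto
  have nonnull: "AE \<omega> in W. \<not> null u t (hst u t \<omega>)" if u: "u \<in> V" "t \<ge> 1" for u t
  proof -
    have "AE \<omega> in W. \<forall>g\<in>{g \<in> Pow (past N u t). null u t g}. hst u t \<omega> \<noteq> g"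
    proof (rule AE_finite_allI)
      show "finite {g \<in> Pow (past N u t). null u t g}" using past_fin[OF u(1)] by simp
      fix g assume "g \<in> {g \<in> Pow (past N u t). null u t g}"
      moreover have "{\<omega> \<in> space W. hst u t \<omega> = g} \<in> sets W"
        using hist_event_info[OF u(1)] info_sub[OF u] by blast
      ultimately show "AE \<omega> in W. hst u t \<omega> \<noteq> g"
        by (intro AE_I[where N = "{\<omega> \<in> space W. hst u t \<omega> = g}"]) (auto simp: null_def WP.emeasure_eq_measure)
    qed
    then show ?thesis
    proof eventually_elim
      case (elim \<omega>)
      have "hst u t \<omega> \<in> Pow (past N u t)" by (rule PowI[OF hist_subset])
      then show ?case using elim by blast
    qed
  qed
  have "AE \<omega> in W. \<forall>u t. u \<in> V \<longrightarrow> t \<ge> 1 \<longrightarrow> \<not> null u t (hst u t \<omega>)"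
    unfolding AE_all_countable using nonnull by (auto intro: AE_I2)
  then have rep: "AE \<omega> in W. \<forall>u\<in>V. \<forall>t\<ge>1. act u t \<omega> \<longleftrightarrow> snd \<omega> u \<in> B u t (hst u t \<omega>)"
    using AE_space
  proof eventually_elim
    case (elim \<omega>)
    have a1: "act u t \<omega> \<longleftrightarrow> snd \<omega> u \<in> B1 u t (hst u t \<omega>)" if "u \<in> V" "t \<ge> 1" for u t
      using elim that B0(2)[OF that elim(2)] by (simp add: B1_def)
    show ?case
    proof (intro ballI allI impI)
      fix u t assume u: "u \<in> V" "1 \<le> (t :: nat)"
      have "snd \<omega> u \<in> space m0" using elim(2) u by (auto simp: space_world)
      moreover have "(snd \<omega> u \<in> B1 u t' (hst u t \<omega> \<inter> past N u t')) = ((u, t') \<in> hst u t \<omega>)" if "t' \<in> {1..<t}" for t'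
        using a1[OF u(1), of t'] that hist_restrict[of t' t N act u \<omega>] by (simp add: hist_def past_def)
      ultimately have "snd \<omega> u \<in> cell m0 B1 N u (past N u t) (hst u t \<omega>)"
        unfolding cell_past_eq by simp
      then show "act u t \<omega> \<longleftrightarrow> snd \<omega> u \<in> B u t (hst u t \<omega>)"
        using a1[OF u] u by (simp add: B_def)
    qed
  qed
  have "B u t g \<subseteq> cell m0 B N u (past N u t) g \<and> (null u t g \<longrightarrow> B u t g = {})" if "u \<in> V" for u t g
  proof -
    have "cell m0 B N u (past N u t) g = cell m0 B1 N u (past N u t) g"
      by (rule cell_Int_cell) (simp add: B_def that)
    then show ?thesis by (auto simp: B_def B1_def that)
  qed
  with rep Bs show ?thesis by (intro exI[of _ B]) (simp add: profile_def null_def)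
qed

end

section \<open>Optimality of strategies in equilibrium\<close>

locale equilibrium = network m0 m1 G act for m0 m1 :: "'w measure" and G act +
  assumes action_process: "action_process m0 m1 G act"
begin

lemma act_gain:
  assumes u: "u \<in> V" "t \<ge> 1" and E: "E \<in> sets (infm u t)"
  shows "gain V (E \<inter> {\<omega> \<in> space W. act u t \<omega>}) \<ge> 0" "gain V (E - {\<omega> \<in> space W. act u t \<omega>}) \<le> 0"
proof -
  have A: "{\<omega> \<in> space W. act u t \<omega>} \<in> sets (infm u t)" using act_event_info[OF u, of True] by simp
  have "AE \<omega> in W. (belief m0 m1 G (infm u t) \<omega> < 1/2 \<longrightarrow> act u t \<omega> = False) \<and>
           (belief m0 m1 G (infm u t) \<omega> > 1/2 \<longrightarrow> act u t \<omega> = True)"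
    using action_process u unfolding action_process_def by blast
  then have "AE \<omega> in W. (real_cond_exp W (infm u t) (indicator {\<omega>. fst \<omega> = True}) \<omega> < 1/2 \<longrightarrow> \<omega> \<notin> {\<omega> \<in> space W. act u t \<omega>}) \<and>
           (real_cond_exp W (infm u t) (indicator {\<omega>. fst \<omega> = True}) \<omega> > 1/2 \<longrightarrow> \<omega> \<in> {\<omega> \<in> space W. act u t \<omega>})"
    using AE_space unfolding belief_def by eventually_elim auto
  from gain_optimal[OF info_subalgebra[OF u] A E this]
  show "gain V (E \<inter> {\<omega> \<in> space W. act u t \<omega>}) \<ge> 0" "gain V (E - {\<omega> \<in> space W. act u t \<omega>}) \<le> 0" .
qed

text \<open>Exchanging \<open>E\<close> for the action removes a piece of nonpositive gain and adds
  one of nonnegative gain.\<close>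

lemma act_gain_max:
  assumes u: "u \<in> V" "t \<ge> 1" and E: "E \<in> sets (infm u t)"
  shows "gain V E \<le> gain V {\<omega> \<in> space W. act u t \<omega>}"
proof -
  let ?A = "{\<omega> \<in> space W. act u t \<omega>}"
  have A: "?A \<in> sets W" using act_event[OF u, of True] by simp
  have E': "E \<in> sets W" using E info_sub[OF u] by blast
  have sp: "space W \<in> sets (infm u t)" using space_info[of u t] sets.top[of "infm u t"] by simp
  have A': "?A \<in> sets (infm u t)" using act_event_info[OF u, of True] by simp
  have "gain V X = gain V (X \<inter> Y) + gain V (X - Y)" if "X \<in> sets W" "Y \<in> sets W" for X Y
  proof -
    have "X \<inter> Y \<union> (X - Y) = X" "X \<inter> Y \<inter> (X - Y) = {}" by blast+
    then show ?thesis using mass_Un[of "X \<inter> Y" V "X - Y"] that by (simp add: gain_def)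
  qed
  from this[OF E' A] this[OF A E']
  have "gain V E - gain V ?A = gain V (E - ?A) - gain V (?A - E)" by (simp add: Int_commute)
  moreover have "?A - E = (space W - E) \<inter> ?A" by blast
  moreover have "space W - E \<in> sets (infm u t)" using E sp by blast
  ultimately show ?thesis using act_gain(2)[OF u E] act_gain(1)[OF u, of "space W - E"] by simp
qed

text \<open>The action is optimal on each event given by a history \<open>g\<close> and a signal set
  \<open>S\<close>, and \<open>hist_law\<close> expresses the masses of such events by strategy
  sets. The result involves only signal laws and finitely many decisions, so it can be carried to a
  limit.\<close>

lemma profile_optimal:
  assumes B: "profile B" and u: "u \<in> V" "t \<ge> 1" and g: "g \<subseteq> past N u t" and S: "S \<in> sets m0"
  shows "others B N True u t g * measure (mu True) (cell m0 B N u (past N u t) g \<inter> (B u t g \<inter> S)) \<ge>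
      others B N False u t g * measure (mu False) (cell m0 B N u (past N u t) g \<inter> (B u t g \<inter> S))"
    and "others B N True u t g * measure (mu True) (cell m0 B N u (past N u t) g \<inter> (S - B u t g)) \<le>
      others B N False u t g * measure (mu False) (cell m0 B N u (past N u t) g \<inter> (S - B u t g))"
proof -
  have Bs: "\<And>u t g. B u t g \<in> sets m0" and rep: "AE \<omega> in W. \<forall>u\<in>V. \<forall>t\<ge>1. act u t \<omega> \<longleftrightarrow> snd \<omega> u \<in> B u t (hst u t \<omega>)"
    using B by (auto simp: profile_def)
  let ?A = "{\<omega> \<in> space W. act u t \<omega>}"
  have A: "?A \<in> sets W" using act_event[OF u, of True] by simp
  have ev: "{\<omega> \<in> space W. hst u t \<omega> = g \<and> snd \<omega> u \<in> S} \<in> sets (infm u t)" if "S \<in> sets m0" for S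
    using sets.sets_Collect_conj[of "infm u t"] hist_event_info[OF u(1), of t g] coord_info[OF that, of u t]
    by (simp add: space_info)
  have evW: "{\<omega> \<in> space W. hst u t \<omega> = g \<and> snd \<omega> u \<in> S} \<in> sets W" if "S \<in> sets m0" for S
    using ev[OF that] info_sub[OF u] by blast
  let ?E = "{\<omega> \<in> space W. hst u t \<omega> = g \<and> snd \<omega> u \<in> S}"
  have 1: "mass V s (?E \<inter> ?A) = mass V s {\<omega> \<in> space W. hst u t \<omega> = g \<and> snd \<omega> u \<in> B u t g \<inter> S}" for s
  proof (rule mass_cong_AE)
    show "AE \<omega> in W. (\<omega> \<in> ?E \<inter> ?A) = (\<omega> \<in> {\<omega> \<in> space W. hst u t \<omega> = g \<and> snd \<omega> u \<in> B u t g \<inter> S})"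
      using rep by eventually_elim (use u in auto)
  qed (use evW[OF S] A evW[of "B u t g \<inter> S"] S Bs in auto)
  have 2: "mass V s (?E - ?A) = mass V s {\<omega> \<in> space W. hst u t \<omega> = g \<and> snd \<omega> u \<in> S - B u t g}" for s
  proof (rule mass_cong_AE)
    show "AE \<omega> in W. (\<omega> \<in> ?E - ?A) = (\<omega> \<in> {\<omega> \<in> space W. hst u t \<omega> = g \<and> snd \<omega> u \<in> S - B u t g})"
      using rep by eventually_elim (use u in auto)
  qed (use evW[OF S] A evW[of "S - B u t g"] S Bs in auto)
  have s: "B u t g \<inter> S \<in> sets m0" "S - B u t g \<in> sets m0" using S Bs by auto
  show "others B N True u t g * measure (mu True) (cell m0 B N u (past N u t) g \<inter> (B u t g \<inter> S)) \<ge>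
      others B N False u t g * measure (mu False) (cell m0 B N u (past N u t) g \<inter> (B u t g \<inter> S))"
    using act_gain(1)[OF u ev[OF S]] unfolding gain_def 1 hist_law[OF B u(1) g s(1)] by simp
  show "others B N True u t g * measure (mu True) (cell m0 B N u (past N u t) g \<inter> (S - B u t g)) \<le>
      others B N False u t g * measure (mu False) (cell m0 B N u (past N u t) g \<inter> (S - B u t g))"
    using act_gain(2)[OF u ev[OF S]] unfolding gain_def 2 hist_law[OF B u(1) g s(2)] by simp
qed

end

subsection \<open>Bhattacharyya coefficients of histories\<close>

text \<open>Origin of the constant: the roots of \<open>p\<close> and \<open>q\<close> add up to at
  most 2, so they differ by at least \<open>\<delta> / 2\<close>, and completing the square puts
  \<open>sqrt (p * q)\<close> at least \<open>\<delta>\<^sup>2 / 8\<close> below the mean of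
  \<open>p\<close> and \<open>q\<close>. The other root is at most its arithmetic mean, and the two
  means add up to 1.\<close>

lemma sqrt_binary_le:
  fixes p q :: real
  assumes "0 \<le> p" "q \<le> 1" "\<delta> \<le> q - p" "0 < \<delta>"
  shows "sqrt (p * q) + sqrt ((1 - p) * (1 - q)) \<le> 1 - \<delta>\<^sup>2 / 8"
proof -
  have pq: "0 \<le> q" "p \<le> 1" using assms by linarith+
  have "sqrt q - sqrt p \<ge> \<delta> / 2"
  proof -
    have "\<delta> \<le> (sqrt q - sqrt p) * (sqrt q + sqrt p)"
      using assms pq by (simp add: algebra_simps power2_eq_square[symmetric])
    also have "\<dots> \<le> (sqrt q - sqrt p) * 2"
      using assms pq real_sqrt_le_1_iff[of p] real_sqrt_le_1_iff[of q]
      by (intro mult_left_mono) (auto simp: add_mono intro: order_trans[OF add_mono[of _ 1 _ 1]])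
    finally show ?thesis by simp
  qed
  then have "(\<delta> / 2)\<^sup>2 \<le> (sqrt q - sqrt p)\<^sup>2" using assms(4) by (intro power_mono) auto
  also have "\<dots> = p + q - 2 * sqrt (p * q)"
    using assms pq by (simp add: power2_diff real_sqrt_mult)
  finally have "\<delta>\<^sup>2 / 4 \<le> p + q - 2 * sqrt (p * q)" by (simp add: power_divide)
  moreover have "x \<le> (p + q) / 2 - y / 8" if "y / 4 \<le> p + q - 2 * x" for x y using that by (simp add: field_simps)
  ultimately have "sqrt (p * q) \<le> (p + q) / 2 - \<delta>\<^sup>2 / 8" by blast
  moreover have "sqrt ((1 - p) * (1 - q)) \<le> (1 - p + (1 - q)) / 2"
    using assms pq by (intro arith_geo_mean_sqrt) auto
  ultimately show ?thesis by (simp add: field_simps)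
qed

text \<open>Cauchy-Schwarz for the vectors of square roots.\<close>

lemma sum_sqrt_mult_le:
  fixes a b :: "'i \<Rightarrow> real"
  assumes "\<And>i. i \<in> I \<Longrightarrow> a i \<ge> 0" "\<And>i. i \<in> I \<Longrightarrow> b i \<ge> 0"
  shows "(\<Sum>i\<in>I. sqrt (a i * b i)) \<le> sqrt ((\<Sum>i\<in>I. a i) * (\<Sum>i\<in>I. b i))"
proof -
  have "(\<Sum>i\<in>I. sqrt (a i * b i)) = (\<Sum>i\<in>I. \<bar>sqrt (a i)\<bar> * \<bar>sqrt (b i)\<bar>)"
    using assms by (intro sum.cong) (auto simp: real_sqrt_mult)
  also have "\<dots> \<le> L2_set (\<lambda>i. sqrt (a i)) I * L2_set (\<lambda>i. sqrt (b i)) I"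
    by (rule L2_set_mult_ineq)
  also have "\<dots> = sqrt ((\<Sum>i\<in>I. a i) * (\<Sum>i\<in>I. b i))"
    using assms by (simp add: L2_set_def real_sqrt_mult)
  finally show ?thesis .
qed

text \<open>The square root is Hoelder continuous of order 1/2, and each factor can be replaced at
  the cost \<open>sqrt e\<close> because the factor kept meanwhile is at most 1.\<close>

lemma sqrt_mult_diff_le:
  fixes a b c d :: real
  assumes "0 \<le> a" "0 \<le> b" "b \<le> 1" "0 \<le> c" "c \<le> 1" "0 \<le> d" and "\<bar>a - c\<bar> \<le> e" "\<bar>b - d\<bar> \<le> e"
  shows "sqrt (a * b) \<le> sqrt (c * d) + 2 * sqrt e"
proof -
  have s: "sqrt x \<le> sqrt y + sqrt e" if "0 \<le> y" "\<bar>x - y\<bar> \<le> e" for x y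
  proof -
    have "sqrt x \<le> sqrt (y + e)" using that by (intro real_sqrt_le_mono) linarith
    also have "\<dots> \<le> sqrt y + sqrt e" using that by (intro sqrt_add_le_add_sqrt) auto
    finally show ?thesis .
  qed
  have e: "0 \<le> e" using assms(7) by linarith
  have "sqrt (a * b) = sqrt a * sqrt b" by (rule real_sqrt_mult)
  also have "\<dots> \<le> (sqrt c + sqrt e) * sqrt b"
    using s[OF assms(4,7)] assms by (intro mult_right_mono) auto
  also have "\<dots> = sqrt c * sqrt b + sqrt e * sqrt b" by (simp add: algebra_simps)
  also have "\<dots> \<le> sqrt c * (sqrt d + sqrt e) + sqrt e * 1"
    using s[OF assms(6,8)] assms e by (intro add_mono mult_left_mono) auto
  also have "\<dots> = sqrt c * sqrt d + sqrt c * sqrt e + sqrt e" by (simp add: algebra_simps)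
  also have "\<dots> \<le> sqrt c * sqrt d + 1 * sqrt e + sqrt e"
    using assms e by (intro add_mono mult_right_mono) auto
  finally show ?thesis by (simp add: real_sqrt_mult)
qed

context signals begin

text \<open>Half the usual coefficient of the two conditional laws, as the masses are joint with the
  state; a constant \<open>X\<close> with value in \<open>R\<close> gives 1/2.\<close>

definition bhattacharyya :: "nat set \<Rightarrow> 'c set \<Rightarrow> ('w outcome \<Rightarrow> 'c) \<Rightarrow> real" where
  "bhattacharyya V R X = (\<Sum>r\<in>R. sqrt (mass V False {\<omega> \<in> space (world m0 m1 V). X \<omega> = r} *
     mass V True {\<omega> \<in> space (world m0 m1 V). X \<omega> = r}))"

text \<open>Discarding information increases the coefficient: Cauchy-Schwarz within each fibre of
  \<open>f\<close>.\<close>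

lemma bhattacharyya_coarsen:
  assumes R: "finite R" "finite R'" "f ` R \<subseteq> R'"
    and X: "\<And>r. r \<in> R \<Longrightarrow> {\<omega> \<in> space (world m0 m1 V). X \<omega> = r} \<in> sets (world m0 m1 V)"
    and XR: "\<And>\<omega>. \<omega> \<in> space (world m0 m1 V) \<Longrightarrow> X \<omega> \<in> R"
  shows "bhattacharyya V R X \<le> bhattacharyya V R' (\<lambda>\<omega>. f (X \<omega>))"
proof -
  let ?E = "\<lambda>r. {\<omega> \<in> space (world m0 m1 V). X \<omega> = r}"
  have m: "mass V s {\<omega> \<in> space (world m0 m1 V). f (X \<omega>) = c} = (\<Sum>r\<in>{r \<in> R. f r = c}. mass V s (?E r))" for s c
  proof -
    have "{\<omega> \<in> space (world m0 m1 V). f (X \<omega>) = c} = (\<Union>r\<in>{r \<in> R. f r = c}. ?E r)"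
      using XR by auto
    then show ?thesis
      using R(1) X by (simp only:) (rule mass_UN; auto simp: disjoint_family_on_def)
  qed
  have "bhattacharyya V R X = (\<Sum>c\<in>R'. \<Sum>r\<in>{r \<in> R. f r = c}. sqrt (mass V False (?E r) * mass V True (?E r)))"
    unfolding bhattacharyya_def by (rule sum.group[OF R, symmetric])
  also have "\<dots> \<le> (\<Sum>c\<in>R'. sqrt ((\<Sum>r\<in>{r \<in> R. f r = c}. mass V False (?E r)) * (\<Sum>r\<in>{r \<in> R. f r = c}. mass V True (?E r))))"
    by (intro sum_mono sum_sqrt_mult_le mass_nonneg)
  also have "\<dots> = bhattacharyya V R' (\<lambda>\<omega>. f (X \<omega>))" unfolding bhattacharyya_def m ..
  finally show ?thesis .
qed

end

context network begin

definition bhat :: "nat \<Rightarrow> nat \<Rightarrow> real" where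
  "bhat u t = bhattacharyya V (Pow (past N u t)) (hst u t)"

lemma hist_event: "u \<in> V \<Longrightarrow> {\<omega> \<in> space W. hst u t \<omega> = g} \<in> sets W"
proof -
  assume u: "u \<in> V"
  have "{\<omega> \<in> space W. hst u t \<omega> = g} \<in> sets (infm u (max 1 t))"
    using hist_event_info[OF u, of t g] info_mono[of t "max 1 t" u] by auto
  then show ?thesis using info_sub[OF u, of "max 1 t"] by auto
qed

lemma bhat_antimono:
  assumes u: "u \<in> V" and t: "t \<le> t'" shows "bhat u t' \<le> bhat u t"
proof -
  have "bhat u t' \<le> bhattacharyya V (Pow (past N u t)) (\<lambda>\<omega>. hst u t' \<omega> \<inter> past N u t)"
    unfolding bhat_def
    by (rule bhattacharyya_coarsen) (use past_fin[OF u] hist_event[OF u] in \<open>auto intro: subsetD[OF hist_subset]\<close>)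
  then show ?thesis unfolding bhat_def hist_restrict[OF t] .
qed

section \<open>The limiting information and its optimal action\<close>

lemma limit_info_eq:
  "sets (limit_info m0 m1 G act u) = sigma_sets (space W) (\<Union>t\<in>{1..}. sets (infm u t))"
  "space (limit_info m0 m1 G act u) = space W"
proof -
  have sub: "(\<Union>t\<in>{1..}. sets (infm u t)) \<subseteq> Pow (space W)"
    using sets.sets_into_space space_info by fastforce
  show "sets (limit_info m0 m1 G act u) = sigma_sets (space W) (\<Union>t\<in>{1..}. sets (infm u t))"
    unfolding limit_info_def by (rule sets_measure_of[OF sub])
  show "space (limit_info m0 m1 G act u) = space W"
    unfolding limit_info_def by (rule space_measure_of[OF sub])
qed

lemma limit_subalgebra: "u \<in> V \<Longrightarrow> subalgebra W (limit_info m0 m1 G act u)"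
proof -
  assume u: "u \<in> V"
  have "(\<Union>t\<in>{1..}. sets (infm u t)) \<subseteq> sets W" using info_sub[OF u] by auto
  then show ?thesis unfolding subalgebra_def limit_info_eq by (simp add: sets.sigma_sets_subset)
qed

lemma info_limit: "t \<ge> 1 \<Longrightarrow> E \<in> sets (infm u t) \<Longrightarrow> E \<in> sets (limit_info m0 m1 G act u)"
  unfolding limit_info_eq by (auto intro: sigma_sets.Basic)

lemma limit_info_approx:
  assumes u: "u \<in> V" and E: "E \<in> sets (limit_info m0 m1 G act u)" and "\<epsilon> > 0"
  shows "\<exists>t\<ge>1. \<exists>E'\<in>sets (infm u t). measure W (sym_diff E E') < \<epsilon>"
proof -
  have "\<exists>t\<in>{1..}. \<exists>E'\<in>sets (infm u t). measure W (sym_diff E E') < \<epsilon>"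
  proof (rule sigma_union_approx[OF prob_world])
    fix t t' :: nat assume "t \<in> {1..}" "t' \<in> {1..}"
    then show "\<exists>v\<in>{1..}. sets (infm u t) \<subseteq> sets (infm u v) \<and> sets (infm u t') \<subseteq> sets (infm u v)"
      using info_mono[of t "max t t'" u] info_mono[of t' "max t t'" u] by (intro bexI[of _ "max t t'"]) auto
  qed (use E info_sub[OF u] space_info \<open>\<epsilon> > 0\<close> in \<open>simp_all add: limit_info_eq\<close>)
  then show ?thesis by auto
qed

definition bel :: "nat \<Rightarrow> 'w outcome \<Rightarrow> real" where
  "bel u = belief m0 m1 G (limit_info m0 m1 G act u)"

definition likely :: "nat \<Rightarrow> 'w outcome set" where
  "likely u = {\<omega> \<in> space W. bel u \<omega> > 1 / 2}"

definition tie :: "nat \<Rightarrow> 'w outcome set" where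
  "tie u = {\<omega> \<in> space W. bel u \<omega> = 1 / 2}"

lemma bel_eq: "bel u = real_cond_exp W (limit_info m0 m1 G act u) (indicator {\<omega>. fst \<omega> = True})"
  by (simp add: bel_def belief_def)

lemma bel_measurable [measurable]: "bel u \<in> borel_measurable (limit_info m0 m1 G act u)"
  unfolding bel_eq by (rule borel_measurable_cond_exp)

lemma likely_limit: "likely u \<in> sets (limit_info m0 m1 G act u)"
  unfolding likely_def limit_info_eq(2)[of u, symmetric] by measurable

lemma tie_limit: "tie u \<in> sets (limit_info m0 m1 G act u)"
  unfolding tie_def limit_info_eq(2)[of u, symmetric] by measurable

lemma limit_W: "u \<in> V \<Longrightarrow> E \<in> sets (limit_info m0 m1 G act u) \<Longrightarrow> E \<in> sets W"
  using limit_subalgebra[of u] unfolding subalgebra_def by blast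

lemma gain_tie:
  assumes u: "u \<in> V" and E: "E \<in> sets (limit_info m0 m1 G act u)" "E \<subseteq> tie u"
  shows "gain V E = 0"
proof -
  have "gain V E = (\<integral>\<omega>. indicator E \<omega> * (2 * bel u \<omega> - 1) \<partial>W)"
    unfolding bel_eq by (rule gain_eq_integral(1)[OF limit_subalgebra[OF u] E(1)])
  also have "\<dots> = (\<integral>\<omega>. 0 \<partial>W)"
    by (intro Bochner_Integration.integral_cong) (use E(2) in \<open>auto simp: indicator_def tie_def\<close>)
  finally show ?thesis by simp
qed

lemma gain_likely:
  assumes u: "u \<in> V" and E: "E \<in> sets (limit_info m0 m1 G act u)"
  shows "gain V (likely u) - gain V E = (\<integral>\<omega>. indicator (sym_diff (likely u) E) \<omega> * \<bar>2 * bel u \<omega> - 1\<bar> \<partial>W)"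
    "integrable W (\<lambda>\<omega>. indicator (sym_diff (likely u) E) \<omega> * \<bar>2 * bel u \<omega> - 1\<bar>)"
    "gain V E \<le> gain V (likely u)"
proof -
  show eq: "gain V (likely u) - gain V E = (\<integral>\<omega>. indicator (sym_diff (likely u) E) \<omega> * \<bar>2 * bel u \<omega> - 1\<bar> \<partial>W)"
    "integrable W (\<lambda>\<omega>. indicator (sym_diff (likely u) E) \<omega> * \<bar>2 * bel u \<omega> - 1\<bar>)"
    using gain_Diff_eq[OF limit_subalgebra[OF u] E] unfolding likely_def bel_eq by auto
  have "0 \<le> (\<integral>\<omega>. indicator (sym_diff (likely u) E) \<omega> * \<bar>2 * bel u \<omega> - 1\<bar> \<partial>W)"
    by (intro Bochner_Integration.integral_nonneg) auto
  with eq(1) show "gain V E \<le> gain V (likely u)" by linarith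
qed

text \<open>The likelihood rule on a finite history errs with probability at most
  \<open>bhat\<close>, since \<open>min x y \<le> sqrt (x * y)\<close> for nonnegative numbers, and
  the limiting information gains at least as much. Each state is then missed with mass at most
  \<open>b\<close>, ties included; the two states account for the factor 2.\<close>

lemma correct_prob_ge:
  assumes u: "u \<in> V" and b: "bhat u t \<le> b" and A: "common_optimal_action_set m0 m1 G act A"
  shows "measure W {\<omega> \<in> space W. A \<omega> = {fst \<omega>}} \<ge> 1 - 2 * b"
proof -
  interpret WP: prob_space W by (rule prob_world)
  define H where "H = (\<lambda>g. {\<omega> \<in> space W. hst u t \<omega> = g})"
  have H: "H g \<in> sets W" for g unfolding H_def by (rule hist_event[OF u])
  define Yb where "Yb = {g \<in> Pow (past N u t). mass V True (H g) \<ge> mass V False (H g)}"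
  let ?P = "Pow (past N u t)"
  have fin: "finite ?P" using past_fin[OF u] by simp
  define E where "E = (\<Union>g\<in>Yb. H g)"
  have disj: "disjoint_family_on H I" for I by (auto simp: disjoint_family_on_def H_def)
  have mE: "mass V s E = (\<Sum>g\<in>Yb. mass V s (H g))" for s
    unfolding E_def by (rule mass_UN[OF _ H disj]) (use fin in \<open>auto simp: Yb_def\<close>)
  have tot: "(\<Sum>g\<in>?P. mass V s (H g)) = 1 / 2" for s
  proof -
    have "mass V s (\<Union>g\<in>?P. H g) = (\<Sum>g\<in>?P. mass V s (H g))" by (rule mass_UN[OF fin H disj])
    moreover have "(\<Union>g\<in>?P. H g) = space W"
      unfolding H_def using hist_subset[of N act u t] by auto
    ultimately show ?thesis using mass_space[of V s] by simp
  qed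
  have "mass V False E + (1 / 2 - mass V True E) \<le> b"
  proof -
    have "1 / 2 - mass V True E = (\<Sum>g\<in>?P - Yb. mass V True (H g))"
      unfolding mE tot[of True, symmetric] by (subst sum_diff[OF fin]) (auto simp: Yb_def)
    then have "mass V False E + (1 / 2 - mass V True E) = (\<Sum>g\<in>Yb. mass V False (H g)) + (\<Sum>g\<in>?P - Yb. mass V True (H g))"
      by (simp add: mE)
    also have "\<dots> \<le> (\<Sum>g\<in>Yb. sqrt (mass V False (H g) * mass V True (H g))) + (\<Sum>g\<in>?P - Yb. sqrt (mass V False (H g) * mass V True (H g)))"
    proof (intro add_mono sum_mono)
      fix g assume "g \<in> Yb"
      then show "mass V False (H g) \<le> sqrt (mass V False (H g) * mass V True (H g))"
        using mass_nonneg[of V] by (intro real_le_rsqrt) (simp add: power2_eq_square Yb_def mult_left_mono)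
    next
      fix g assume "g \<in> ?P - Yb"
      then have "mass V True (H g) \<le> mass V False (H g)" by (auto simp: Yb_def)
      then show "mass V True (H g) \<le> sqrt (mass V False (H g) * mass V True (H g))"
        by (intro real_le_rsqrt) (simp add: power2_eq_square mult_right_mono mass_nonneg)
    qed
    also have "\<dots> = (\<Sum>g\<in>?P. sqrt (mass V False (H g) * mass V True (H g)))"
      by (subst sum.subset_diff[of Yb ?P]) (use fin in \<open>auto simp: Yb_def\<close>)
    also have "\<dots> = bhat u t" by (simp add: bhat_def bhattacharyya_def H_def)
    finally show ?thesis using b by linarith
  qed
  then have gE: "gain V E \<ge> 1 / 2 - b" by (simp add: gain_def)
  have "E \<in> sets (infm u (max 1 t))"
    unfolding E_def H_def using hist_event_info[OF u, of t] info_mono[of t "max 1 t" u] fin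
    by (intro sets.finite_UN) (auto simp: Yb_def)
  then have "E \<in> sets (limit_info m0 m1 G act u)" by (rule info_limit[rotated]) simp
  then have gA: "gain V (likely u) \<ge> 1 / 2 - b" using gain_likely(3)[OF u] gE by (meson order_trans)
  have aW: "likely u \<in> sets W" and tW: "tie u \<in> sets W"
    using limit_W[OF u] likely_limit tie_limit by blast+
  have gT: "gain V (tie u) = 0" by (rule gain_tie[OF u tie_limit]) simp
  have un: "mass V s (likely u \<union> tie u) = mass V s (likely u) + mass V s (tie u)" for s
    by (rule mass_Un[OF aW tW]) (auto simp: likely_def tie_def)
  have 1: "mass V True (likely u) \<ge> 1 / 2 - b" using gA mass_nonneg[of V False "likely u"] by (simp add: gain_def)
  \<comment> \<open>Ties count as failures because the action set must be a singleton. They have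
    gain 0, so adding them to \<open>likely\<close> leaves the gain unchanged, and the mass under
    \<open>True\<close> is at most 1/2.\<close>
  have "mass V False (likely u \<union> tie u) \<le> b"
    using gA gT mass_le_half[of "likely u \<union> tie u" V True] aW tW unfolding un by (simp add: gain_def)
  moreover have "mass V False (space W - (likely u \<union> tie u)) = 1 / 2 - mass V False (likely u \<union> tie u)"
    using aW tW by (subst mass_Diff) (auto simp: mass_space likely_def tie_def)
  ultimately have 2: "mass V False (space W - (likely u \<union> tie u)) \<ge> 1 / 2 - b" by linarith
  have AE: "AE \<omega> in W. optimal_actions m0 m1 G act u \<omega> = A \<omega>"
    using A u unfolding common_optimal_action_set_def by (auto elim: eventually_mono)
  have "measure W {\<omega> \<in> space W. A \<omega> = {fst \<omega>}} =
    measure W ({\<omega> \<in> likely u. fst \<omega> = True} \<union> {\<omega> \<in> space W - (likely u \<union> tie u). fst \<omega> = False})"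
  proof (rule WP.finite_measure_eq_AE)
    show "AE \<omega> in W. (\<omega> \<in> {\<omega> \<in> space W. A \<omega> = {fst \<omega>}}) =
      (\<omega> \<in> {\<omega> \<in> likely u. fst \<omega> = True} \<union> {\<omega> \<in> space W - (likely u \<union> tie u). fst \<omega> = False})"
      using AE AE_space
    proof eventually_elim
      case (elim \<omega>)
      have A: "A \<omega> = (if bel u \<omega> < 1/2 then {False} else if bel u \<omega> > 1/2 then {True} else {False, True})"
        by (simp only: elim(1)[symmetric] optimal_actions_def bel_def Let_def)
      show ?case using elim(2) by (cases "fst \<omega>") (auto simp: A likely_def tie_def)
    qed
    have "A -` UNIV \<inter> space W \<in> sets W" by simp
    have Am: "A \<in> W \<rightarrow>\<^sub>M count_space UNIV" using A by (simp add: common_optimal_action_set_def)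
    have "{\<omega> \<in> space W. A \<omega> = {fst \<omega>}} = (\<Union>s\<in>UNIV. (A -` {{s}} \<inter> space W) \<inter> {\<omega> \<in> space W. fst \<omega> = s})"
      by auto
    also have "\<dots> \<in> sets W"
    proof (rule sets.finite_UN)
      fix s :: bool
      have "A -` {{s}} \<inter> space W \<in> sets W" by (rule measurable_sets[OF Am]) simp
      then show "(A -` {{s}} \<inter> space W) \<inter> {\<omega> \<in> space W. fst \<omega> = s} \<in> sets W"
        using fst_state_sets by (rule sets.Int)
    qed simp
    finally show "{\<omega> \<in> space W. A \<omega> = {fst \<omega>}} \<in> sets W" .
    show "{\<omega> \<in> likely u. fst \<omega> = True} \<union> {\<omega> \<in> space W - (likely u \<union> tie u). fst \<omega> = False} \<in> sets W"
      using aW tW by (intro sets.Un state_sets) auto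
  qed
  also have "\<dots> = mass V True (likely u) + mass V False (space W - (likely u \<union> tie u))"
    unfolding mass_def using aW tW by (intro WP.finite_measure_Union state_sets) auto
  finally show ?thesis using 1 2 by linarith
qed

end

section \<open>Consequences of equilibrium and agreement\<close>

context equilibrium begin

text \<open>The rule that looks at the own signal alone and acts 1 on \<open>D\<close> is available
  at every time, and the actual action gains at least as much.\<close>

lemma act_correct_gain:
  assumes u: "u \<in> V" "t \<ge> 1" and D: "D \<in> sets m0"
  shows "gain V {\<omega> \<in> space W. act u t \<omega>} \<ge> (measure m1 D - measure m0 D) / 2"
proof -
  have "mass V s {\<omega> \<in> space W. \<forall>v\<in>{u}. snd \<omega> v \<in> D} = (\<Prod>v\<in>{u}. measure (mu s) D) / 2" for s
    by (rule mass_signals) (use u D in auto)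
  from this[of True] this[of False]
  have "gain V {\<omega> \<in> space W. snd \<omega> u \<in> D} = (measure m1 D - measure m0 D) / 2"
    by (simp add: gain_def mu_def diff_divide_distrib)
  then show ?thesis using act_gain_max[OF u coord_info[OF D, of u t]] by simp
qed

text \<open>The probabilities of action 1 under the two states differ by at least
  \<open>\<delta>\<close>, so \<open>sqrt_binary_le\<close> applies. The factor 2 turns joint masses
  into conditional probabilities.\<close>

lemma bhattacharyya_act_le:
  assumes u: "u \<in> V" "t \<ge> 1" and D: "D \<in> sets m0" and \<delta>: "measure m1 D - measure m0 D = \<delta>" "\<delta> > 0"
  shows "2 * bhattacharyya V UNIV (act u t) \<le> 1 - \<delta>\<^sup>2 / 8"
proof -
  have A: "{\<omega> \<in> space W. act u t \<omega> = b} \<in> sets W" for b by (rule act_event[OF u])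
  define p where "p = (\<lambda>s. 2 * mass V s {\<omega> \<in> space W. act u t \<omega>})"
  have p1: "p True - p False \<ge> \<delta>"
    using act_correct_gain[OF u D] \<delta> by (simp add: p_def gain_def)
  have p2: "p s \<le> 1" "p s \<ge> 0" for s
    using mass_le_half[OF A[of True], of s] mass_nonneg[of V s] by (simp_all add: p_def)
  have n: "2 * mass V s {\<omega> \<in> space W. act u t \<omega> = False} = 1 - p s" for s
  proof -
    have "{\<omega> \<in> space W. act u t \<omega> = False} = space W - {\<omega> \<in> space W. act u t \<omega> = True}" by auto
    then show ?thesis
      using mass_Diff[of "space W" V "{\<omega> \<in> space W. act u t \<omega> = True}" s] A[of True] mass_space[of V s]
      by (simp add: p_def)
  qed
  have sq: "2 * sqrt (a * b) = sqrt ((2 * a) * (2 * b))" for a b :: real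
    using real_sqrt_mult[of 4 "a * b"] by (simp add: algebra_simps)
  have "2 * bhattacharyya V UNIV (act u t) =
      2 * sqrt (mass V False {\<omega> \<in> space W. act u t \<omega> = True} * mass V True {\<omega> \<in> space W. act u t \<omega> = True}) +
      2 * sqrt (mass V False {\<omega> \<in> space W. act u t \<omega> = False} * mass V True {\<omega> \<in> space W. act u t \<omega> = False})"
    by (simp add: bhattacharyya_def UNIV_bool)
  also have "\<dots> = sqrt (p False * p True) + sqrt ((1 - p False) * (1 - p True))"
    unfolding sq n by (simp add: p_def)
  also have "\<dots> \<le> 1 - \<delta>\<^sup>2 / 8"
    by (rule sqrt_binary_le) (use p1 p2 \<delta> in auto)
  finally show ?thesis .
qed

text \<open>The optimal action set distinguishes whether the belief is below, at or above 1/2, so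
  equal sets mean the same case for both agents.\<close>

lemma tie_AE:
  assumes A: "common_optimal_action_set m0 m1 G act A" and u: "u \<in> V" and v: "v \<in> V"
  shows "AE \<omega> in W. (\<omega> \<in> tie u \<longleftrightarrow> \<omega> \<in> tie v) \<and> (\<omega> \<in> likely u \<longleftrightarrow> \<omega> \<in> likely v)"
proof -
  have "AE \<omega> in W. \<forall>u\<in>V. optimal_actions m0 m1 G act u \<omega> = A \<omega>"
    using A by (simp add: common_optimal_action_set_def)
  then show ?thesis
  proof eventually_elim
    case (elim \<omega>)
    have "optimal_actions m0 m1 G act u \<omega> = optimal_actions m0 m1 G act v \<omega>" using elim u v by simp
    moreover have o: "optimal_actions m0 m1 G act x \<omega> =
      (if bel x \<omega> < 1/2 then {False} else if bel x \<omega> > 1/2 then {True} else {False, True})" for x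
      by (simp only: optimal_actions_def bel_def Let_def)
    ultimately show ?case unfolding tie_def likely_def
      by (cases "bel u \<omega>" "1/2 :: real" rule: linorder_cases; cases "bel v \<omega>" "1/2 :: real" rule: linorder_cases) (auto simp: o)
  qed
qed

text \<open>Inside the common tie event, whose dependence on a distant signal is negligible, betting on that signal
  would have a positive gain.\<close>

lemma measure_tie_eq_0:
  assumes A: "common_optimal_action_set m0 m1 G act A" and inf: "infinite V" and u: "u \<in> V"
    and D: "D \<in> sets m0" and \<delta>: "measure m1 D - measure m0 D = \<delta>" "\<delta> > 0"
  shows "measure W (tie u) = 0"
proof (rule ccontr)
  assume "measure W (tie u) \<noteq> 0"
  have tW: "tie u \<in> sets W" by (rule limit_W[OF u tie_limit])
  define \<tau> where "\<tau> = mass V True (tie u)"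
  have "gain V (tie u) = 0" by (rule gain_tie[OF u tie_limit]) simp
  then have \<tau>: "mass V s (tie u) = \<tau>" for s by (cases s) (auto simp: \<tau>_def gain_def)
  have "\<tau> \<noteq> 0" using \<open>measure W (tie u) \<noteq> 0\<close> \<tau> by (simp add: measure_eq_mass[OF tW])
  then have \<tau>0: "\<tau> > 0" using mass_nonneg[of V True "tie u"] by (simp add: \<tau>_def)
  \<comment> \<open>The approximations made below cost less than \<open>4 * \<epsilon>\<close> in
    total, which is half of the gain \<open>\<tau> * \<delta>\<close> that independence would give
    to the bet.\<close>
  define \<epsilon> where "\<epsilon> = \<tau> * \<delta> / 8"
  have \<epsilon>: "\<epsilon> > 0" using \<tau>0 \<delta> by (simp add: \<epsilon>_def)
  obtain t E where t: "t \<ge> 1" and E: "E \<in> sets (infm u t)" and d: "measure W (sym_diff (tie u) E) < \<epsilon>"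
    using limit_info_approx[OF u tie_limit \<epsilon>] by blast
  have EW: "E \<in> sets W" using E info_sub[OF u t] by blast
  obtain v where v: "v \<in> V" "v \<notin> nb N t u"
    using inf nb_fin[OF u, of t] by (meson finite_subset subsetI)
  define Dv where "Dv = {\<omega> \<in> space W. snd \<omega> v \<in> D}"
  have DvW: "Dv \<in> sets W" unfolding Dv_def by (rule coord_sets[OF v(1) D])
  have mD: "mass V s Dv = measure (mu s) D / 2" for s
    using mass_signals[of "{v}" V "\<lambda>_. D" s] v D by (simp add: Dv_def)
  have DvF: "Dv \<in> sets (limit_info m0 m1 G act v)"
    unfolding Dv_def by (rule info_limit[of 1]) (simp_all add: coord_info[OF D])
  \<comment> \<open>For \<open>v\<close> the bet is placed on an event of its limiting information
    inside its own ties, so its gain is 0. By agreement the ties of \<open>v\<close> are almost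
    surely those of \<open>u\<close>.\<close>
  have g0: "gain V (tie v \<inter> Dv) = 0"
    by (rule gain_tie[OF v(1)]) (use DvF tie_limit in auto)
  have tvW: "tie v \<in> sets W" by (rule limit_W[OF v(1) tie_limit])
  have "mass V s (tie u \<inter> Dv) = mass V s (tie v \<inter> Dv)" for s
    by (rule mass_cong_AE) (use tW tvW DvW tie_AE[OF A u v(1)] in \<open>auto elim: eventually_mono\<close>)
  then have g: "mass V True (tie u \<inter> Dv) = mass V False (tie u \<inter> Dv)" using g0 by (simp add: gain_def)
  have ind: "mass V s (E \<inter> Dv) = mass V s E * measure (mu s) D" for s
  proof -
    have "mass V s (E \<inter> Dv) = 2 * mass V s E * mass V s Dv"
    proof (rule mass_indep[OF EW DvW info_local[OF u t E]])
      show "local_event V {v} Dv" unfolding local_event_def Dv_def by auto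
    qed (use v nbV[OF u] ne in auto)
    then show ?thesis by (simp add: mD)
  qed
  have 1: "\<bar>\<tau> - mass V s E\<bar> < \<epsilon>" for s
    using mass_diff_le[OF tW EW, of s] d \<tau>[of s] by linarith
  have 2: "\<bar>mass V s (tie u \<inter> Dv) - mass V s (E \<inter> Dv)\<bar> < \<epsilon>" for s
  proof -
    interpret WP: prob_space W by (rule prob_world)
    have "\<bar>mass V s (tie u \<inter> Dv) - mass V s (E \<inter> Dv)\<bar> \<le> measure W (sym_diff (tie u \<inter> Dv) (E \<inter> Dv))"
      by (rule mass_diff_le) (use tW EW DvW in auto)
    also have "\<dots> \<le> measure W (sym_diff (tie u) E)"
      by (rule WP.finite_measure_mono) (use tW EW in auto)
    finally show ?thesis using d by linarith
  qed
  have p: "0 \<le> measure (mu s) D" "measure (mu s) D \<le> 1" for s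
    using prob_space.prob_le_1[OF prob_mu] by auto
  have "(\<tau> - \<epsilon>) * measure m1 D \<le> mass V True E * measure m1 D"
    using 1[of True] p[of True] by (intro mult_right_mono) (auto simp: mu_def)
  moreover have "mass V False E * measure m0 D \<le> (\<tau> + \<epsilon>) * measure m0 D"
    using 1[of False] p[of False] by (intro mult_right_mono) (auto simp: mu_def)
  moreover have "mass V True E * measure m1 D - mass V False E * measure m0 D < 2 * \<epsilon>"
    using 2[of True] 2[of False] g unfolding ind by (simp add: mu_def)
  ultimately have "(\<tau> - \<epsilon>) * measure m1 D - (\<tau> + \<epsilon>) * measure m0 D < 2 * \<epsilon>" by linarith
  moreover have "(\<tau> - \<epsilon>) * measure m1 D - (\<tau> + \<epsilon>) * measure m0 D = \<tau> * \<delta> - \<epsilon> * (measure m1 D + measure m0 D)"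
    using \<delta>(1) by (auto simp: algebra_simps)
  moreover have "\<epsilon> * (measure m1 D + measure m0 D) \<le> \<epsilon> * 2"
    using p[of True] p[of False] \<epsilon> by (intro mult_left_mono) (auto simp: mu_def)
  ultimately have "\<tau> * \<delta> < 4 * \<epsilon>" by linarith
  then show False using \<tau>0 \<delta> by (simp add: \<epsilon>_def)
qed

text \<open>A disagreement with \<open>likely\<close> at a belief away from 1/2 costs a definite
  amount of gain, and the total loss vanishes because \<open>likely\<close> is approximated by
  events known at finite times. Without ties, beliefs very close to 1/2 have small
  probability.\<close>

lemma act_tendsto_likely:
  assumes u: "u \<in> V" and T: "measure W (tie u) = 0" and \<eta>: "\<eta> > 0"
  shows "\<exists>t0\<ge>1. \<forall>t\<ge>t0. measure W (sym_diff (likely u) {\<omega> \<in> space W. act u t \<omega>}) < \<eta>"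
proof -
  interpret WP: prob_space W by (rule prob_world)
  have lW: "likely u \<in> sets W" by (rule limit_W[OF u likely_limit])
  have belW[measurable]: "bel u \<in> borel_measurable W"
    by (rule measurable_from_subalg[OF limit_subalgebra[OF u] bel_measurable])
  define small where "small = (\<lambda>n. {\<omega> \<in> space W. \<bar>2 * bel u \<omega> - 1\<bar> < 1 / (real n + 1)})"
  have smallW: "small n \<in> sets W" for n unfolding small_def by measurable
  have "(\<lambda>n. measure W (small n)) \<longlonglongrightarrow> measure W (\<Inter>n. small n)"
  proof (rule WP.finite_Lim_measure_decseq)
    show "decseq small"
      unfolding decseq_def
    proof (intro allI impI subsetI)
      fix k l :: nat and \<omega> assume "k \<le> l" "\<omega> \<in> small l"
      moreover from \<open>k \<le> l\<close> have "1 / (real l + 1) \<le> 1 / (real k + 1)" by (intro frac_le) auto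
      ultimately show "\<omega> \<in> small k" by (simp add: small_def)
    qed
  qed (use smallW in auto)
  moreover have "(\<Inter>n. small n) = tie u"
  proof -
    have "bel u \<omega> = 1 / 2" if "\<omega> \<in> (\<Inter>n. small n)" for \<omega>
    proof (rule ccontr)
      assume "bel u \<omega> \<noteq> 1 / 2"
      then have "\<bar>2 * bel u \<omega> - 1\<bar> > 0" by auto
      then obtain n where "inverse (real (Suc n)) < \<bar>2 * bel u \<omega> - 1\<bar>" using reals_Archimedean by blast
      moreover have "\<bar>2 * bel u \<omega> - 1\<bar> < 1 / (real n + 1)" using that by (auto simp: small_def)
      ultimately show False by (simp add: inverse_eq_divide add.commute)
    qed
    moreover have "\<omega> \<in> small n" if "\<omega> \<in> tie u" for \<omega> n
    proof -
      have "2 * bel u \<omega> - 1 = 0" using that by (simp add: tie_def)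
      then show ?thesis unfolding small_def mem_Collect_eq using that by (simp add: tie_def)
    qed
    ultimately show ?thesis by (auto simp: tie_def small_def)
  qed
  ultimately have "(\<lambda>n. measure W (small n)) \<longlonglongrightarrow> 0" using T by simp
  then have "eventually (\<lambda>n. measure W (small n) < \<eta> / 2) sequentially"
    using \<eta> by (intro order_tendstoD(2)) auto
  then obtain n where n: "measure W (small n) < \<eta> / 2" by (auto simp: eventually_sequentially)
  define \<kappa> where "\<kappa> = 1 / (real n + 1)"
  have \<kappa>: "\<kappa> > 0" by (simp add: \<kappa>_def)
  \<comment> \<open>The gain changes by at most twice the measure of the symmetric difference, so
    \<open>E\<close> comes within \<open>\<kappa> * \<eta> / 2\<close> of the optimal gain; it stays
    available at all later times.\<close>
  obtain t0 E where t0: "t0 \<ge> 1" and E: "E \<in> sets (infm u t0)" and d: "measure W (sym_diff (likely u) E) < \<kappa> * \<eta> / 4"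
    using limit_info_approx[OF u likely_limit, of "\<kappa> * \<eta> / 4"] \<kappa> \<eta> by auto
  have EW: "E \<in> sets W" using E info_sub[OF u t0] by blast
  have "measure W (sym_diff (likely u) {\<omega> \<in> space W. act u t \<omega>}) < \<eta>" if t: "t \<ge> t0" for t
  proof -
    let ?A = "{\<omega> \<in> space W. act u t \<omega>}"
    let ?D = "sym_diff (likely u) ?A"
    have t1: "t \<ge> 1" using t t0 by simp
    have AI: "?A \<in> sets (infm u t)" using act_event_info[OF u t1, of True] by simp
    have AF: "?A \<in> sets (limit_info m0 m1 G act u)" by (rule info_limit[OF t1 AI])
    have AW: "?A \<in> sets W" by (rule limit_W[OF u AF])
    have DW: "?D \<in> sets W" using lW AW by auto
    have "gain V (likely u) - gain V ?A \<le> gain V (likely u) - gain V E"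
      using act_gain_max[OF u t1, of E] E info_mono[OF t, of u] by auto
    also have "\<dots> \<le> 2 * measure W (sym_diff (likely u) E)"
      using mass_diff_le[OF lW EW, of True] mass_diff_le[OF lW EW, of False] by (simp add: gain_def)
    also have "\<dots> < \<kappa> * \<eta> / 2" using d by simp
    finally have up: "gain V (likely u) - gain V ?A < \<kappa> * \<eta> / 2" .
    have "\<kappa> * (measure W ?D - measure W (small n)) \<le> \<kappa> * measure W (?D - small n)"
    proof -
      have "measure W ?D \<le> measure W ((?D - small n) \<union> small n)"
        by (rule WP.finite_measure_mono) (use DW smallW in auto)
      also have "\<dots> \<le> measure W (?D - small n) + measure W (small n)"
        by (rule measure_Un_le) (use DW smallW in auto)
      finally show ?thesis using \<kappa> by (intro mult_left_mono) auto
    qed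
    also have "\<dots> = (\<integral>\<omega>. \<kappa> * indicator (?D - small n) \<omega> \<partial>W)"
      using DW smallW by simp
    also have "\<dots> \<le> (\<integral>\<omega>. indicator ?D \<omega> * \<bar>2 * bel u \<omega> - 1\<bar> \<partial>W)"
    proof (rule integral_mono)
      show "integrable W (\<lambda>\<omega>. \<kappa> * indicator (?D - small n) \<omega>)"
        using sets.Diff[OF DW smallW]
        by (intro integrable_mult_right integrable_real_indicator) (simp_all only: WP.emeasure_eq_measure ennreal_less_top infinity_ennreal_def)
      show "integrable W (\<lambda>\<omega>. indicator ?D \<omega> * \<bar>2 * bel u \<omega> - 1\<bar>)" by (rule gain_likely(2)[OF u AF])
      fix \<omega> assume "\<omega> \<in> space W"
      then show "\<kappa> * indicator (?D - small n) \<omega> \<le> indicator ?D \<omega> * \<bar>2 * bel u \<omega> - 1\<bar>"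
        by (auto simp: indicator_def small_def \<kappa>_def not_less)
    qed
    also have "\<dots> = gain V (likely u) - gain V ?A" using gain_likely(1)[OF u AF] by simp
    also note up
    finally have "\<kappa> * (measure W ?D - measure W (small n)) < \<kappa> * (\<eta> / 2)" by simp
    then have "measure W ?D - measure W (small n) < \<eta> / 2" by (simp only: mult_less_cancel_left_pos[OF \<kappa>])
    then show ?thesis using n by linarith
  qed
  then show ?thesis using t0 by blast
qed

end

subsection \<open>Improvement on an infinite network in agreement\<close>

text \<open>Each arc can be returned along at most \<open>L\<close> arcs, so a path of length
  \<open>k\<close> is reversed by one of length at most \<open>L * k\<close>.\<close>

lemma nb_rev:
  assumes V: "u \<in> V" "\<And>v. v \<in> V \<Longrightarrow> N v \<subseteq> V" and rev: "\<And>u w. u \<in> V \<Longrightarrow> w \<in> N u \<Longrightarrow> u \<in> nb N L w"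
    and x: "x \<in> nb N k u"
  shows "u \<in> nb N (L * k) x"
  using x
proof (induction k arbitrary: x)
  case (Suc k)
  then obtain v where v: "v \<in> nb N k u" "x \<in> insert v (N v)" by auto
  have "v \<in> V" using nb_subset[of u V N k] V v(1) by blast
  then have "v \<in> nb N L x" using v(2) rev nb_self by blast
  then have "u \<in> nb N (L + L * k) x" using nb_trans[OF Suc.IH[OF v(1)]] by blast
  then show ?case by simp
qed simp

context equilibrium begin

text \<open>\<open>T\<close> and \<open>R\<close> are given before the agent \<open>v\<close> is
  chosen, so \<open>v\<close> can be placed far from any fixed ball. The later history of
  \<open>v\<close> contains its history up to \<open>T\<close> and an own late action, which nearly
  always equals the action of \<open>r0\<close> at time \<open>T0\<close>. Replacing one by the
  other costs at most \<open>\<epsilon>\<close>, and afterwards the two parts are independent given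
  the state.\<close>

lemma bhat_improve:
  assumes A: "common_optimal_action_set m0 m1 G act A" and inf: "infinite V"
    and D: "D \<in> sets m0" and \<delta>: "measure m1 D - measure m0 D = \<delta>" "\<delta> > 0"
    and deg: "\<And>u. u \<in> V \<Longrightarrow> card (N u) \<le> d" and rev: "\<And>u w. u \<in> V \<Longrightarrow> w \<in> N u \<Longrightarrow> u \<in> nb N L w"
    and hyp: "\<And>r. r \<in> V \<Longrightarrow> \<exists>v\<in>nb N R r. bhat v T \<le> \<beta>" and \<epsilon>: "\<epsilon> > 0"
  shows "\<exists>v\<in>V. \<exists>T'. bhat v T' \<le> (1 - \<delta>\<^sup>2 / 8) * \<beta> + \<epsilon>"
proof -
  interpret WP: prob_space W by (rule prob_world)
  obtain r0 where r0: "r0 \<in> V" using ne by blast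
  \<comment> \<open>A bound on the number of values of a history up to \<open>T\<close> together
    with one bit. The choice of \<open>e\<close> makes the total error, \<open>2 * sqrt e\<close>
    per value, at most \<open>\<epsilon>\<close>.\<close>
  define K where "K = (2 * 2 ^ ((d + 1) * T) :: real)"
  have K: "K > 0" by (simp add: K_def)
  define e where "e = (\<epsilon> / (2 * K))\<^sup>2"
  have e: "e > 0" using \<epsilon> K by (simp add: e_def)
  have tie0: "measure W (tie u) = 0" if "u \<in> V" for u
    by (rule measure_tie_eq_0[OF A inf that D \<delta>])
  obtain T0 where T0: "T0 \<ge> 1" "measure W (sym_diff (likely r0) {\<omega> \<in> space W. act r0 T0 \<omega>}) < e / 2"
    using act_tendsto_likely[OF r0 tie0[OF r0], of "e / 2"] e by auto
  \<comment> \<open>If \<open>v\<close> is within \<open>R\<close> of an agent outside this finite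
    set, the ball of radius \<open>T\<close> around \<open>v\<close> misses the ball of radius
    \<open>T0\<close> around \<open>r0\<close>. Balls are traversed backwards, whence the factors
    \<open>L\<close>.\<close>
  define far where "far = (\<Union>x\<in>nb N T0 r0. \<Union>v\<in>nb N (L * T) x. nb N (L * R) v)"
  have "finite far"
    unfolding far_def
  proof (intro finite_UN_I)
    show "finite (nb N T0 r0)" by (rule nb_fin[OF r0])
    fix x assume "x \<in> nb N T0 r0"
    then have x: "x \<in> V" using nbV[OF r0] by blast
    then show "finite (nb N (L * T) x)" by (rule nb_fin)
    fix v assume "v \<in> nb N (L * T) x"
    then have "v \<in> V" using nbV[OF x] by blast
    then show "finite (nb N (L * R) v)" by (rule nb_fin)
  qed
  then obtain r1 where r1: "r1 \<in> V" "r1 \<notin> far" using inf by (meson finite_subset subsetI)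
  obtain v where v: "v \<in> nb N R r1" "bhat v T \<le> \<beta>" using hyp[OF r1(1)] by blast
  have vV: "v \<in> V" using v(1) nbV[OF r1(1)] by blast
  have disj: "nb N T v \<inter> nb N T0 r0 = {}"
  proof (rule equals0I)
    fix x assume x: "x \<in> nb N T v \<inter> nb N T0 r0"
    have "v \<in> nb N (L * T) x" using x by (intro nb_rev[OF vV N_sub rev]) auto
    moreover have "r1 \<in> nb N (L * R) v" by (intro nb_rev[OF r1(1) N_sub rev] v(1))
    ultimately show False using r1(2) x by (auto simp: far_def)
  qed
  obtain t0 where t0: "\<And>t. t \<ge> t0 \<Longrightarrow> measure W (sym_diff (likely v) {\<omega> \<in> space W. act v t \<omega>}) < e / 2"
    using act_tendsto_likely[OF vV tie0[OF vV], of "e / 2"] e by auto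
  define t1 where "t1 = max t0 (max T 1)"
  have t1: "t1 \<ge> 1" "t1 \<ge> T" "t1 \<ge> t0" by (auto simp: t1_def)
  let ?a = "act r0 T0" and ?b = "act v t1"
  have aE: "{\<omega> \<in> space W. ?a \<omega> = c} \<in> sets W" for c by (rule act_event[OF r0 T0(1)])
  have bE: "{\<omega> \<in> space W. ?b \<omega> = c} \<in> sets W" for c by (rule act_event[OF vV t1(1)])
  have lW: "likely u \<in> sets W" if "u \<in> V" for u by (rule limit_W[OF that likely_limit])
  have diff: "measure W {\<omega> \<in> space W. ?a \<omega> \<noteq> ?b \<omega>} < e"
  proof -
    let ?X = "sym_diff (likely r0) {\<omega> \<in> space W. ?a \<omega>}" and ?Y = "sym_diff (likely v) {\<omega> \<in> space W. ?b \<omega>}"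
    have m: "?X \<in> sets W" "?Y \<in> sets W" using lW[OF r0] lW[OF vV] aE[of True] bE[of True] by auto
    have "{\<omega> \<in> space W. ?a \<omega> \<noteq> ?b \<omega>} = sym_diff {\<omega> \<in> space W. ?a \<omega> = True} {\<omega> \<in> space W. ?b \<omega> = True}" by auto
    then have s: "{\<omega> \<in> space W. ?a \<omega> \<noteq> ?b \<omega>} \<in> sets W" using aE[of True] bE[of True] by auto
    have "measure W {\<omega> \<in> space W. ?a \<omega> \<noteq> ?b \<omega>} \<le> measure W (?X \<union> ?Y)"
    proof (rule WP.finite_measure_mono_AE)
      show "AE \<omega> in W. \<omega> \<in> {\<omega> \<in> space W. ?a \<omega> \<noteq> ?b \<omega>} \<longrightarrow> \<omega> \<in> ?X \<union> ?Y"
        using tie_AE[OF A r0 vV] by eventually_elim auto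
    qed (use m in auto)
    also have "\<dots> \<le> measure W ?X + measure W ?Y" by (rule measure_Un_le[OF m])
    also have "\<dots> < e" using T0(2) t0[OF t1(3)] by linarith
    finally show ?thesis .
  qed
  let ?h = "hst v T"
  let ?R = "Pow (past N v T) \<times> (UNIV :: bool set)"
  have fR: "finite ?R" using past_fin[OF vV] by simp
  have hE: "{\<omega> \<in> space W. ?h \<omega> = g} \<in> sets W" for g by (rule hist_event[OF vV])
  have pair: "{\<omega> \<in> space W. (?h \<omega>, X \<omega>) = p} = {\<omega> \<in> space W. ?h \<omega> = fst p} \<inter> {\<omega> \<in> space W. X \<omega> = snd p}" for X :: "_ \<Rightarrow> bool" and p
    by (cases p) auto
  \<comment> \<open>The own action at time \<open>t1\<close> enters the history at time
    \<open>Suc t1\<close>; everything else recorded from time \<open>T\<close> on is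
    dropped.\<close>
  have 1: "bhat v (Suc t1) \<le> bhattacharyya V ?R (\<lambda>\<omega>. (?h \<omega>, ?b \<omega>))"
  proof -
    have "bhat v (Suc t1) \<le> bhattacharyya V ?R (\<lambda>\<omega>. (hst v (Suc t1) \<omega> \<inter> past N v T, (v, t1) \<in> hst v (Suc t1) \<omega>))"
      unfolding bhat_def
      by (rule bhattacharyya_coarsen[where f = "\<lambda>g. (g \<inter> past N v T, (v, t1) \<in> g)"])
        (use past_fin[OF vV] hist_event[OF vV] in \<open>auto intro: subsetD[OF hist_subset]\<close>)
    moreover have "hst v (Suc t1) \<omega> \<inter> past N v T = ?h \<omega>" for \<omega> by (rule hist_restrict) (use t1 in simp)
    moreover have "(v, t1) \<in> hst v (Suc t1) \<omega> \<longleftrightarrow> ?b \<omega>" for \<omega> using t1 by (simp add: hist_def past_def)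
    ultimately show ?thesis by simp
  qed
  have card: "real (card ?R) \<le> K"
  proof -
    have "card (past N v T) \<le> (d + 1) * T"
    proof -
      have "card (insert v (N v)) \<le> d + 1" using deg[OF vV] finN[OF vV] card_insert_le_m1[of "d + 1" "N v" v] by auto
      moreover have "card {1..<T} \<le> T" by simp
      ultimately show ?thesis unfolding past_def card_cartesian_product by (rule mult_le_mono)
    qed
    then have "(2::nat) ^ card (past N v T) \<le> 2 ^ ((d + 1) * T)" by (intro power_increasing) auto
    then have "card ?R \<le> 2 ^ ((d + 1) * T) * 2"
      using past_fin[OF vV] by (simp add: card_cartesian_product card_Pow card_UNIV_bool)
    then have "real (card ?R) \<le> real (2 ^ ((d + 1) * T) * 2)" by (simp only: of_nat_le_iff)
    then show ?thesis by (simp add: K_def)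
  qed
  have 2: "bhattacharyya V ?R (\<lambda>\<omega>. (?h \<omega>, ?b \<omega>)) \<le> bhattacharyya V ?R (\<lambda>\<omega>. (?h \<omega>, ?a \<omega>)) + real (card ?R) * (2 * sqrt e)"
  proof -
    have "sqrt (mass V False {\<omega> \<in> space W. (?h \<omega>, ?b \<omega>) = p} * mass V True {\<omega> \<in> space W. (?h \<omega>, ?b \<omega>) = p}) \<le>
      sqrt (mass V False {\<omega> \<in> space W. (?h \<omega>, ?a \<omega>) = p} * mass V True {\<omega> \<in> space W. (?h \<omega>, ?a \<omega>) = p}) + 2 * sqrt e" for p
    proof -
      have m: "{\<omega> \<in> space W. (?h \<omega>, ?a \<omega>) = p} \<in> sets W" "{\<omega> \<in> space W. (?h \<omega>, ?b \<omega>) = p} \<in> sets W"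
        unfolding pair using aE bE hE by auto
      have "\<bar>mass V s {\<omega> \<in> space W. (?h \<omega>, ?b \<omega>) = p} - mass V s {\<omega> \<in> space W. (?h \<omega>, ?a \<omega>) = p}\<bar> \<le> e" for s
      proof -
        have "\<bar>mass V s {\<omega> \<in> space W. (?h \<omega>, ?b \<omega>) = p} - mass V s {\<omega> \<in> space W. (?h \<omega>, ?a \<omega>) = p}\<bar> \<le>
          measure W (sym_diff {\<omega> \<in> space W. (?h \<omega>, ?b \<omega>) = p} {\<omega> \<in> space W. (?h \<omega>, ?a \<omega>) = p})"
          by (rule mass_diff_le[OF m(2,1)])
        also have "\<dots> \<le> measure W {\<omega> \<in> space W. ?a \<omega> \<noteq> ?b \<omega>}"
        proof (rule WP.finite_measure_mono)
          have "{\<omega> \<in> space W. ?a \<omega> \<noteq> ?b \<omega>} = sym_diff {\<omega> \<in> space W. ?a \<omega> = True} {\<omega> \<in> space W. ?b \<omega> = True}" by auto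
          then show "{\<omega> \<in> space W. ?a \<omega> \<noteq> ?b \<omega>} \<in> sets W" using aE[of True] bE[of True] by auto
        qed auto
        finally show ?thesis using diff by linarith
      qed
      then show ?thesis
        using mass_le_half[OF m(1)] mass_le_half[OF m(2)] mass_nonneg[of V]
        by (intro sqrt_mult_diff_le) (auto intro: order_trans[of _ "1/2"])
    qed
    then have "bhattacharyya V ?R (\<lambda>\<omega>. (?h \<omega>, ?b \<omega>)) \<le> (\<Sum>p\<in>?R. sqrt (mass V False {\<omega> \<in> space W. (?h \<omega>, ?a \<omega>) = p} * mass V True {\<omega> \<in> space W. (?h \<omega>, ?a \<omega>) = p}) + 2 * sqrt e)"
      unfolding bhattacharyya_def by (rule sum_mono)
    then show ?thesis by (simp only: bhattacharyya_def sum.distrib sum_constant)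
  qed
  \<comment> \<open>Independence given the state turns the sum over pairs into a product of sums.
    The factors 2 from the two states leave the root as a single factor 2.\<close>
  have 3: "bhattacharyya V ?R (\<lambda>\<omega>. (?h \<omega>, ?a \<omega>)) = bhat v T * (2 * bhattacharyya V UNIV ?a)"
  proof -
    have ind: "mass V s {\<omega> \<in> space W. (?h \<omega>, ?a \<omega>) = p} = 2 * mass V s {\<omega> \<in> space W. ?h \<omega> = fst p} * mass V s {\<omega> \<in> space W. ?a \<omega> = snd p}" for s p
      unfolding pair
    proof (rule mass_indep[OF hE aE])
      have "{\<omega> \<in> space W. ?h \<omega> = fst p} \<in> sets (infm v (max 1 T))"
        using hist_event_info[OF vV, of T] info_mono[of T "max 1 T" v] by auto
      then have "local_event V (nb N (max 1 T) v) {\<omega> \<in> space W. ?h \<omega> = fst p}"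
        by (rule info_local[OF vV, rotated]) simp
      show "local_event V (nb N T v) {\<omega> \<in> space W. ?h \<omega> = fst p}"
      proof (cases "T \<ge> 1")
        case True
        then show ?thesis using info_local[OF vV True hist_event_info[OF vV]] by simp
      next
        case False
        then have "?h \<omega> = {}" for \<omega> by (simp add: hist_def past_def)
        then show ?thesis by (simp add: local_event_def)
      qed
      show "local_event V (nb N T0 r0) {\<omega> \<in> space W. ?a \<omega> = snd p}"
        by (rule info_local[OF r0 T0(1) act_event_info[OF r0 T0(1)]])
    qed (use nbV[OF vV] nbV[OF r0] disj ne in auto)
    have "sqrt (mass V False {\<omega> \<in> space W. (?h \<omega>, ?a \<omega>) = (g, c)} * mass V True {\<omega> \<in> space W. (?h \<omega>, ?a \<omega>) = (g, c)}) =
      sqrt (mass V False {\<omega> \<in> space W. ?h \<omega> = g} * mass V True {\<omega> \<in> space W. ?h \<omega> = g}) *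
      (2 * sqrt (mass V False {\<omega> \<in> space W. ?a \<omega> = c} * mass V True {\<omega> \<in> space W. ?a \<omega> = c}))" for g c
    proof -
      have "sqrt ((2 * x1 * y1) * (2 * x2 * y2)) = sqrt (x1 * x2) * (2 * sqrt (y1 * y2))" for x1 y1 x2 y2 :: real
      proof -
        have "(2 * x1 * y1) * (2 * x2 * y2) = (x1 * x2) * (4 * (y1 * y2))" by simp
        then show ?thesis using real_sqrt_mult[of 4 "y1 * y2"] by (simp add: real_sqrt_mult)
      qed
      then show ?thesis unfolding ind fst_conv snd_conv .
    qed
    then have "bhattacharyya V ?R (\<lambda>\<omega>. (?h \<omega>, ?a \<omega>)) = (\<Sum>(g, c)\<in>?R. sqrt (mass V False {\<omega> \<in> space W. ?h \<omega> = g} * mass V True {\<omega> \<in> space W. ?h \<omega> = g}) *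
      (2 * sqrt (mass V False {\<omega> \<in> space W. ?a \<omega> = c} * mass V True {\<omega> \<in> space W. ?a \<omega> = c})))"
      unfolding bhattacharyya_def by (intro sum.cong[OF refl]) (simp only: split_paired_all prod.case)
    also have "\<dots> = (\<Sum>g\<in>Pow (past N v T). \<Sum>c\<in>UNIV. sqrt (mass V False {\<omega> \<in> space W. ?h \<omega> = g} * mass V True {\<omega> \<in> space W. ?h \<omega> = g}) *
      (2 * sqrt (mass V False {\<omega> \<in> space W. ?a \<omega> = c} * mass V True {\<omega> \<in> space W. ?a \<omega> = c})))"
      by (rule sum.cartesian_product[symmetric])
    also have "\<dots> = bhat v T * (2 * bhattacharyya V UNIV ?a)"
      unfolding bhat_def bhattacharyya_def sum_product[symmetric] sum_distrib_left ..
    finally show ?thesis .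
  qed
  have "bhat v T * (2 * bhattacharyya V UNIV ?a) \<le> (1 - \<delta>\<^sup>2 / 8) * \<beta>"
  proof -
    have nn: "0 \<le> bhat v T" "0 \<le> bhattacharyya V UNIV ?a"
      unfolding bhat_def bhattacharyya_def by (auto intro!: sum_nonneg mult_nonneg_nonneg mass_nonneg)
    have "bhat v T * (2 * bhattacharyya V UNIV ?a) \<le> \<beta> * (1 - \<delta>\<^sup>2 / 8)"
      using v(2) nn bhattacharyya_act_le[OF r0 T0(1) D \<delta>] by (intro mult_mono) auto
    then show ?thesis by (simp add: mult.commute)
  qed
  moreover have "real (card ?R) * (2 * sqrt e) \<le> \<epsilon>"
  proof -
    have "sqrt e = \<epsilon> / (2 * K)" using \<epsilon> K by (simp add: e_def real_sqrt_abs)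
    then have "real (card ?R) * (2 * sqrt e) \<le> K * (2 * (\<epsilon> / (2 * K)))"
      using card \<epsilon> K by (intro mult_mono) auto
    then show ?thesis using K by simp
  qed
  ultimately have "bhat v (Suc t1) \<le> (1 - \<delta>\<^sup>2 / 8) * \<beta> + \<epsilon>" using 1 2 3 by linarith
  then show ?thesis using vV by blast
qed

end

subsection \<open>Equilibria from optimal profiles\<close>

context network begin

text \<open>Converse of \<open>profile_optimal\<close>. By \<open>info_strategy\<close> an event of
  the information is a union over histories of conditions on the signal, so the inequalities add up
  over finitely many histories and \<open>AE_optimal\<close> applies.\<close>

lemma optimal_profile_action_process:
  assumes B: "profile B"
    and pos: "\<And>u t g S. u \<in> V \<Longrightarrow> t \<ge> 1 \<Longrightarrow> g \<subseteq> past N u t \<Longrightarrow> S \<in> sets m0 \<Longrightarrow>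
      others B N True u t g * measure (mu True) (cell m0 B N u (past N u t) g \<inter> (B u t g \<inter> S)) \<ge>
      others B N False u t g * measure (mu False) (cell m0 B N u (past N u t) g \<inter> (B u t g \<inter> S))"
    and neg: "\<And>u t g S. u \<in> V \<Longrightarrow> t \<ge> 1 \<Longrightarrow> g \<subseteq> past N u t \<Longrightarrow> S \<in> sets m0 \<Longrightarrow>
      others B N True u t g * measure (mu True) (cell m0 B N u (past N u t) g \<inter> (S - B u t g)) \<le>
      others B N False u t g * measure (mu False) (cell m0 B N u (past N u t) g \<inter> (S - B u t g))"
  shows "action_process m0 m1 G act"
  unfolding action_process_def
proof (intro ballI allI impI conjI)
  fix u t assume u: "u \<in> V" "1 \<le> (t :: nat)"
  show "act u t \<in> infm u t \<rightarrow>\<^sub>M count_space UNIV" by (rule act_info[OF u])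
  let ?A = "{\<omega> \<in> space W. act u t \<omega>}"
  have A: "?A \<in> sets (infm u t)" using act_event_info[OF u, of True] by simp
  have Bs: "\<And>u t g. B u t g \<in> sets m0" and rep: "AE \<omega> in W. \<forall>u\<in>V. \<forall>t\<ge>1. act u t \<omega> \<longleftrightarrow> snd \<omega> u \<in> B u t (hst u t \<omega>)"
    using B by (auto simp: profile_def)
  have decomp: "mass V s {\<omega> \<in> space W. snd \<omega> u \<in> S (hst u t \<omega>)} =
      (\<Sum>g\<in>Pow (past N u t). others B N s u t g * measure (mu s) (cell m0 B N u (past N u t) g \<inter> S g) / 2)"
    if S: "\<And>g. S g \<in> sets m0" for S s
  proof -
    define Ev where "Ev = (\<lambda>g. {\<omega> \<in> space W. hst u t \<omega> = g \<and> snd \<omega> u \<in> S g})"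
    have "{\<omega> \<in> space W. snd \<omega> u \<in> S (hst u t \<omega>)} = (\<Union>g\<in>Pow (past N u t). Ev g)"
      unfolding Ev_def by (auto intro: subsetD[OF hist_subset])
    moreover have "mass V s (\<Union>g\<in>Pow (past N u t). Ev g) = (\<Sum>g\<in>Pow (past N u t). mass V s (Ev g))"
    proof (rule mass_UN)
      show "finite (Pow (past N u t))" using past_fin[OF u(1)] by simp
      show "disjoint_family_on Ev (Pow (past N u t))" by (auto simp: disjoint_family_on_def Ev_def)
      fix g
      have "Ev g = {\<omega> \<in> space W. hst u t \<omega> = g} \<inter> {\<omega> \<in> space W. snd \<omega> u \<in> S g}" by (auto simp: Ev_def)
      then have "Ev g \<in> sets (infm u t)" using hist_event_info[OF u(1), of t g] coord_info[OF S] by auto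
      then show "Ev g \<in> sets W" using info_sub[OF u] by blast
    qed
    moreover have "mass V s (Ev g) = others B N s u t g * measure (mu s) (cell m0 B N u (past N u t) g \<inter> S g) / 2"
      if "g \<in> Pow (past N u t)" for g
      unfolding Ev_def by (rule hist_law[OF B u(1) _ S]) (use that in auto)
    ultimately show ?thesis by simp
  qed
  have ev: "{\<omega> \<in> space W. snd \<omega> u \<in> S (hst u t \<omega>)} \<in> sets W" if "\<And>g. S g \<in> sets m0" for S
  proof -
    have "{\<omega> \<in> space W. snd \<omega> u \<in> S (hst u t \<omega>)} \<in> sets (infm u t)"
      by (rule strategy_event_own[OF u(1) that own_event_info[OF u(1)]])
    then show ?thesis using info_sub[OF u] by blast
  qed
  have "AE \<omega> in W. (real_cond_exp W (infm u t) (indicator {\<omega>. fst \<omega> = True}) \<omega> < 1/2 \<longrightarrow> \<omega> \<notin> ?A) \<and>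
           (real_cond_exp W (infm u t) (indicator {\<omega>. fst \<omega> = True}) \<omega> > 1/2 \<longrightarrow> \<omega> \<in> ?A)"
  proof (rule AE_optimal[OF info_subalgebra[OF u] A])
    fix E assume "E \<in> sets (infm u t)"
    then obtain S where S: "\<And>g. S g \<in> sets m0" "E = {\<omega> \<in> space W. snd \<omega> u \<in> S (hst u t \<omega>)}"
      using info_strategy[OF u(1)] by blast
    have AW: "?A \<in> sets W" using A info_sub[OF u] by blast
    have 1: "mass V s (E \<inter> ?A) = mass V s {\<omega> \<in> space W. snd \<omega> u \<in> B u t (hst u t \<omega>) \<inter> S (hst u t \<omega>)}" for s
    proof (rule mass_cong_AE)
      show "AE \<omega> in W. (\<omega> \<in> E \<inter> ?A) = (\<omega> \<in> {\<omega> \<in> space W. snd \<omega> u \<in> B u t (hst u t \<omega>) \<inter> S (hst u t \<omega>)})"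
        using rep by eventually_elim (use u in \<open>auto simp: S(2)\<close>)
    qed (use ev[OF S(1)] AW ev[of "\<lambda>g. B u t g \<inter> S g"] S(1) Bs in \<open>auto simp: S(2)\<close>)
    have 2: "mass V s (E - ?A) = mass V s {\<omega> \<in> space W. snd \<omega> u \<in> S (hst u t \<omega>) - B u t (hst u t \<omega>)}" for s
    proof (rule mass_cong_AE)
      show "AE \<omega> in W. (\<omega> \<in> E - ?A) = (\<omega> \<in> {\<omega> \<in> space W. snd \<omega> u \<in> S (hst u t \<omega>) - B u t (hst u t \<omega>)})"
        using rep by eventually_elim (use u in \<open>auto simp: S(2)\<close>)
    qed (use ev[OF S(1)] AW ev[of "\<lambda>g. S g - B u t g"] S(1) Bs in \<open>auto simp: S(2)\<close>)
    have s: "B u t g \<inter> S g \<in> sets m0" "S g - B u t g \<in> sets m0" for g using S(1) Bs by auto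
    show "gain V (E \<inter> ?A) \<ge> 0"
      unfolding gain_def 1 decomp[of "\<lambda>g. B u t g \<inter> S g", OF s(1)] sum_subtractf[symmetric]
      by (rule sum_nonneg) (use pos[OF u _ S(1)] in auto)
    show "gain V (E - ?A) \<le> 0"
      unfolding gain_def 2 decomp[of "\<lambda>g. S g - B u t g", OF s(2)] sum_subtractf[symmetric]
      by (rule sum_nonpos) (use neg[OF u _ S(1)] in auto)
  qed
  then show "AE \<omega> in W. (belief m0 m1 G (infm u t) \<omega> < 1/2 \<longrightarrow> act u t \<omega> = False) \<and>
           (belief m0 m1 G (infm u t) \<omega> > 1/2 \<longrightarrow> act u t \<omega> = True)"
    using AE_space unfolding belief_def by eventually_elim auto
qed

end

text \<open>The play generated by strategies, as the set of agent-time pairs with action 1 before a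
  given time. One recursion on time serves all agents together because a history refers to earlier
  times only; the guard \<open>1 \<le> t\<close> makes times start at 1.\<close>

primrec run :: "(nat \<Rightarrow> nat \<Rightarrow> (nat \<times> nat) set \<Rightarrow> 'w set) \<Rightarrow> (nat \<Rightarrow> nat set) \<Rightarrow> 'w outcome \<Rightarrow> nat \<Rightarrow> (nat \<times> nat) set" where
  "run B N \<omega> 0 = {}"
| "run B N \<omega> (Suc t) = run B N \<omega> t \<union> {(u, t) | u. 1 \<le> t \<and> snd \<omega> u \<in> B u t (run B N \<omega> t \<inter> past N u t)}"

definition run_act :: "(nat \<Rightarrow> nat \<Rightarrow> (nat \<times> nat) set \<Rightarrow> 'w set) \<Rightarrow> (nat \<Rightarrow> nat set) \<Rightarrow> 'w actions" where
  "run_act B N u t \<omega> \<longleftrightarrow> (u, t) \<in> run B N \<omega> (Suc t)"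

lemma run_times: "(u, t') \<in> run B N \<omega> t \<Longrightarrow> 1 \<le> t' \<and> t' < t"
  by (induction t) auto

lemma run_mono: "t \<le> t' \<Longrightarrow> (v, s) \<in> run B N \<omega> t' \<and> s < t \<longleftrightarrow> (v, s) \<in> run B N \<omega> t"
  by (induction t' rule: nat_induct_at_least) (auto dest: run_times)

lemma hist_run_act: "hist N (run_act B N) u t \<omega> = run B N \<omega> t \<inter> past N u t"
proof -
  have "run_act B N v t' \<omega> \<longleftrightarrow> (v, t') \<in> run B N \<omega> t" if "t' < t" for v t'
    using run_mono[of "Suc t'" t v t' B N \<omega>] that by (simp add: run_act_def)
  then show ?thesis by (auto simp: hist_def past_def)
qed

lemma run_act_iff: "t \<ge> 1 \<Longrightarrow> run_act B N u t \<omega> \<longleftrightarrow> snd \<omega> u \<in> B u t (hist N (run_act B N) u t \<omega>)"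
  unfolding hist_run_act by (auto simp: run_act_def dest: run_times)

subsection \<open>Relabelling networks\<close>

lemma card_nb_le:
  assumes V: "u \<in> V" "\<And>v. v \<in> V \<Longrightarrow> N v \<subseteq> V" "\<And>v. v \<in> V \<Longrightarrow> finite (N v)"
    and d: "\<And>v. v \<in> V \<Longrightarrow> card (N v) \<le> d"
  shows "card (nb N k u) \<le> (d + 1) ^ k"
proof (induction k)
  case (Suc k)
  have sub: "nb N k u \<subseteq> V" by (rule nb_subset) (use V in auto)
  have fin: "finite (nb N k u)" by (rule nb_finite[of _ V]) (use V in auto)
  have "card (nb N (Suc k) u) \<le> (\<Sum>v\<in>nb N k u. card (insert v (N v)))"
    unfolding nb.simps by (rule card_UN_le[OF fin])
  also have "\<dots> \<le> (\<Sum>v\<in>nb N k u. d + 1)"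
  proof (rule sum_mono)
    fix v assume "v \<in> nb N k u"
    then have "card (N v) \<le> d" using sub d by blast
    then show "card (insert v (N v)) \<le> d + 1" using card_insert_le_m1[of "d + 1" "N v" v] by simp
  qed
  also have "\<dots> = card (nb N k u) * (d + 1)" by simp
  also have "\<dots> \<le> (d + 1) ^ k * (d + 1)" using Suc by (rule mult_le_mono1)
  finally show ?case by (simp add: mult.commute)
qed simp

text \<open>A ball that fails to grow once never grows again, and is then the whole network by
  connectivity.\<close>

lemma card_nb_ge:
  assumes V: "u \<in> V" "\<And>v. v \<in> V \<Longrightarrow> N v \<subseteq> V" "\<And>v. v \<in> V \<Longrightarrow> finite (N v)"
    and conn: "\<And>v. v \<in> V \<Longrightarrow> \<exists>k. v \<in> nb N k u"
    and k: "infinite V \<or> k < card V"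
  shows "k < card (nb N k u)"
  using k
proof (induction k)
  case (Suc k)
  have fin: "finite (nb N k u)" for k by (rule nb_finite[of _ V]) (use V in auto)
  have sub: "nb N k u \<subseteq> V" for k by (rule nb_subset) (use V in auto)
  have IH: "k < card (nb N k u)" using Suc by auto
  show ?case
  proof (cases "nb N (Suc k) u = nb N k u")
    case True
    have stab: "nb N (k + j) u = nb N k u" for j
    proof (induction j)
      case (Suc j)
      then show ?case using True by simp
    qed simp
    have "V \<subseteq> nb N k u"
    proof
      fix v assume "v \<in> V"
      then obtain l where "v \<in> nb N l u" using conn by blast
      then have "v \<in> nb N (k + l) u" using nb_mono[of l "k + l" N u] by auto
      then show "v \<in> nb N k u" unfolding stab .
    qed
    then have "V = nb N k u" using sub by blast
    then show ?thesis using Suc.prems True fin by auto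
  next
    case False
    then have "nb N k u \<subset> nb N (Suc k) u" using nb_mono[of k "Suc k" N u] by auto
    then have "card (nb N k u) < card (nb N (Suc k) u)" by (rule psubset_card_mono[OF fin])
    then show ?thesis using IH by linarith
  qed
qed (use V in simp)

text \<open>Breadth-first numbering: agents are ordered by distance from the root, then by name, and
  numbered by their count of predecessors. Every ball around the root then occupies an initial
  segment of labels, which ties labels to distances in all networks alike.\<close>

lemma bfs_labels:
  assumes V: "r \<in> V" "\<And>v. v \<in> V \<Longrightarrow> N v \<subseteq> V" "\<And>v. v \<in> V \<Longrightarrow> finite (N v)"
    and conn: "\<And>v. v \<in> V \<Longrightarrow> \<exists>k. v \<in> nb N k r"
  shows "\<exists>g. \<forall>k. bij_betw g {..<card (nb N k r)} (nb N k r)"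
proof -
  define dist where "dist = (\<lambda>v. LEAST k. v \<in> nb N k r)"
  have dist: "v \<in> nb N k r \<longleftrightarrow> dist v \<le> k" if "v \<in> V" for v k
  proof
    assume "v \<in> nb N k r"
    then show "dist v \<le> k" unfolding dist_def by (rule Least_le)
  next
    assume "dist v \<le> k"
    moreover have "v \<in> nb N (dist v) r" unfolding dist_def using conn[OF that] by (rule LeastI_ex)
    ultimately show "v \<in> nb N k r" using nb_mono[of "dist v" k N r] by auto
  qed
  define less where "less = (\<lambda>u v. dist u < dist v \<or> dist u = dist v \<and> u < (v :: nat))"
  define f where "f = (\<lambda>v. card {w \<in> V. less w v})"
  have fin: "finite (nb N k r)" for k by (rule nb_finite[of _ V]) (use V in auto)
  have sub: "nb N k r \<subseteq> V" for k by (rule nb_subset) (use V in auto)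
  have below: "{w \<in> V. less w v} \<subseteq> nb N k r - {v}" if "v \<in> nb N k r" for v k
  proof -
    have v: "v \<in> V" using that sub by blast
    then have "dist v \<le> k" using dist that by blast
    then show ?thesis using dist by (auto simp: less_def)
  qed
  have f_less: "f v < card (nb N k r)" if "v \<in> nb N k r" for v k
    unfolding f_def using below[OF that] that fin by (intro psubset_card_mono) auto
  have f_mono: "f u < f v" if "u \<in> V" "v \<in> V" "less u v" for u v
  proof -
    have "v \<in> nb N (dist v) r" using dist[OF that(2)] by simp
    then have "finite {w \<in> V. less w v}" using below[of v "dist v"] fin finite_subset by blast
    moreover have "{w \<in> V. less w u} \<subset> {w \<in> V. less w v}" using that by (auto simp: less_def)
    ultimately show ?thesis unfolding f_def by (rule psubset_card_mono)
  qed
  have inj: "inj_on f V"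
  proof (rule inj_onI)
    fix u v assume uv: "u \<in> V" "v \<in> V" "f u = f v"
    show "u = v"
    proof (rule ccontr)
      assume "u \<noteq> v"
      then have "less u v \<or> less v u" by (auto simp: less_def)
      then show False using f_mono[OF uv(1,2)] f_mono[OF uv(2,1)] uv(3) by auto
    qed
  qed
  have img: "f ` nb N k r = {..<card (nb N k r)}" for k
  proof (rule card_subset_eq)
    show "f ` nb N k r \<subseteq> {..<card (nb N k r)}" using f_less by blast
    show "card (f ` nb N k r) = card {..<card (nb N k r)}"
      using inj_on_subset[OF inj sub] by (simp add: card_image)
  qed simp
  have "bij_betw (inv_into V f) {..<card (nb N k r)} (nb N k r)" for k
    by (rule bij_betw_inv_into_subset[OF _ sub img]) (use inj in \<open>simp add: bij_betw_def\<close>)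
  then show ?thesis by blast
qed

text \<open>The correspondence of neighbourhoods is asked only within the ball, since labels of a
  converging sequence preserve adjacency only locally.\<close>

lemma nb_transport:
  assumes "\<And>i. i \<in> nb N' k u \<Longrightarrow> N (g i) = g ` N' i"
  shows "nb N k (g u) = g ` nb N' k u"
  using assms
proof (induction k)
  case (Suc k)
  have "nb N k (g u) = g ` nb N' k u"
    by (rule Suc.IH) (use Suc.prems nb_mono[of k "Suc k" N' u] in auto)
  moreover have "N (g i) = g ` N' i" if "i \<in> nb N' k u" for i
    using Suc.prems that nb_mono[of k "Suc k" N' u] by auto
  ultimately show ?case by (auto simp del: image_insert)
qed simp

lemma past_transport:
  assumes "N (g u) = g ` N' u"
  shows "past N (g u) t = map_prod g id ` past N' u t"
proof -
  have "insert (g u) (N (g u)) = g ` insert u (N' u)" using assms by simp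
  then show ?thesis unfolding past_def by (simp add: map_prod_surj_on[OF refl refl, symmetric] id_def map_prod_image)
qed

lemma horizon_transport:
  assumes "\<And>i. i \<in> nb N' t u \<Longrightarrow> N (g i) = g ` N' i"
  shows "horizon N (g u) t = map_prod g id ` horizon N' u t"
proof -
  have nb: "nb N (t - t') (g u) = g ` nb N' (t - t') u" for t'
    by (rule nb_transport) (use assms nb_mono[of "t - t'" t N' u] in auto)
  show ?thesis unfolding horizon_def nb by force
qed

lemma image_Int_inj:
  assumes "inj_on g U" "A \<subseteq> U \<times> UNIV" "B \<subseteq> U \<times> (UNIV :: nat set)"
  shows "map_prod g id ` A \<inter> map_prod g id ` B = map_prod g id ` (A \<inter> B)"
proof -
  have "inj_on (map_prod g id) (U \<times> UNIV)" using assms(1) by (auto simp: inj_on_def)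
  from inj_on_image_Int[OF this assms(2,3)] show ?thesis by (rule sym)
qed

lemma mem_image_inj:
  assumes "inj_on g U" "A \<subseteq> U \<times> (UNIV :: nat set)" "v \<in> U"
  shows "(g v, t) \<in> map_prod g id ` A \<longleftrightarrow> (v, t) \<in> A"
proof
  assume "(g v, t) \<in> map_prod g id ` A"
  then obtain w where "(w, t) \<in> A" "g v = g w" by auto
  then show "(v, t) \<in> A" using assms by (auto dest: inj_onD)
qed force

text \<open>A relabelling injective on \<open>U\<close> commutes with intersecting a configuration
  with a past and preserves membership, so each test that defines the cell is the same on both
  sides.\<close>

lemma cell_transport:
  assumes inj: "inj_on g U" and v: "v \<in> U" and D: "D \<subseteq> U \<times> {1..}" and \<alpha>: "\<alpha> \<subseteq> U \<times> UNIV"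
    and past: "\<And>t. (v, t) \<in> D \<Longrightarrow> past N' v t \<subseteq> U \<times> UNIV" and N: "N (g v) = g ` N' v"
    and B: "\<And>t \<alpha>. t \<ge> 1 \<Longrightarrow> B' v t \<alpha> = B (g v) t (map_prod g id ` \<alpha>)"
  shows "cell M B N (g v) (map_prod g id ` D) (map_prod g id ` \<alpha>) = cell M B' N' v D \<alpha>"
proof -
  have D': "D \<subseteq> U \<times> UNIV" using D by auto
  have 1: "(g v, t) \<in> map_prod g id ` D \<longleftrightarrow> (v, t) \<in> D" for t by (rule mem_image_inj[OF inj D' v])
  have 2: "(g v, t) \<in> map_prod g id ` \<alpha> \<longleftrightarrow> (v, t) \<in> \<alpha>" for t by (rule mem_image_inj[OF inj \<alpha> v])
  have 3: "B (g v) t (map_prod g id ` \<alpha> \<inter> past N (g v) t) = B' v t (\<alpha> \<inter> past N' v t)" if "(v, t) \<in> D" for t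
    unfolding past_transport[where N = N and g = g and u = v and N' = N', OF N] image_Int_inj[OF inj \<alpha> past[OF that]]
    using B[of t] that D by auto
  show ?thesis unfolding cell_def by (simp add: 1 2 3 cong: imp_cong conj_cong)
qed

context signals begin

text \<open>The relabelling is a bijection on the configurations extending \<open>\<gamma>\<close>
  and on the agents of the ball; the sum and the products are reindexed along it.\<close>

lemma others_transport:
  assumes inj: "inj_on g (nb N' (Suc t) u)" and N: "\<And>i. i \<in> nb N' t u \<Longrightarrow> N (g i) = g ` N' i"
    and B: "\<And>v t \<alpha>. t \<ge> 1 \<Longrightarrow> B' v t \<alpha> = B (g v) t (map_prod g id ` \<alpha>)"
    and \<gamma>: "\<gamma> \<subseteq> past N' u t"
  shows "others B N s (g u) t (map_prod g id ` \<gamma>) = others B' N' s u t \<gamma>"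
proof -
  let ?U = "nb N' (Suc t) u" and ?\<iota> = "map_prod g (id :: nat \<Rightarrow> nat)"
  have nbU: "nb N' t u \<subseteq> ?U" by (rule nb_mono) simp
  have H: "horizon N' u t \<subseteq> ?U \<times> {1..}" using horizon_subset[of N' u t] nbU by fastforce
  have HU: "horizon N' u t \<subseteq> ?U \<times> UNIV" using H by auto
  have Hnb: "horizon N (g u) t = ?\<iota> ` horizon N' u t" by (rule horizon_transport) (rule N)
  have P: "past N (g u) t = ?\<iota> ` past N' u t" by (rule past_transport) (rule N[OF nb_self])
  have nb: "nb N t (g u) - {g u} = g ` (nb N' t u - {u})"
  proof -
    have "nb N t (g u) = g ` nb N' t u" by (rule nb_transport) (rule N)
    moreover have "g ` (nb N' t u - {u}) = g ` nb N' t u - g ` {u}"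
      by (rule inj_on_image_set_diff[OF inj]) (use nbU nb_self[of u N' "Suc t"] in blast)+
    ultimately show ?thesis by simp
  qed
  have inji: "inj_on ?\<iota> (?U \<times> UNIV)" using inj by (auto simp: inj_on_def)
  have cell: "cell m0 B N (g v) (?\<iota> ` horizon N' u t) (?\<iota> ` \<alpha>) = cell m0 B' N' v (horizon N' u t) \<alpha>"
    if "v \<in> nb N' t u" "\<alpha> \<subseteq> horizon N' u t" for v \<alpha>
  proof (rule cell_transport[OF inj _ H])
    show "v \<in> ?U" using that nbU by blast
    show "\<alpha> \<subseteq> ?U \<times> UNIV" using that H by auto
    show "past N' v t' \<subseteq> ?U \<times> UNIV" if "(v, t') \<in> horizon N' u t" for t'
      using past_horizon_closed[OF that] HU by (rule subset_trans)
  qed (use N B that in auto)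
  have set_eq: "{\<alpha> \<in> Pow (?\<iota> ` horizon N' u t). \<alpha> \<inter> ?\<iota> ` past N' u t = ?\<iota> ` \<gamma>} =
      (image ?\<iota>) ` {\<alpha> \<in> Pow (horizon N' u t). \<alpha> \<inter> past N' u t = \<gamma>}"
  proof -
    have PU: "past N' u t \<subseteq> ?U \<times> UNIV" using past_subset_horizon[of N' u t] HU by (rule subset_trans)
    have "?\<iota> ` \<alpha> \<inter> ?\<iota> ` past N' u t = ?\<iota> ` \<gamma> \<longleftrightarrow> \<alpha> \<inter> past N' u t = \<gamma>" if "\<alpha> \<subseteq> horizon N' u t" for \<alpha>
    proof -
      have aU: "\<alpha> \<subseteq> ?U \<times> UNIV" using that HU by (rule subset_trans)
      have "?\<iota> ` (\<alpha> \<inter> past N' u t) = ?\<iota> ` \<gamma> \<longleftrightarrow> \<alpha> \<inter> past N' u t = \<gamma>"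
        by (rule inj_on_image_eq_iff[OF inji]) (use aU PU \<gamma> in auto)
      then show ?thesis using image_Int_inj[OF inj aU PU] by simp
    qed
    note iff = this
    show ?thesis
    proof (intro equalityI subsetI)
      fix \<beta> assume b: "\<beta> \<in> {\<alpha> \<in> Pow (?\<iota> ` horizon N' u t). \<alpha> \<inter> ?\<iota> ` past N' u t = ?\<iota> ` \<gamma>}"
      then obtain \<alpha> where a: "\<alpha> \<subseteq> horizon N' u t" "\<beta> = ?\<iota> ` \<alpha>" by (auto simp: subset_image_iff)
      then have "\<alpha> \<inter> past N' u t = \<gamma>" using b iff[OF a(1)] by simp
      with a show "\<beta> \<in> image ?\<iota> ` {\<alpha> \<in> Pow (horizon N' u t). \<alpha> \<inter> past N' u t = \<gamma>}" by blast
    next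
      fix \<beta> assume "\<beta> \<in> image ?\<iota> ` {\<alpha> \<in> Pow (horizon N' u t). \<alpha> \<inter> past N' u t = \<gamma>}"
      then obtain \<alpha> where a: "\<alpha> \<subseteq> horizon N' u t" "\<alpha> \<inter> past N' u t = \<gamma>" "\<beta> = ?\<iota> ` \<alpha>" by blast
      then show "\<beta> \<in> {\<alpha> \<in> Pow (?\<iota> ` horizon N' u t). \<alpha> \<inter> ?\<iota> ` past N' u t = ?\<iota> ` \<gamma>}"
        using iff[OF a(1)] by (simp add: image_mono)
    qed
  qed
  have inj_im: "inj_on (image ?\<iota>) {\<alpha> \<in> Pow (horizon N' u t). \<alpha> \<inter> past N' u t = \<gamma>}"
  proof (rule inj_onI)
    fix \<alpha> \<beta> assume "\<alpha> \<in> {\<alpha> \<in> Pow (horizon N' u t). \<alpha> \<inter> past N' u t = \<gamma>}" "\<beta> \<in> {\<alpha> \<in> Pow (horizon N' u t). \<alpha> \<inter> past N' u t = \<gamma>}"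
      and eq: "?\<iota> ` \<alpha> = ?\<iota> ` \<beta>"
    then have "\<alpha> \<subseteq> ?U \<times> UNIV" "\<beta> \<subseteq> ?U \<times> UNIV" using HU by auto
    from inj_on_image_eq_iff[OF inji this] eq show "\<alpha> = \<beta>" by simp
  qed
  have inj_nb: "inj_on g (nb N' t u - {u})" by (rule inj_on_subset[OF inj]) (use nbU in auto)
  show ?thesis
    unfolding others_def Hnb P nb set_eq sum.reindex[OF inj_im] o_def
  proof (rule sum.cong[OF refl])
    fix \<alpha> assume a: "\<alpha> \<in> {\<alpha> \<in> Pow (horizon N' u t). \<alpha> \<inter> past N' u t = \<gamma>}"
    show "(\<Prod>v\<in>g ` (nb N' t u - {u}). measure (mu s) (cell m0 B N v (?\<iota> ` horizon N' u t) (?\<iota> ` \<alpha>))) =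
      (\<Prod>v\<in>nb N' t u - {u}. measure (mu s) (cell m0 B' N' v (horizon N' u t) \<alpha>))"
      unfolding prod.reindex[OF inj_nb] o_def using a cell by (intro prod.cong) auto
  qed
qed

section \<open>The likelihood ratio and threshold rules\<close>

lemma ex_likelihood:
  "\<exists>l :: 'w \<Rightarrow> real. l \<in> borel_measurable m0 \<and> integrable m0 l \<and> (\<forall>x. l x \<ge> 0) \<and>
     (\<forall>S\<in>sets m0. measure m1 S = (\<integral>x. indicator S x * l x \<partial>m0))"
proof -
  interpret M0: prob_space m0 by (rule prob0)
  interpret M1: prob_space m1 by (rule prob1)
  obtain l where l[measurable]: "l \<in> borel_measurable m0" and ae: "AE x in m0. RN_deriv m0 m1 x = ennreal (l x)" and nn: "\<And>x. 0 \<le> l x"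
    using M0.real_RN_deriv[OF M1.finite_measure_axioms ac01 sets_m1] by metis
  have eq: "emeasure m1 S = (\<integral>\<^sup>+x. ennreal (indicator S x * l x) \<partial>m0)" if [measurable]: "S \<in> sets m0" for S
  proof -
    have "emeasure m1 S = emeasure (density m0 (RN_deriv m0 m1)) S"
      using M0.density_RN_deriv[OF ac01 sets_m1] by simp
    also have "\<dots> = (\<integral>\<^sup>+x. RN_deriv m0 m1 x * indicator S x \<partial>m0)" by (rule emeasure_density) auto
    also have "\<dots> = (\<integral>\<^sup>+x. ennreal (indicator S x * l x) \<partial>m0)"
      by (rule nn_integral_cong_AE) (use ae in \<open>eventually_elim; auto simp: indicator_def\<close>)
    finally show ?thesis .
  qed
  have "(\<integral>\<^sup>+x. ennreal (l x) \<partial>m0) = emeasure m1 (space m0)"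
    unfolding eq[OF sets.top] by (rule nn_integral_cong) (simp add: indicator_def)
  then have int: "integrable m0 l"
    by (intro integrableI_nonneg) (auto simp: nn M1.emeasure_eq_measure)
  have "measure m1 S = (\<integral>x. indicator S x * l x \<partial>m0)" if S[measurable]: "S \<in> sets m0" for S
  proof -
    have "integrable m0 (\<lambda>x. indicator S x * l x)" using integrable_mult_indicator[OF S int] by simp
    then have "(\<integral>\<^sup>+x. ennreal (indicator S x * l x) \<partial>m0) = ennreal (\<integral>x. indicator S x * l x \<partial>m0)"
      by (rule nn_integral_eq_integral) (auto simp: nn)
    then show ?thesis using eq[OF S] by (simp add: measure_def nn integral_nonneg_AE)
  qed
  with l int nn show ?thesis by blast
qed

text \<open>The density of \<open>m1\<close> with respect to \<open>m0\<close>, in a version that is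
  finite and nonnegative everywhere.\<close>

definition lik :: "'w \<Rightarrow> real" where
  "lik = (SOME l. l \<in> borel_measurable m0 \<and> integrable m0 l \<and> (\<forall>x. l x \<ge> 0) \<and>
     (\<forall>S\<in>sets m0. measure m1 S = (\<integral>x. indicator S x * l x \<partial>m0)))"

lemma lik_measurable [measurable]: "lik \<in> borel_measurable m0"
  and lik_integrable: "integrable m0 lik" and lik_nonneg: "lik x \<ge> 0"
  and measure_m1: "S \<in> sets m0 \<Longrightarrow> measure m1 S = (\<integral>x. indicator S x * lik x \<partial>m0)"
  using someI_ex[OF ex_likelihood] unfolding lik_def[symmetric] by blast+

lemma weighted_diff:
  assumes S: "S \<in> sets m0"
  shows "b * measure m1 S - a * measure m0 S = (\<integral>x. indicator S x * (lik x * b - a) \<partial>m0)"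
    and "integrable m0 (\<lambda>x. indicator S x * (lik x * b - a))"
proof -
  interpret M0: prob_space m0 by (rule prob0)
  have i1: "integrable m0 (\<lambda>x. indicator S x * lik x)" using integrable_mult_indicator[OF S lik_integrable] by simp
  have i2: "integrable m0 (\<lambda>x. indicator S x :: real)" using S by (simp add: M0.emeasure_eq_measure)
  have eq: "indicator S x * (lik x * b - a) = b * (indicator S x * lik x) - a * indicator S x" for x
    by (simp add: algebra_simps)
  show "integrable m0 (\<lambda>x. indicator S x * (lik x * b - a))"
    unfolding eq using i1 i2 by (intro Bochner_Integration.integrable_diff integrable_mult_right) auto
  show "b * measure m1 S - a * measure m0 S = (\<integral>x. indicator S x * (lik x * b - a) \<partial>m0)"
    unfolding eq using i1 i2 S by (simp add: measure_m1)
qed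

text \<open>On the set where the threshold fails, the hypothesis makes the integral of a negative
  function nonnegative, so this set is null. The signs of \<open>a\<close> and \<open>b\<close> are
  free; negating both gives the opposite threshold.\<close>

lemma threshold_AE:
  assumes E: "E \<in> sets m0"
    and le: "a * measure m0 {x \<in> E. lik x * b < a} \<le> b * measure m1 {x \<in> E. lik x * b < a}"
  shows "AE x in m0. x \<in> E \<longrightarrow> a \<le> lik x * b"
proof -
  let ?S = "{x \<in> E. lik x * b < a}"
  have "?S = E \<inter> {x \<in> space m0. lik x * b < a}" using sets.sets_into_space[OF E] by auto
  then have S: "?S \<in> sets m0" using E by simp
  have "(\<integral>x. - (indicator ?S x * (lik x * b - a)) \<partial>m0) = 0"
  proof (rule order_antisym)
    show "(\<integral>x. - (indicator ?S x * (lik x * b - a)) \<partial>m0) \<le> 0"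
      using le weighted_diff(1)[OF S, of b a] by simp
  qed (intro Bochner_Integration.integral_nonneg, auto simp: indicator_def)
  then have "AE x in m0. - (indicator ?S x * (lik x * b - a)) = 0"
    using weighted_diff(2)[OF S, of b a]
    by (subst (asm) integral_nonneg_eq_0_iff_AE) (auto simp: indicator_def)
  then show ?thesis by eventually_elim (auto simp: indicator_def split: if_splits)
qed

text \<open>Leads from the pointwise threshold back to the inequality, now on every measurable
  \<open>S\<close> and not only on sets described by \<open>lik\<close>.\<close>

lemma threshold_le:
  assumes E: "E \<in> sets m0" and S: "S \<in> sets m0" and AE: "AE x in m0. x \<in> E \<longrightarrow> a \<le> lik x * b"
  shows "a * measure m0 (E \<inter> S) \<le> b * measure m1 (E \<inter> S)"
proof -
  have "0 \<le> (\<integral>x. indicator (E \<inter> S) x * (lik x * b - a) \<partial>m0)"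
    by (rule integral_nonneg_AE) (use AE in \<open>eventually_elim; auto simp: indicator_def\<close>)
  then show ?thesis using weighted_diff(1)[of "E \<inter> S" b a] E S by simp
qed

end

subsection \<open>Limits of equilibria\<close>

definition settles :: "(nat \<Rightarrow> bool) \<Rightarrow> bool" where
  "settles P \<longleftrightarrow> (\<exists>n. (\<forall>m\<ge>n. P m) \<or> (\<forall>m\<ge>n. \<not> P m))"

lemma settles_iff: "settles P \<longleftrightarrow> eventually P sequentially \<or> eventually (\<lambda>n. \<not> P n) sequentially"
  by (auto simp: settles_def eventually_sequentially)

lemma settles_cong: "eventually (\<lambda>n. P n = Q n) sequentially \<Longrightarrow> settles P = settles Q"
proof -
  assume e: "eventually (\<lambda>n. P n = Q n) sequentially"
  have "eventually P sequentially = eventually Q sequentially"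
    by (rule eventually_subst) (use e in auto)
  moreover have "eventually (\<lambda>n. \<not> P n) sequentially = eventually (\<lambda>n. \<not> Q n) sequentially"
    by (rule eventually_subst) (use e in \<open>auto elim: eventually_mono\<close>)
  ultimately show ?thesis by (simp add: settles_iff)
qed

lemma settles_subst: "settles P \<Longrightarrow> eventually (\<lambda>n. P n = Q n) sequentially \<Longrightarrow> settles Q"
  by (drule settles_cong) simp

lemma settles_eq: "settles P \<Longrightarrow> settles (\<lambda>n. P n = b)"
  by (cases b) (auto simp: settles_iff)

lemma settles_ball:
  assumes "finite I" "\<And>i. i \<in> I \<Longrightarrow> settles (P i)"
  shows "settles (\<lambda>n. \<forall>i\<in>I. P i n)"
proof (cases "\<forall>i\<in>I. eventually (P i) sequentially")
  case True
  then have "eventually (\<lambda>n. \<forall>i\<in>I. P i n) sequentially" using assms(1) by (intro eventually_ball_finite) auto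
  then show ?thesis by (simp add: settles_iff)
next
  case False
  then obtain i where i: "i \<in> I" "eventually (\<lambda>n. \<not> P i n) sequentially"
    using assms(2) by (auto simp: settles_iff)
  from i(2) have "eventually (\<lambda>n. \<not> (\<forall>i\<in>I. P i n)) sequentially"
    by eventually_elim (use i(1) in blast)
  then show ?thesis by (simp add: settles_iff)
qed

text \<open>Numbers the triples of agent, time and finite history, so that all decisions form a
  sequence of sets as in \<open>realize_limit\<close>. \<open>dec\<close> always returns a finite
  set and inverts \<open>enc\<close> on finite histories.\<close>

definition enc :: "nat \<times> nat \<times> (nat \<times> nat) set \<Rightarrow> nat" where
  "enc p = prod_encode (fst p, prod_encode (fst (snd p), set_encode (prod_encode ` snd (snd p))))"

definition dec :: "nat \<Rightarrow> nat \<times> nat \<times> (nat \<times> nat) set" where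
  "dec n = (fst (prod_decode n), fst (prod_decode (snd (prod_decode n))),
     prod_decode ` set_decode (snd (prod_decode (snd (prod_decode n)))))"

lemma dec_enc: "finite \<alpha> \<Longrightarrow> dec (enc (u, t, \<alpha>)) = (u, t, \<alpha>)"
  by (simp add: enc_def dec_def image_image)

lemma finite_dec: "finite (snd (snd (dec n)))"
  by (simp add: dec_def)

context network begin

text \<open>Expresses the coefficient continuously through measures of cells, which is how it will
  converge.\<close>

lemma bhat_profile:
  assumes B: "profile B" and u: "u \<in> V"
  shows "bhat u t = (\<Sum>g\<in>Pow (past N u t). sqrt
    ((others B N False u t g * measure (mu False) (cell m0 B N u (past N u t) g) / 2) *
     (others B N True u t g * measure (mu True) (cell m0 B N u (past N u t) g) / 2)))"
proof -
  have "mass V s {\<omega> \<in> space W. hst u t \<omega> = g} = others B N s u t g * measure (mu s) (cell m0 B N u (past N u t) g) / 2"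
    if g: "g \<subseteq> past N u t" for s g
  proof -
    have "{\<omega> \<in> space W. hst u t \<omega> = g} = {\<omega> \<in> space W. hst u t \<omega> = g \<and> snd \<omega> u \<in> space m0}"
      using u by (auto simp: space_world)
    moreover have "cell m0 B N u (past N u t) g \<inter> space m0 = cell m0 B N u (past N u t) g" by (auto simp: cell_def)
    ultimately show ?thesis using hist_law[OF B u g sets.top, of s] by simp
  qed
  note m = this
  show ?thesis unfolding bhat_def bhattacharyya_def
  proof (rule sum.cong[OF refl])
    fix g assume "g \<in> Pow (past N u t)"
    then have g: "g \<subseteq> past N u t" by simp
    show "sqrt (mass V False {\<omega> \<in> space W. hst u t \<omega> = g} * mass V True {\<omega> \<in> space W. hst u t \<omega> = g}) =
      sqrt ((others B N False u t g * measure (mu False) (cell m0 B N u (past N u t) g) / 2) *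
     (others B N True u t g * measure (mu True) (cell m0 B N u (past N u t) g) / 2))"
      unfolding m[OF g] ..
  qed
qed

definition relevant :: "nat \<Rightarrow> nat \<Rightarrow> (nat \<times> nat) set \<Rightarrow> bool" where
  "relevant u t g \<longleftrightarrow> measure W {\<omega> \<in> space W. hst u t \<omega> = g} \<noteq> 0"

lemma relevant_past: "relevant u t g \<Longrightarrow> g \<subseteq> past N u t"
proof (rule ccontr)
  assume r: "relevant u t g" and "\<not> g \<subseteq> past N u t"
  then have "{\<omega> \<in> space W. hst u t \<omega> = g} = {}" using hist_subset[of N act u t] by blast
  then show False using r by (simp only: relevant_def measure_empty)
qed

text \<open>Ensures a positive denominator for the weights in \<open>converging\<close> wherever the
  history has positive probability.\<close>

lemma relevant_others:
  assumes B: "profile B" and u: "u \<in> V" and r: "relevant u t g"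
  shows "others B N False u t g + others B N True u t g > 0"
proof (rule ccontr)
  assume "\<not> ?thesis"
  then have z: "others B N s u t g = 0" for s
    using others_nonneg[of B N False u t g] others_nonneg[of B N True u t g] by (cases s) auto
  have "{\<omega> \<in> space W. hst u t \<omega> = g} = {\<omega> \<in> space W. hst u t \<omega> = g \<and> snd \<omega> u \<in> space m0}"
    using u by (auto simp: space_world)
  then have "mass V s {\<omega> \<in> space W. hst u t \<omega> = g} = 0" for s
    using hist_law[OF B u relevant_past[OF r] sets.top, of s] z by simp
  then have "measure W {\<omega> \<in> space W. hst u t \<omega> = g} = 0"
    using measure_eq_mass[OF hist_event[OF u]] by simp
  then show False using r by (simp add: relevant_def)
qed

end

context equilibrium begin

text \<open>Acting optimally means comparing the likelihood ratio of the own signal with the odds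
  derived from the others. One null set serves for all agents, times and histories, as these are
  countably many.\<close>

lemma profile_threshold:
  assumes B: "profile B" and nrm: "\<And>u t g. u \<in> V \<Longrightarrow> t \<ge> 1 \<Longrightarrow> B u t g \<subseteq> cell m0 B N u (past N u t) g"
  shows "AE x in m0. \<forall>u\<in>V. \<forall>t\<ge>1. \<forall>g\<in>Pow (past N u t).
    (x \<in> B u t g \<longrightarrow> others B N False u t g \<le> lik x * others B N True u t g) \<and>
    (x \<in> cell m0 B N u (past N u t) g \<and> x \<notin> B u t g \<longrightarrow> lik x * others B N True u t g \<le> others B N False u t g)"
proof -
  have Bs: "\<And>u t g. B u t g \<in> sets m0" using B by (simp add: profile_def)
  have one: "AE x in m0.
    (x \<in> B u t g \<longrightarrow> others B N False u t g \<le> lik x * others B N True u t g) \<and>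
    (x \<in> cell m0 B N u (past N u t) g \<and> x \<notin> B u t g \<longrightarrow> lik x * others B N True u t g \<le> others B N False u t g)"
    if u: "u \<in> V" "t \<ge> 1" and g: "g \<subseteq> past N u t" for u t g
  proof -
    let ?C = "cell m0 B N u (past N u t) g" and ?a = "others B N False u t g" and ?b = "others B N True u t g"
    have C: "?C \<in> sets m0" by (rule cell_sets[OF Bs past_fin[OF u(1)]])
    have lvl: "{x \<in> E. P (lik x)} \<in> sets m0" if "E \<in> sets m0" "{x \<in> space m0. P (lik x)} \<in> sets m0" for E P
    proof -
      have "{x \<in> E. P (lik x)} = E \<inter> {x \<in> space m0. P (lik x)}" using sets.sets_into_space[OF that(1)] by auto
      then show ?thesis using that by auto
    qed
    have "AE x in m0. x \<in> B u t g \<longrightarrow> ?a \<le> lik x * ?b"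
    proof (rule threshold_AE[OF Bs])
      let ?S = "{x \<in> B u t g. lik x * ?b < ?a}"
      have S: "?S \<in> sets m0" by (rule lvl[OF Bs]) measurable
      have "?C \<inter> (B u t g \<inter> ?S) = ?S" using nrm[OF u] by auto
      then show "?a * measure m0 ?S \<le> ?b * measure m1 ?S"
        using profile_optimal(1)[OF B u g S] by (simp add: mu_def)
    qed
    moreover have "AE x in m0. x \<in> ?C - B u t g \<longrightarrow> - ?a \<le> lik x * - ?b"
    proof (rule threshold_AE)
      show CB: "?C - B u t g \<in> sets m0" using C Bs by auto
      let ?S = "{x \<in> ?C - B u t g. lik x * - ?b < - ?a}"
      have S: "?S \<in> sets m0" by (rule lvl[OF CB]) measurable
      have "?C \<inter> (?S - B u t g) = ?S" by auto
      then show "- ?a * measure m0 ?S \<le> - ?b * measure m1 ?S"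
        using profile_optimal(2)[OF B u g S] by (simp add: mu_def)
    qed
    ultimately show ?thesis by eventually_elim auto
  qed
  have "AE x in m0. \<forall>t. t \<ge> 1 \<longrightarrow> (\<forall>g\<in>Pow (past N u t).
    (x \<in> B u t g \<longrightarrow> others B N False u t g \<le> lik x * others B N True u t g) \<and>
    (x \<in> cell m0 B N u (past N u t) g \<and> x \<notin> B u t g \<longrightarrow> lik x * others B N True u t g \<le> others B N False u t g))"
    if u: "u \<in> V" for u
    unfolding AE_all_countable
  proof
    fix t :: nat
    show "AE x in m0. t \<ge> 1 \<longrightarrow> (\<forall>g\<in>Pow (past N u t).
      (x \<in> B u t g \<longrightarrow> others B N False u t g \<le> lik x * others B N True u t g) \<and>
      (x \<in> cell m0 B N u (past N u t) g \<and> x \<notin> B u t g \<longrightarrow> lik x * others B N True u t g \<le> others B N False u t g))"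
    proof (cases "t \<ge> 1")
      case True
      have "AE x in m0. \<forall>g\<in>Pow (past N u t).
        (x \<in> B u t g \<longrightarrow> others B N False u t g \<le> lik x * others B N True u t g) \<and>
        (x \<in> cell m0 B N u (past N u t) g \<and> x \<notin> B u t g \<longrightarrow> lik x * others B N True u t g \<le> others B N False u t g)"
        by (rule AE_finite_allI) (use past_fin[OF u] one[OF u True] in auto)
      then show ?thesis by eventually_elim blast
    qed simp
  qed
  then have "AE x in m0. \<forall>u\<in>V. \<forall>t. t \<ge> 1 \<longrightarrow> (\<forall>g\<in>Pow (past N u t).
    (x \<in> B u t g \<longrightarrow> others B N False u t g \<le> lik x * others B N True u t g) \<and>
    (x \<in> cell m0 B N u (past N u t) g \<and> x \<notin> B u t g \<longrightarrow> lik x * others B N True u t g \<le> others B N False u t g))"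
    by (subst AE_ball_countable) auto
  then show ?thesis by simp
qed

end

text \<open>Local convergence of labelled networks together with their strategies. The weight of the
  state \<open>True\<close> is normalised by the sum over both states so that it stays bounded; the
  odds themselves could diverge.\<close>

locale converging = signals m0 m1 for m0 m1 :: "'w measure" +
  fixes G :: "nat \<Rightarrow> nat pair_pre_digraph" and act :: "nat \<Rightarrow> 'w actions"
    and B :: "nat \<Rightarrow> nat \<Rightarrow> nat \<Rightarrow> (nat \<times> nat) set \<Rightarrow> 'w set"
    and lab :: "nat \<Rightarrow> nat \<Rightarrow> nat" and N' :: "nat \<Rightarrow> nat set" and q :: "nat \<Rightarrow> nat \<Rightarrow> (nat \<times> nat) set \<Rightarrow> real"
  assumes eq: "\<And>n. equilibrium m0 m1 (G n) (act n)"
    and prof: "\<And>n. network.profile m0 m1 (G n) (act n) (B n)"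
    and nrm: "\<And>n u t g. u \<in> pverts (G n) \<Longrightarrow> t \<ge> 1 \<Longrightarrow>
      B n u t g \<subseteq> cell m0 (B n) (neighbors (G n)) u (past (neighbors (G n)) u t) g"
    and irrel: "\<And>n u t g. u \<in> pverts (G n) \<Longrightarrow> t \<ge> 1 \<Longrightarrow> \<not> network.relevant m0 m1 (G n) (act n) u t g \<Longrightarrow> B n u t g = {}"
    and inj: "\<And>J. finite J \<Longrightarrow> eventually (\<lambda>n. inj_on (lab n) J \<and> lab n ` J \<subseteq> pverts (G n)) sequentially"
    and nbr: "\<And>i. eventually (\<lambda>n. neighbors (G n) (lab n i) = lab n ` N' i) sequentially"
    and finN': "\<And>i. finite (N' i)"
    and rel: "\<And>u t g. finite g \<Longrightarrow> settles (\<lambda>n. network.relevant m0 m1 (G n) (act n) (lab n u) t (map_prod (lab n) id ` g))"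
    and q: "\<And>u t g. finite g \<Longrightarrow> (\<lambda>n. others (B n) (neighbors (G n)) True (lab n u) t (map_prod (lab n) id ` g) /
        (others (B n) (neighbors (G n)) False (lab n u) t (map_prod (lab n) id ` g) +
         others (B n) (neighbors (G n)) True (lab n u) t (map_prod (lab n) id ` g))) \<longlonglongrightarrow> q u t g"
begin

abbreviation "Nn n \<equiv> neighbors (G n)"
abbreviation "\<iota> n \<equiv> map_prod (lab n) (id :: nat \<Rightarrow> nat)"

text \<open>Strategies read in the common labels. The normalisation of \<open>B\<close> concerns
  times from 1 on; at time 0 the empty set makes the sequence constant.\<close>

definition Bp :: "nat \<Rightarrow> nat \<Rightarrow> nat \<Rightarrow> (nat \<times> nat) set \<Rightarrow> 'w set" where
  "Bp n u t g = (if t = 0 then {} else B n (lab n u) t (\<iota> n ` g))"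

lemma Bp_pos: "t \<ge> 1 \<Longrightarrow> Bp n u t g = B n (lab n u) t (\<iota> n ` g)"
  by (simp add: Bp_def)

lemma B_sets: "B n u t g \<in> sets m0"
proof -
  interpret E: equilibrium m0 m1 "G n" "act n" by (rule eq)
  show ?thesis using prof[of n] by (simp add: E.profile_def)
qed

lemma Bp_sets: "Bp n u t g \<in> sets m0" by (simp add: Bp_def B_sets)

lemma finite_nb': "finite (nb N' k u)"
  by (rule nb_finite[of _ UNIV]) (auto simp: finN')

lemma finite_past': "finite (past N' u t)" using finN' by (rule finite_past)

lemma stable_ball:
  "eventually (\<lambda>n. inj_on (lab n) (nb N' k u) \<and> lab n ` nb N' k u \<subseteq> pverts (G n) \<and>
     (\<forall>i\<in>nb N' k u. Nn n (lab n i) = lab n ` N' i)) sequentially"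
proof -
  have "eventually (\<lambda>n. \<forall>i\<in>nb N' k u. Nn n (lab n i) = lab n ` N' i) sequentially"
    by (rule eventually_ball_finite[OF finite_nb']) (use nbr in blast)
  with inj[OF finite_nb'[of k u]] show ?thesis by eventually_elim blast
qed

text \<open>Induction on time. The own cell settles because it involves earlier decisions only, and
  inside it the decision compares \<open>lik x\<close> with a threshold governed by
  \<open>q\<close>. Off the atoms of the law of \<open>lik\<close>, the ratio almost surely differs
  from each of the countably many limiting thresholds, so it ends up on one side.\<close>

lemma settles_Bp:
  "AE x in m0. measure m0 {y \<in> space m0. lik y = lik x} = 0 \<longrightarrow>
    (\<forall>u t g. finite g \<longrightarrow> settles (\<lambda>n. x \<in> Bp n u t g))"
proof -
  have opt: "AE x in m0. \<forall>n. \<forall>u\<in>pverts (G n). \<forall>t\<ge>1. \<forall>g\<in>Pow (past (Nn n) u t).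
    (x \<in> B n u t g \<longrightarrow> others (B n) (Nn n) False u t g \<le> lik x * others (B n) (Nn n) True u t g) \<and>
    (x \<in> cell m0 (B n) (Nn n) u (past (Nn n) u t) g \<and> x \<notin> B n u t g \<longrightarrow>
       lik x * others (B n) (Nn n) True u t g \<le> others (B n) (Nn n) False u t g)"
    unfolding AE_all_countable
  proof
    fix n
    interpret E: equilibrium m0 m1 "G n" "act n" by (rule eq)
    show "AE x in m0. \<forall>u\<in>pverts (G n). \<forall>t\<ge>1. \<forall>g\<in>Pow (past (Nn n) u t).
      (x \<in> B n u t g \<longrightarrow> others (B n) (Nn n) False u t g \<le> lik x * others (B n) (Nn n) True u t g) \<and>
      (x \<in> cell m0 (B n) (Nn n) u (past (Nn n) u t) g \<and> x \<notin> B n u t g \<longrightarrow>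
         lik x * others (B n) (Nn n) True u t g \<le> others (B n) (Nn n) False u t g)"
      by (rule E.profile_threshold[OF prof nrm])
  qed
  \<comment> \<open>The critical equation amounts to \<open>lik x = (1 - c) / c\<close>. This level
    is either null, hence avoided almost surely, or an atom, which the premise excludes; for
    \<open>c = 0\<close> there is no solution.\<close>
  have crit1: "AE x in m0. measure m0 {y \<in> space m0. lik y = lik x} = 0 \<longrightarrow> lik x * c \<noteq> 1 - c" for c
  proof (cases "c = 0")
    case False
    define k where "k = (1 - c) / c"
    have iff: "lik x * c = 1 - c \<longleftrightarrow> lik x = k" for x using False by (simp add: k_def field_simps)
    show ?thesis
    proof (cases "measure m0 {y \<in> space m0. lik y = k} = 0")
      case True
      interpret M0: prob_space m0 by (rule prob0)
      have "AE x in m0. lik x \<noteq> k"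
        by (rule AE_I[where N = "{y \<in> space m0. lik y = k}"]) (use True in \<open>auto simp: M0.emeasure_eq_measure\<close>)
      then show ?thesis by eventually_elim (simp add: iff)
    next
      case False
      then show ?thesis by (intro AE_I2) (auto simp: iff)
    qed
  qed simp
  have "AE x in m0. \<forall>u t i. measure m0 {y \<in> space m0. lik y = lik x} = 0 \<longrightarrow>
      lik x * q u t (snd (snd (dec i))) \<noteq> 1 - q u t (snd (snd (dec i)))"
    unfolding AE_all_countable using crit1 by blast
  with opt show ?thesis using AE_space
  proof eventually_elim
    case (elim x)
    have x: "x \<in> space m0" by (rule elim(3))
    note opt' = elim(1) and crit' = elim(2)
    show ?case
    proof (intro impI allI)
      fix u t and g :: "(nat \<times> nat) set"
      assume null: "measure m0 {y \<in> space m0. lik y = lik x} = 0" and "finite g"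
      from \<open>finite g\<close> show "settles (\<lambda>n. x \<in> Bp n u t g)"
      proof (induction t arbitrary: g rule: less_induct)
        case (less t)
        let ?g = "\<lambda>n. \<iota> n ` g"
        let ?rel = "\<lambda>n. network.relevant m0 m1 (G n) (act n) (lab n u) t (?g n)"
        let ?cell = "\<lambda>n. cell m0 (B n) (Nn n) (lab n u) (past (Nn n) (lab n u) t) (?g n)"
        let ?a = "\<lambda>n. others (B n) (Nn n) False (lab n u) t (?g n)"
        let ?b = "\<lambda>n. others (B n) (Nn n) True (lab n u) t (?g n)"
        show ?case
        proof (cases "t \<ge> 1")
          case t: True
          define J where "J = insert u (N' u) \<union> fst ` g"
          have "finite J" using finN' less.prems by (simp add: J_def)
          from inj[OF this] nbr[of u]
          have ev: "eventually (\<lambda>n. inj_on (lab n) J \<and> lab n u \<in> pverts (G n) \<and> Nn n (lab n u) = lab n ` N' u) sequentially"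
            by eventually_elim (auto simp: J_def)
          consider "eventually (\<lambda>n. \<not> ?rel n) sequentially" | "eventually ?rel sequentially"
            using rel[OF less.prems, of u t] by (auto simp: settles_iff)
          then show ?thesis
          proof cases
            case 1
            with ev have "eventually (\<lambda>n. x \<notin> Bp n u t g) sequentially"
              by eventually_elim (simp add: Bp_pos[OF t] irrel[OF _ t])
            then show ?thesis by (simp add: settles_iff)
          next
            case 2
            \<comment> \<open>The induction hypothesis at the restricted histories settles the
              finitely many tests that define the own cell.\<close>
            have "settles (\<lambda>n. \<forall>t'\<in>{1..<t}. (x \<in> Bp n u t' (g \<inter> past N' u t')) = ((u, t') \<in> g))"
              by (rule settles_ball) (use less.IH less.prems in \<open>auto intro!: settles_eq\<close>)
            moreover have "eventually (\<lambda>n. (\<forall>t'\<in>{1..<t}. (x \<in> Bp n u t' (g \<inter> past N' u t')) = ((u, t') \<in> g)) =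
                (x \<in> ?cell n)) sequentially"
              using ev
            proof eventually_elim
              case (elim n)
              have gJ: "g \<subseteq> J \<times> UNIV" by (force simp: J_def)
              have uJ: "u \<in> J" by (simp add: J_def)
              have pJ: "past N' u t' \<subseteq> J \<times> UNIV" for t' by (auto simp: past_def J_def)
              have a: "?g n \<inter> past (Nn n) (lab n u) t' = \<iota> n ` (g \<inter> past N' u t')" for t'
              proof -
                have inj': "inj_on (lab n) J" and "Nn n (lab n u) = lab n ` N' u" using elim by blast+
                from this(2) have p: "past (Nn n) (lab n u) t' = \<iota> n ` past N' u t'" by (rule past_transport)
                show ?thesis unfolding p by (rule image_Int_inj[OF inj' gJ pJ])
              qed
              have b: "(lab n u, t') \<in> ?g n \<longleftrightarrow> (u, t') \<in> g" for t'
              proof (rule mem_image_inj[OF _ gJ uJ])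
                show "inj_on (lab n) J" using elim by blast
              qed
              have "(x \<in> ?cell n) = (\<forall>t'\<in>{1..<t}. (x \<in> B n (lab n u) t' (?g n \<inter> past (Nn n) (lab n u) t')) = ((lab n u, t') \<in> ?g n))"
                unfolding cell_past_eq using x by (simp only: mem_Collect_eq simp_thms)
              also have "\<dots> = (\<forall>t'\<in>{1..<t}. (x \<in> Bp n u t' (g \<inter> past N' u t')) = ((u, t') \<in> g))"
                by (rule ball_cong[OF refl]) (simp only: a b Bp_pos atLeastLessThan_iff)
              finally show ?case by (rule sym)
            qed
            ultimately have sc: "settles (\<lambda>n. x \<in> ?cell n)" by (rule settles_subst)
            have thr: "eventually (\<lambda>n. (x \<in> Bp n u t g \<longrightarrow> x \<in> ?cell n \<and> ?a n \<le> lik x * ?b n) \<and>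
                (x \<in> ?cell n \<and> x \<notin> Bp n u t g \<longrightarrow> lik x * ?b n \<le> ?a n) \<and> ?a n + ?b n > 0) sequentially"
              using ev 2
            proof eventually_elim
              case (elim n)
              interpret E: equilibrium m0 m1 "G n" "act n" by (rule eq)
              have "?g n \<in> Pow (past (Nn n) (lab n u) t)" using E.relevant_past[OF elim(2)] by simp
              moreover have "lab n u \<in> pverts (G n)" using elim(1) by blast
              moreover note opt'
              ultimately show ?case
                using t nrm[of "lab n u" n t "?g n"] E.relevant_others[OF prof _ elim(2)]
                by (simp add: Bp_pos[OF t]) blast
            qed
            have lim: "(\<lambda>n. lik x * (?b n / (?a n + ?b n)) - (1 - ?b n / (?a n + ?b n))) \<longlonglongrightarrow> lik x * q u t g - (1 - q u t g)"
              by (intro tendsto_intros q less.prems)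
            \<comment> \<open>The convergent quantity is \<open>lik x * b - a\<close> divided by the
              positive number \<open>a + b\<close>, so its sign is the one that decides the
              action.\<close>
            have sgn: "lik x * (b / (a + b)) - (1 - b / (a + b)) = (lik x * b - a) / (a + b)" if "a + b > 0" for a b
            proof -
              have "1 - b / (a + b) = a / (a + b)" using that by (simp add: field_simps)
              then show ?thesis by (simp add: diff_divide_distrib)
            qed
            have sgn_pos: "lik x * b > a" if "a + b > 0" "lik x * (b / (a + b)) - (1 - b / (a + b)) > 0" for a b
              using that(2) unfolding sgn[OF that(1)] using that(1) by (simp add: zero_less_divide_iff)
            have sgn_neg: "lik x * b < a" if "a + b > 0" "lik x * (b / (a + b)) - (1 - b / (a + b)) < 0" for a b
              using that(2) unfolding sgn[OF that(1)] using that(1) by (simp add: divide_less_0_iff)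
            have "snd (snd (dec (enc (u, t, g)))) = g" using dec_enc[OF less.prems] by simp
            then have "lik x * q u t g \<noteq> 1 - q u t g" using crit' null by metis
            \<comment> \<open>Above the threshold the decision eventually coincides with membership
              in the cell; below it the signal is eventually outside the strategy set.\<close>
            then consider "lik x * q u t g - (1 - q u t g) > 0" | "lik x * q u t g - (1 - q u t g) < 0" by linarith
            then show ?thesis
            proof cases
              case 1
              have "eventually (\<lambda>n. lik x * (?b n / (?a n + ?b n)) - (1 - ?b n / (?a n + ?b n)) > 0) sequentially"
                using order_tendstoD(1)[OF lim 1] .
              with thr have "eventually (\<lambda>n. (x \<in> ?cell n) = (x \<in> Bp n u t g)) sequentially"
              proof eventually_elim
                case (elim n)
                have "lik x * ?b n > ?a n" by (rule sgn_pos) (use elim in blast)+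
                with elim show ?case by auto
              qed
              with sc show ?thesis by (rule settles_subst)
            next
              case 2
              have "eventually (\<lambda>n. lik x * (?b n / (?a n + ?b n)) - (1 - ?b n / (?a n + ?b n)) < 0) sequentially"
                using order_tendstoD(2)[OF lim 2] .
              with thr have "eventually (\<lambda>n. x \<notin> Bp n u t g) sequentially"
              proof eventually_elim
                case (elim n)
                have "lik x * ?b n < ?a n" by (rule sgn_neg) (use elim in blast)+
                with elim show ?case by auto
              qed
              then show ?thesis by (simp add: settles_iff)
            qed
          qed
        qed (simp add: Bp_def settles_def)
      qed
    qed
  qed
qed

end

section \<open>Limit strategies and their optimality\<close>

context converging begin

text \<open>Convergence of the joint laws of the likelihood ratio and finitely many decisions, under
  both states. \<open>\<Phi>\<close> is any condition on the decisions indexed by \<open>I\<close>;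
  the Borel set \<open>J\<close> lets optimality be tested on signal sets described by
  \<open>lik\<close>.\<close>

definition converges_to :: "(nat \<Rightarrow> nat) \<Rightarrow> (nat \<Rightarrow> nat \<Rightarrow> (nat \<times> nat) set \<Rightarrow> 'w set) \<Rightarrow> bool" where
  "converges_to r B' \<longleftrightarrow> strict_mono r \<and> (\<forall>u t g. B' u t g \<in> sets m0) \<and>
    (\<forall>s J I \<Phi>. J \<in> sets borel \<longrightarrow> finite I \<longrightarrow> (\<forall>(u, t, g)\<in>I. finite g) \<longrightarrow>
      (\<forall>f h. (\<forall>p\<in>I. f p = h p) \<longrightarrow> \<Phi> f = \<Phi> h) \<longrightarrow>
      (\<lambda>n. measure (mu s) {x \<in> space m0. lik x \<in> J \<and> \<Phi> (\<lambda>(u, t, g). x \<in> Bp (r n) u t g)})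
        \<longlonglongrightarrow> measure (mu s) {x \<in> space m0. lik x \<in> J \<and> \<Phi> (\<lambda>(u, t, g). x \<in> B' u t g)})"

text \<open>\<open>realize_limit\<close> with \<open>l = lik\<close>: on a level set of
  \<open>lik\<close> both signal laws are multiples of \<open>m0\<close>, with factor 1 for the
  state \<open>False\<close> and the level itself for \<open>True\<close>.\<close>

lemma ex_limit_profile: "\<exists>r B'. converges_to r B'"
proof -
  define C where "C = (\<lambda>n i. case dec i of (u, t, g) \<Rightarrow> Bp n u t g)"
  have C: "C n i \<in> sets m0" for n i by (auto simp: C_def Bp_sets split: prod.splits)
  interpret M0: prob_space m0 by (rule prob0)
  have "AE x in m0. measure m0 {y \<in> space m0. lik y = lik x} = 0 \<longrightarrow>
      (\<forall>i. \<exists>n. (\<forall>m\<ge>n. x \<in> C m i) \<or> (\<forall>m\<ge>n. x \<notin> C m i))"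
    using settles_Bp
  proof eventually_elim
    case (elim x)
    show ?case
    proof (intro impI allI)
      fix i assume null: "measure m0 {y \<in> space m0. lik y = lik x} = 0"
      obtain u t g where d: "dec i = (u, t, g)" by (cases "dec i") auto
      have "finite g" using finite_dec[of i] d by simp
      then have "settles (\<lambda>n. x \<in> Bp n u t g)" using elim null by blast
      then show "\<exists>n. (\<forall>m\<ge>n. x \<in> C m i) \<or> (\<forall>m\<ge>n. x \<notin> C m i)" by (simp add: settles_def C_def d)
    qed
  qed
  from realize_limit[OF M0.finite_measure_axioms lik_measurable C this]
  obtain r :: "nat \<Rightarrow> nat" and B'' where r: "strict_mono r" and B''0: "\<forall>i. B'' i \<in> sets m0" and
    lim0: "\<forall>N a \<sigma> J. finite_measure N \<longrightarrow> sets N = sets m0 \<longrightarrow> absolutely_continuous m0 N \<longrightarrow>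
       (\<forall>c S. S \<in> sets m0 \<longrightarrow> S \<subseteq> {x \<in> space m0. lik x = c} \<longrightarrow> measure N S = a c * measure m0 S) \<longrightarrow>
       J \<in> sets borel \<longrightarrow>
       (\<lambda>m. measure N (pattern {x \<in> space m0. lik x \<in> J} (C (r m)) \<sigma>))
         \<longlonglongrightarrow> measure N (pattern {x \<in> space m0. lik x \<in> J} B'' \<sigma>)"
    by (elim exE conjE) (rule that)
  note B'' = B''0[rule_format] and lim = lim0[rule_format]
  have fin_mu: "finite_measure (mu s)" for s
  proof -
    interpret P: prob_space "mu s" by (rule prob_mu)
    show ?thesis by unfold_locales
  qed
  have ratio: "measure (mu s) S = (if s then c else 1) * measure m0 S"
    if "S \<in> sets m0" "S \<subseteq> {x \<in> space m0. lik x = c}" for s c S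
  proof (cases s)
    case True
    have "measure m1 S = (\<integral>x. indicator S x * lik x \<partial>m0)" by (rule measure_m1[OF that(1)])
    also have "\<dots> = (\<integral>x. c * indicator S x \<partial>m0)"
      by (rule Bochner_Integration.integral_cong) (use that(2) in \<open>auto simp: indicator_def\<close>)
    finally show ?thesis using True that(1) by (simp add: mu_def)
  qed (simp add: mu_def)
  have ac: "absolutely_continuous m0 (mu s)" for s
    using ac01 by (cases s) (auto simp: mu_def absolutely_continuous_def)
  have lim': "(\<lambda>m. measure (mu s) (pattern {x \<in> space m0. lik x \<in> J} (C (r m)) \<sigma>))
         \<longlonglongrightarrow> measure (mu s) (pattern {x \<in> space m0. lik x \<in> J} B'' \<sigma>)" if "J \<in> sets borel" for s J \<sigma>
    by (rule lim[where a = "\<lambda>c. if s then c else 1", OF fin_mu sets_mu ac ratio that])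
  define B' where "B' = (\<lambda>u t g. B'' (enc (u, t, g)))"
  have "converges_to r B'"
    unfolding converges_to_def
  proof (intro conjI allI impI r)
    show "B' u t g \<in> sets m0" for u t g by (simp add: B'_def B'')
    fix s I and J :: "real set" and \<Phi> :: "(nat \<times> nat \<times> (nat \<times> nat) set \<Rightarrow> bool) \<Rightarrow> bool"
    assume J: "J \<in> sets borel" and I: "finite I" "\<forall>(u, t, g)\<in>I. finite g"
      and \<Phi>: "\<forall>f h. (\<forall>p\<in>I. f p = h p) \<longrightarrow> \<Phi> f = \<Phi> h"
    define \<Psi> where "\<Psi> = (\<lambda>f. \<Phi> (\<lambda>p. f (enc p)))"
    \<comment> \<open>A condition on finitely many triples depends on codes below some bound, as
      \<open>tendsto_measure_of_patterns\<close> requires.\<close>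
    obtain n0 where n0: "\<And>p. p \<in> I \<Longrightarrow> enc p < n0"
    proof
      fix p assume "p \<in> I"
      then have "enc p \<le> Max (enc ` I)" using I(1) by (intro Max_ge) auto
      then show "enc p < Suc (Max (enc ` I))" by simp
    qed
    have X: "{x \<in> space m0. lik x \<in> J} \<in> sets m0" using J by measurable
    have "(\<lambda>m. measure (mu s) {x \<in> {x \<in> space m0. lik x \<in> J}. \<Psi> (\<lambda>i. x \<in> C (r m) i)})
        \<longlonglongrightarrow> measure (mu s) {x \<in> {x \<in> space m0. lik x \<in> J}. \<Psi> (\<lambda>i. x \<in> B'' i)}"
    proof (rule tendsto_measure_of_patterns[OF fin_mu sets_mu X C B''])
      show "(\<lambda>m. measure (mu s) (pattern {x \<in> space m0. lik x \<in> J} (C (r m)) \<sigma>))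
         \<longlonglongrightarrow> measure (mu s) (pattern {x \<in> space m0. lik x \<in> J} B'' \<sigma>)" for \<sigma>
        by (rule lim'[OF J])
      fix f h :: "nat \<Rightarrow> bool" assume eq: "\<And>i. i < n0 \<Longrightarrow> f i = h i"
      show "\<Psi> f = \<Psi> h" unfolding \<Psi>_def by (rule \<Phi>[rule_format]) (rule eq[OF n0])
    qed
    moreover have "\<Psi> (\<lambda>i. x \<in> C (r m) i) = \<Phi> (\<lambda>(u, t, g). x \<in> Bp (r m) u t g)" for x m
    proof -
      have "\<forall>p\<in>I. (x \<in> C (r m) (enc p)) = (case p of (u, t, g) \<Rightarrow> x \<in> Bp (r m) u t g)"
      proof
        fix p assume p: "p \<in> I"
        obtain u t g where pe: "p = (u, t, g)" by (cases p) auto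
        then have "finite g" using I(2) p by blast
        then show "(x \<in> C (r m) (enc p)) = (case p of (u, t, g) \<Rightarrow> x \<in> Bp (r m) u t g)"
          by (simp add: pe C_def dec_enc)
      qed
      then show ?thesis unfolding \<Psi>_def by (intro \<Phi>[rule_format]) (rule bspec)
    qed
    moreover have "\<Psi> (\<lambda>i. x \<in> B'' i) = \<Phi> (\<lambda>(u, t, g). x \<in> B' u t g)" for x
      unfolding \<Psi>_def B'_def by (rule arg_cong[where f = \<Phi>]) auto
    ultimately show "(\<lambda>n. measure (mu s) {x \<in> space m0. lik x \<in> J \<and> \<Phi> (\<lambda>(u, t, g). x \<in> Bp (r n) u t g)})
        \<longlonglongrightarrow> measure (mu s) {x \<in> space m0. lik x \<in> J \<and> \<Phi> (\<lambda>(u, t, g). x \<in> B' u t g)}"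
      by simp
  qed
  then show ?thesis by blast
qed

text \<open>The past, the cells and \<open>others\<close> of \<open>u\<close> at time
  \<open>t\<close> are determined within the ball of radius \<open>Suc t\<close>, on which the
  labels are eventually injective and respect neighbourhoods.\<close>

lemma transport_cell:
  "eventually (\<lambda>n. lab n u \<in> pverts (G n) \<and> past (Nn n) (lab n u) t = \<iota> n ` past N' u t \<and> inj_on (\<iota> n) (past N' u t) \<and>
    (\<forall>g\<in>Pow (past N' u t). cell m0 (B n) (Nn n) (lab n u) (past (Nn n) (lab n u) t) (\<iota> n ` g) = cell m0 (Bp n) N' u (past N' u t) g \<and>
      (\<forall>s. others (B n) (Nn n) s (lab n u) t (\<iota> n ` g) = others (Bp n) N' s u t g))) sequentially"
  using stable_ball[of "Suc t" u]
proof eventually_elim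
  case (elim n)
  let ?U = "nb N' (Suc t) u"
  have inj: "inj_on (lab n) ?U" and sub: "lab n ` ?U \<subseteq> pverts (G n)" using elim by blast+
  have N: "Nn n (lab n i) = lab n ` N' i" if "i \<in> ?U" for i using elim that by blast
  have uU: "u \<in> ?U" by (rule nb_self)
  have "insert u (N' u) \<subseteq> ?U" using nb_mono[of 1 "Suc t" N' u] by simp
  then have pU: "past N' u t' \<subseteq> ?U \<times> {1..}" for t' by (fastforce simp: past_def)
  then have pU': "past N' u t' \<subseteq> ?U \<times> UNIV" for t' by blast
  have p: "past (Nn n) (lab n u) t = \<iota> n ` past N' u t" by (rule past_transport) (rule N[OF uU])
  have inji: "inj_on (\<iota> n) (past N' u t)"
    by (rule inj_on_subset[OF _ pU']) (use inj in \<open>auto simp: inj_on_def\<close>)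
  show ?case
  proof (intro conjI ballI allI p inji)
    show "lab n u \<in> pverts (G n)" using sub uU by blast
    fix g s assume g: "g \<in> Pow (past N' u t)"
    show "cell m0 (B n) (Nn n) (lab n u) (past (Nn n) (lab n u) t) (\<iota> n ` g) = cell m0 (Bp n) N' u (past N' u t) g"
      unfolding p
      by (rule cell_transport[where g = "lab n" and v = u and N = "Nn n" and N' = N' and U = ?U, OF inj uU pU _ pU' N[OF uU]]) (use g pU' in \<open>auto simp: Bp_pos\<close>)
    show "others (B n) (Nn n) s (lab n u) t (\<iota> n ` g) = others (Bp n) N' s u t g"
    proof (rule others_transport[OF inj])
      show "Nn n (lab n i) = lab n ` N' i" if "i \<in> nb N' t u" for i
        using N that nb_mono[of t "Suc t" N' u] by auto
    qed (use g in \<open>auto simp: Bp_pos\<close>)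
  qed
qed

text \<open>Membership in a cell is itself a condition on finitely many decisions, so it can be
  absorbed into the condition \<open>\<Phi>\<close>.\<close>

lemma cell_tendsto:
  assumes c: "converges_to r B'" and D: "finite D" and J: "J \<in> sets borel" and I: "finite I" "\<forall>(u, t, g)\<in>I. finite g"
    and \<Phi>: "\<And>f h. (\<forall>p\<in>I. f p = h p) \<Longrightarrow> \<Phi> f = \<Phi> h"
  shows "(\<lambda>n. measure (mu s) {x \<in> cell m0 (Bp (r n)) N' v D \<alpha>. lik x \<in> J \<and> \<Phi> (\<lambda>(u, t, g). x \<in> Bp (r n) u t g)})
    \<longlonglongrightarrow> measure (mu s) {x \<in> cell m0 B' N' v D \<alpha>. lik x \<in> J \<and> \<Phi> (\<lambda>(u, t, g). x \<in> B' u t g)}"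
proof -
  define \<Psi> where "\<Psi> = (\<lambda>f. (\<forall>t. (v, t) \<in> D \<longrightarrow> f (v, t, \<alpha> \<inter> past N' v t) = ((v, t) \<in> \<alpha>)) \<and> \<Phi> f)"
  define I' where "I' = I \<union> (\<lambda>(v, t). (v, t, \<alpha> \<inter> past N' v t)) ` D"
  have "(\<lambda>n. measure (mu s) {x \<in> space m0. lik x \<in> J \<and> \<Psi> (\<lambda>(u, t, g). x \<in> Bp (r n) u t g)})
        \<longlonglongrightarrow> measure (mu s) {x \<in> space m0. lik x \<in> J \<and> \<Psi> (\<lambda>(u, t, g). x \<in> B' u t g)}"
  proof -
    have "finite I'" using I D by (simp add: I'_def)
    moreover have "\<forall>(u, t, g)\<in>I'. finite g" using I finite_past' by (auto simp: I'_def)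
    moreover have "\<forall>f h. (\<forall>p\<in>I'. f p = h p) \<longrightarrow> \<Psi> f = \<Psi> h"
    proof (intro allI impI)
      fix f h :: "nat \<times> nat \<times> (nat \<times> nat) set \<Rightarrow> bool" assume e: "\<forall>p\<in>I'. f p = h p"
      then have "\<Phi> f = \<Phi> h" by (intro \<Phi>) (simp add: I'_def)
      moreover have "f (v, t, \<alpha> \<inter> past N' v t) = h (v, t, \<alpha> \<inter> past N' v t)" if "(v, t) \<in> D" for t
        using e that by (force simp: I'_def)
      ultimately show "\<Psi> f = \<Psi> h" unfolding \<Psi>_def by auto
    qed
    ultimately show ?thesis using c J unfolding converges_to_def by blast
  qed
  moreover have "{x \<in> space m0. lik x \<in> J \<and> \<Psi> (\<lambda>(u, t, g). x \<in> A u t g)} =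
      {x \<in> cell m0 A N' v D \<alpha>. lik x \<in> J \<and> \<Phi> (\<lambda>(u, t, g). x \<in> A u t g)}" for A
    by (auto simp: cell_def \<Psi>_def)
  ultimately show ?thesis by simp
qed

lemma cell_tendsto': "converges_to r B' \<Longrightarrow> finite D \<Longrightarrow>
  (\<lambda>n. measure (mu s) (cell m0 (Bp (r n)) N' v D \<alpha>)) \<longlonglongrightarrow> measure (mu s) (cell m0 B' N' v D \<alpha>)"
  using cell_tendsto[of r B' D UNIV "{}" "\<lambda>_. True" s v \<alpha>] by simp

lemma others_tendsto:
  assumes "converges_to r B'"
  shows "(\<lambda>n. others (Bp (r n)) N' s u t g) \<longlonglongrightarrow> others B' N' s u t g"
proof -
  have "finite (horizon N' u t)" by (rule finite_subset[OF horizon_subset]) (simp add: finite_nb')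
  then show ?thesis unfolding others_def by (intro tendsto_sum tendsto_prod cell_tendsto' assms)
qed

lemma eventually_subseq: "converges_to r B' \<Longrightarrow> eventually P sequentially \<Longrightarrow> eventually (\<lambda>n. P (r n)) sequentially"
  unfolding converges_to_def by (intro eventually_compose_filterlim[of P sequentially r]) (auto intro: filterlim_subseq)

text \<open>Convergence controls sets of the form \<open>lik x \<in> J\<close> within a cell,
  whereas \<open>S\<close> is arbitrary. The inequalities are passed to the limit on such sets; the
  set where a threshold would fail is one of them, so the threshold rule holds almost everywhere,
  and it implies the inequality for every \<open>S\<close>.\<close>

lemma limit_optimal:
  assumes c: "converges_to r B'" and t: "t \<ge> 1" and g: "g \<subseteq> past N' u t" and S: "S \<in> sets m0"
  shows "others B' N' False u t g * measure (mu False) (cell m0 B' N' u (past N' u t) g \<inter> (B' u t g \<inter> S)) \<le>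
      others B' N' True u t g * measure (mu True) (cell m0 B' N' u (past N' u t) g \<inter> (B' u t g \<inter> S))"
    and "others B' N' True u t g * measure (mu True) (cell m0 B' N' u (past N' u t) g \<inter> (S - B' u t g)) \<le>
      others B' N' False u t g * measure (mu False) (cell m0 B' N' u (past N' u t) g \<inter> (S - B' u t g))"
proof -
  let ?C = "cell m0 B' N' u (past N' u t) g" and ?a = "others B' N' False u t g" and ?b = "others B' N' True u t g"
  have B's: "B' u t g \<in> sets m0" for u t g using c by (simp add: converges_to_def)
  have fg: "finite g" using finite_past' g by (rule rev_finite_subset)
  have C: "?C \<in> sets m0" by (rule cell_sets[OF B's finite_past'])
  have conv: "(\<lambda>n. measure (mu s) {x \<in> cell m0 (Bp (r n)) N' u (past N' u t) g. lik x \<in> J \<and> (x \<in> Bp (r n) u t g) = b})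
    \<longlonglongrightarrow> measure (mu s) {x \<in> ?C. lik x \<in> J \<and> (x \<in> B' u t g) = b}" if "J \<in> sets borel" for J s b
    using cell_tendsto[OF c finite_past' that, of "{(u, t, g)}" "\<lambda>f. f (u, t, g) = b" s u u t g] fg by simp
  have opt: "eventually (\<lambda>n.
      others (Bp (r n)) N' False u t g * measure (mu False) {x \<in> cell m0 (Bp (r n)) N' u (past N' u t) g. lik x \<in> J \<and> (x \<in> Bp (r n) u t g) = True} \<le>
      others (Bp (r n)) N' True u t g * measure (mu True) {x \<in> cell m0 (Bp (r n)) N' u (past N' u t) g. lik x \<in> J \<and> (x \<in> Bp (r n) u t g) = True} \<and>
      others (Bp (r n)) N' True u t g * measure (mu True) {x \<in> cell m0 (Bp (r n)) N' u (past N' u t) g. lik x \<in> J \<and> (x \<in> Bp (r n) u t g) = False} \<le>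
      others (Bp (r n)) N' False u t g * measure (mu False) {x \<in> cell m0 (Bp (r n)) N' u (past N' u t) g. lik x \<in> J \<and> (x \<in> Bp (r n) u t g) = False}) sequentially"
    if J: "J \<in> sets borel" for J
    using eventually_subseq[OF c transport_cell[of u t]]
  proof eventually_elim
    case (elim n)
    interpret E: equilibrium m0 m1 "G (r n)" "act (r n)" by (rule eq)
    let ?n = "r n"
    define X where "X = {x \<in> space m0. lik x \<in> J}"
    have X: "X \<in> sets m0" unfolding X_def using J by measurable
    have gP: "g \<in> Pow (past N' u t)" using g by simp
    have V: "lab ?n u \<in> pverts (G ?n)" and P: "past (Nn ?n) (lab ?n u) t = \<iota> ?n ` past N' u t" using elim by blast+
    have ce: "cell m0 (B ?n) (Nn ?n) (lab ?n u) (past (Nn ?n) (lab ?n u) t) (\<iota> ?n ` g) = cell m0 (Bp ?n) N' u (past N' u t) g"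
      and oe: "\<And>s. others (B ?n) (Nn ?n) s (lab ?n u) t (\<iota> ?n ` g) = others (Bp ?n) N' s u t g" using elim gP by blast+
    have gi: "\<iota> ?n ` g \<subseteq> past (Nn ?n) (lab ?n u) t" unfolding P using g by (rule image_mono)
    have sp: "cell m0 (Bp ?n) N' u (past N' u t) g \<subseteq> space m0" by (auto simp: cell_def)
    have e1: "cell m0 (Bp ?n) N' u (past N' u t) g \<inter> (Bp ?n u t g \<inter> X) = {x \<in> cell m0 (Bp ?n) N' u (past N' u t) g. lik x \<in> J \<and> (x \<in> Bp ?n u t g) = True}"
      using sp by (auto simp: X_def)
    have e2: "cell m0 (Bp ?n) N' u (past N' u t) g \<inter> (X - Bp ?n u t g) = {x \<in> cell m0 (Bp ?n) N' u (past N' u t) g. lik x \<in> J \<and> (x \<in> Bp ?n u t g) = False}"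
      using sp by (auto simp: X_def)
    show ?case
      using E.profile_optimal[OF prof V t gi X]
      unfolding ce oe Bp_pos[OF t, symmetric] e1 e2 by (intro conjI)
  qed
  have lim1: "?a * measure (mu False) {x \<in> ?C. lik x \<in> J \<and> (x \<in> B' u t g) = True} \<le>
      ?b * measure (mu True) {x \<in> ?C. lik x \<in> J \<and> (x \<in> B' u t g) = True}" if J: "J \<in> sets borel" for J
  proof (rule tendsto_le[OF sequentially_bot tendsto_mult[OF others_tendsto[OF c] conv[OF J]] tendsto_mult[OF others_tendsto[OF c] conv[OF J]]])
    show "eventually (\<lambda>n. others (Bp (r n)) N' False u t g * measure (mu False) {x \<in> cell m0 (Bp (r n)) N' u (past N' u t) g. lik x \<in> J \<and> (x \<in> Bp (r n) u t g) = True} \<le>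
      others (Bp (r n)) N' True u t g * measure (mu True) {x \<in> cell m0 (Bp (r n)) N' u (past N' u t) g. lik x \<in> J \<and> (x \<in> Bp (r n) u t g) = True}) sequentially"
      using opt[OF J] by (rule eventually_mono) (rule conjunct1)
  qed
  have lim2: "?b * measure (mu True) {x \<in> ?C. lik x \<in> J \<and> (x \<in> B' u t g) = False} \<le>
      ?a * measure (mu False) {x \<in> ?C. lik x \<in> J \<and> (x \<in> B' u t g) = False}" if J: "J \<in> sets borel" for J
  proof (rule tendsto_le[OF sequentially_bot tendsto_mult[OF others_tendsto[OF c] conv[OF J]] tendsto_mult[OF others_tendsto[OF c] conv[OF J]]])
    show "eventually (\<lambda>n. others (Bp (r n)) N' True u t g * measure (mu True) {x \<in> cell m0 (Bp (r n)) N' u (past N' u t) g. lik x \<in> J \<and> (x \<in> Bp (r n) u t g) = False} \<le>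
      others (Bp (r n)) N' False u t g * measure (mu False) {x \<in> cell m0 (Bp (r n)) N' u (past N' u t) g. lik x \<in> J \<and> (x \<in> Bp (r n) u t g) = False}) sequentially"
      using opt[OF J] by (rule eventually_mono) (rule conjunct2)
  qed
  have 1: "AE x in m0. x \<in> ?C \<inter> B' u t g \<longrightarrow> ?a \<le> lik x * ?b"
  proof (rule threshold_AE)
    show "?C \<inter> B' u t g \<in> sets m0" using C B's by auto
    have "{x \<in> ?C \<inter> B' u t g. lik x * ?b < ?a} = {x \<in> ?C. lik x \<in> {y. y * ?b < ?a} \<and> (x \<in> B' u t g) = True}" by auto
    then show "?a * measure m0 {x \<in> ?C \<inter> B' u t g. lik x * ?b < ?a} \<le> ?b * measure m1 {x \<in> ?C \<inter> B' u t g. lik x * ?b < ?a}"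
      using lim1[of "{y. y * ?b < ?a}"] by (simp add: mu_def)
  qed
  have 2: "AE x in m0. x \<in> ?C - B' u t g \<longrightarrow> - ?a \<le> lik x * - ?b"
  proof (rule threshold_AE)
    show "?C - B' u t g \<in> sets m0" using C B's by auto
    have "{x \<in> ?C - B' u t g. lik x * - ?b < - ?a} = {x \<in> ?C. lik x \<in> {y. y * ?b > ?a} \<and> (x \<in> B' u t g) = False}" by auto
    then show "- ?a * measure m0 {x \<in> ?C - B' u t g. lik x * - ?b < - ?a} \<le> - ?b * measure m1 {x \<in> ?C - B' u t g. lik x * - ?b < - ?a}"
      using lim2[of "{y. y * ?b > ?a}"] by (simp add: mu_def)
  qed
  have s: "?C \<inter> B' u t g \<in> sets m0" "?C - B' u t g \<in> sets m0" using C B's by auto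
  have e: "?C \<inter> (B' u t g \<inter> S) = ?C \<inter> B' u t g \<inter> S" "?C \<inter> (S - B' u t g) = (?C - B' u t g) \<inter> S" by auto
  show "?a * measure (mu False) (?C \<inter> (B' u t g \<inter> S)) \<le> ?b * measure (mu True) (?C \<inter> (B' u t g \<inter> S))"
    unfolding e using threshold_le[OF s(1) S 1] by (simp add: mu_def)
  show "?b * measure (mu True) (?C \<inter> (S - B' u t g)) \<le> ?a * measure (mu False) (?C \<inter> (S - B' u t g))"
    unfolding e using threshold_le[OF s(2) S 2] by (simp add: mu_def)
qed

definition limit_graph :: "nat pair_pre_digraph" where
  "limit_graph = \<lparr>pverts = UNIV, parcs = {(i, j). j \<in> N' i}\<rparr>"

lemma neighbors_limit_graph: "neighbors limit_graph = N'" "pverts limit_graph = UNIV"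
  by (simp_all add: neighbors_def limit_graph_def fun_eq_iff)

text \<open>The limit strategies are played out by \<open>run_act\<close>. The play is optimal by
  \<open>limit_optimal\<close>, and by \<open>bhat_profile\<close> the coefficients are continuous
  functions of quantities already known to converge.\<close>

lemma limit_equilibrium:
  "\<exists>act'. equilibrium m0 m1 limit_graph act' \<and> (\<forall>u t. \<exists>r. strict_mono r \<and>
    (\<lambda>n. network.bhat m0 m1 (G (r n)) (act (r n)) (lab (r n) u) t) \<longlonglongrightarrow> network.bhat m0 m1 limit_graph act' u t)"
proof -
  obtain r B' where c: "converges_to r B'" using ex_limit_profile by blast
  have B's: "B' u t g \<in> sets m0" for u t g using c by (simp add: converges_to_def)
  define act' where "act' = run_act B' N'"
  interpret L: prenetwork m0 m1 limit_graph act'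
    by unfold_locales (simp_all add: neighbors_limit_graph finN')
  have rep: "act' u t \<omega> \<longleftrightarrow> snd \<omega> u \<in> B' u t (hist (neighbors limit_graph) act' u t \<omega>)" if "t \<ge> 1" for u t \<omega>
    unfolding act'_def neighbors_limit_graph using that by (rule run_act_iff)
  interpret L: network m0 m1 limit_graph act'
  proof unfold_locales
    fix u t assume "u \<in> pverts limit_graph" "t \<ge> (1 :: nat)"
    then show "act' u t \<in> info m0 m1 limit_graph act' u t \<rightarrow>\<^sub>M count_space UNIV"
      by (intro L.strategy_measurable[OF B's rep])
  qed
  have prof': "L.profile B'" unfolding L.profile_def using B's rep by simp
  have ap: "action_process m0 m1 limit_graph act'"
    by (rule L.optimal_profile_action_process[OF prof'])
      (use limit_optimal[OF c] in \<open>simp_all add: neighbors_limit_graph\<close>)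
  have E: "equilibrium m0 m1 limit_graph act'"
    by unfold_locales (rule ap)
  have "(\<lambda>n. network.bhat m0 m1 (G (r n)) (act (r n)) (lab (r n) u) t) \<longlonglongrightarrow> L.bhat u t" for u t
  proof -
    let ?f = "\<lambda>A. \<Sum>g\<in>Pow (past N' u t). sqrt
      ((others A N' False u t g * measure (mu False) (cell m0 A N' u (past N' u t) g) / 2) *
       (others A N' True u t g * measure (mu True) (cell m0 A N' u (past N' u t) g) / 2))"
    have "L.bhat u t = ?f B'"
      by (subst L.bhat_profile[OF prof']) (simp_all add: neighbors_limit_graph)
    moreover have "(\<lambda>n. ?f (Bp (r n))) \<longlonglongrightarrow> ?f B'"
      by (intro tendsto_sum tendsto_real_sqrt tendsto_mult tendsto_divide others_tendsto[OF c] cell_tendsto'[OF c finite_past'] tendsto_const) auto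
    moreover have "eventually (\<lambda>n. network.bhat m0 m1 (G (r n)) (act (r n)) (lab (r n) u) t = ?f (Bp (r n))) sequentially"
      using eventually_subseq[OF c transport_cell[of u t]]
    proof eventually_elim
      case (elim n)
      interpret E: equilibrium m0 m1 "G (r n)" "act (r n)" by (rule eq)
      have V: "lab (r n) u \<in> pverts (G (r n))" and P: "past (Nn (r n)) (lab (r n) u) t = \<iota> (r n) ` past N' u t"
        and inj: "inj_on (\<iota> (r n)) (past N' u t)" using elim by blast+
      have PP: "Pow (past (Nn (r n)) (lab (r n) u) t) = image (\<iota> (r n)) ` Pow (past N' u t)"
        unfolding P by (rule image_Pow_surj[OF refl, symmetric])
      have inj': "inj_on (image (\<iota> (r n))) (Pow (past N' u t))" using inj by (rule inj_on_image_Pow)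
      show ?case
        unfolding E.bhat_profile[OF prof V] PP sum.reindex[OF inj'] o_def
      proof (rule sum.cong[OF refl], goal_cases)
        case (1 g)
        have ce: "cell m0 (B (r n)) (Nn (r n)) (lab (r n) u) (past (Nn (r n)) (lab (r n) u) t) (\<iota> (r n) ` g) = cell m0 (Bp (r n)) N' u (past N' u t) g"
          and oe: "\<And>s. others (B (r n)) (Nn (r n)) s (lab (r n) u) t (\<iota> (r n) ` g) = others (Bp (r n)) N' s u t g"
          using elim 1 by blast+
        show ?case by (simp only: ce oe)
      qed
    qed
    ultimately show ?thesis by (simp add: tendsto_cong)
  qed
  moreover have "strict_mono r" using c by (simp add: converges_to_def)
  ultimately show ?thesis using E by blast
qed

end

subsection \<open>Compactness of rooted networks\<close>

lemma nb_reachable: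
  assumes "\<And>u v. u \<in> V \<Longrightarrow> v \<in> N u \<Longrightarrow> (u, v) \<in> E \<and> v \<in> V" and "u \<in> V" "v \<in> nb N k u"
  shows "(u, v) \<in> rtrancl_on V E"
  using assms(3)
proof (induction k arbitrary: v)
  case 0
  then show ?case using assms(2) by simp
next
  case (Suc k)
  then obtain w where w: "w \<in> nb N k u" "v \<in> insert w (N w)" by auto
  have uw: "(u, w) \<in> rtrancl_on V E" by (rule Suc.IH[OF w(1)])
  then have "w \<in> V" by (rule in_rtrancl_on_in_F)
  then show ?case using w(2) uw assms(1) by (auto intro: rtrancl_on_into_rtrancl_on)
qed

lemma reachable_nb:
  assumes "(u, v) \<in> rtrancl_on (pverts G) (parcs G)"
  shows "\<exists>k. v \<in> nb (neighbors G) k u"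
  using assms
proof (induction rule: rtrancl_on_induct)
  case base
  show ?case by (intro exI[of _ 0]) simp
next
  case (step y z)
  then obtain k where "y \<in> nb (neighbors G) k u" by blast
  then have "z \<in> nb (neighbors G) (Suc k) u" using step(2) by (auto simp: neighbors_def)
  then show ?case by blast
qed

lemma pcas_nb: "pcas w p u \<Longrightarrow> set p \<subseteq> parcs G \<Longrightarrow> u \<in> nb (neighbors G) (length p) w"
proof (induction p arbitrary: w)
  case (Cons e p)
  have "snd e \<in> nb (neighbors G) 1 w" using Cons.prems by (cases e) (auto simp: neighbors_def)
  moreover have "u \<in> nb (neighbors G) (length p) (snd e)" using Cons by auto
  ultimately have "u \<in> nb (neighbors G) (1 + length p) w" by (rule nb_trans[rotated])
  then show ?case by simp
qed simp

text \<open>Replaces reachability by the union of all balls, a form that can be verified on a limit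
  network.\<close>

lemma social_network_iff:
  "social_network G \<longleftrightarrow> (\<forall>u v. v \<in> neighbors G u \<longrightarrow> u \<in> pverts G \<and> v \<in> pverts G \<and> u \<noteq> v) \<and> pverts G \<noteq> {} \<and>
    (\<forall>u\<in>pverts G. \<forall>v\<in>pverts G. \<exists>k. v \<in> nb (neighbors G) k u)"
proof
  assume s: "social_network G"
  then interpret pair_loopfree_digraph G by (simp add: social_network_def)
  have "u \<in> pverts G \<and> v \<in> pverts G \<and> u \<noteq> v" if "v \<in> neighbors G u" for u v
  proof -
    have e: "(u, v) \<in> parcs G" using that by (simp add: neighbors_def)
    show ?thesis using arc_fst_in_verts[OF e] arc_snd_in_verts[OF e] pair_no_loops[OF e] by simp
  qed
  moreover have "pverts G \<noteq> {}" "\<And>u v. u \<in> pverts G \<Longrightarrow> v \<in> pverts G \<Longrightarrow> (u, v) \<in> rtrancl_on (pverts G) (parcs G)"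
    using s by (auto simp: social_network_def strongly_connected_def reachable_def)
  ultimately show "(\<forall>u v. v \<in> neighbors G u \<longrightarrow> u \<in> pverts G \<and> v \<in> pverts G \<and> u \<noteq> v) \<and> pverts G \<noteq> {} \<and>
    (\<forall>u\<in>pverts G. \<forall>v\<in>pverts G. \<exists>k. v \<in> nb (neighbors G) k u)"
    using reachable_nb by blast
next
  assume a: "(\<forall>u v. v \<in> neighbors G u \<longrightarrow> u \<in> pverts G \<and> v \<in> pverts G \<and> u \<noteq> v) \<and> pverts G \<noteq> {} \<and>
    (\<forall>u\<in>pverts G. \<forall>v\<in>pverts G. \<exists>k. v \<in> nb (neighbors G) k u)"
  have "pair_loopfree_digraph G"
    by unfold_locales (use a in \<open>auto simp: neighbors_def\<close>)
  moreover have "(u, v) \<in> rtrancl_on (pverts G) (parcs G)" if u: "u \<in> pverts G" and v: "v \<in> pverts G" for u v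
  proof -
    obtain k where k: "v \<in> nb (neighbors G) k u" using a u v by blast
    show ?thesis by (rule nb_reachable[OF _ u k]) (use a in \<open>auto simp: neighbors_def\<close>)
  qed
  ultimately show "social_network G" using a
    by (auto simp: social_network_def strongly_connected_def reachable_def)
qed

lemma locally_strongly_connected_nb:
  assumes "locally_strongly_connected L G" "w \<in> neighbors G u"
  shows "u \<in> nb (neighbors G) L w"
proof -
  obtain p where p: "pre_digraph.apath (with_proj G) w p u" "length p \<le> L"
    using assms by (auto simp: locally_strongly_connected_def neighbors_def)
  then have "u \<in> nb (neighbors G) (length p) w"
    by (intro pcas_nb) (auto simp: pre_digraph.apath_def pre_digraph.awalk_def cas_with_proj_eq)
  then show ?thesis using nb_mono[OF p(2)] by blast
qed

lemma settles_of_bool: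
  assumes "(\<lambda>n. of_bool (P n) :: real) \<longlonglongrightarrow> l" shows "settles P"
proof -
  have "eventually (\<lambda>n. dist (of_bool (P n)) l < 1 / 2) sequentially" using assms by (rule tendstoD) simp
  then obtain n where n: "\<And>m. m \<ge> n \<Longrightarrow> dist (of_bool (P m)) l < 1 / 2" by (auto simp: eventually_sequentially)
  have "P m = P n" if "m \<ge> n" for m
    using n[OF that] n[of n] by (cases "P m"; cases "P n") (auto simp: dist_real_def abs_if split: if_splits)
  then show ?thesis unfolding settles_def by (intro exI[of _ n]) blast
qed

context signals begin

text \<open>The return of arcs is phrased by balls of radius \<open>L\<close>, hence visible on
  finitely many labels and inherited by limits. Strong connectivity by itself is not a local
  property.\<close>

definition admissible :: "nat \<Rightarrow> nat \<Rightarrow> nat pair_pre_digraph \<Rightarrow> 'w actions \<Rightarrow> bool" where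
  "admissible d L G act \<longleftrightarrow> social_network G \<and>
     (\<forall>u\<in>pverts G. finite (neighbors G u) \<and> card (neighbors G u) \<le> d) \<and>
     (\<forall>u\<in>pverts G. \<forall>w\<in>neighbors G u. u \<in> nb (neighbors G) L w) \<and> action_process m0 m1 G act"

lemma equilibriumI:
  assumes "social_network G" "\<And>u. u \<in> pverts G \<Longrightarrow> finite (neighbors G u)" "action_process m0 m1 G act"
  shows "equilibrium m0 m1 G act"
  by unfold_locales (use assms in \<open>auto simp: social_network_iff action_process_def\<close>)

lemma admissible_equilibrium: "admissible d L G act \<Longrightarrow> equilibrium m0 m1 G act"
  by (rule equilibriumI) (auto simp: admissible_def)

text \<open>With breadth-first labels from \<open>r m\<close>, the degree bound confines the
  neighbours of label \<open>i\<close> to finitely many labels, the same ones in all networks, so no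
  neighbour escapes in the limit. By \<open>big\<close> every label is eventually in use and the
  limit is infinite. Since coefficients decrease in time, bounds at time \<open>m\<close> on the
  ball of radius \<open>m\<close> become bounds for all agents and times.\<close>

lemma compactness:
  fixes G :: "nat \<Rightarrow> nat pair_pre_digraph" and act :: "nat \<Rightarrow> 'w actions"
  assumes adm: "\<And>m. admissible d L (G m) (act m)" and r: "\<And>m. r m \<in> pverts (G m)"
    and big: "\<And>m. infinite (pverts (G m)) \<or> m < card (pverts (G m))"
    and bad: "\<And>m v. v \<in> nb (neighbors (G m)) m (r m) \<Longrightarrow> \<beta> \<le> network.bhat m0 m1 (G m) (act m) v m"
  shows "\<exists>G' act'. admissible d L G' act' \<and> infinite (pverts G') \<and>
    (\<forall>u\<in>pverts G'. \<forall>t. \<beta> \<le> network.bhat m0 m1 G' act' u t)"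
proof -
  let ?N = "\<lambda>m. neighbors (G m)" and ?V = "\<lambda>m. pverts (G m)"
  have E: "equilibrium m0 m1 (G m) (act m)" for m by (rule admissible_equilibrium[OF adm])
  have sn: "social_network (G m)" for m using adm by (simp add: admissible_def)
  have closed: "v \<in> ?V m \<Longrightarrow> ?N m v \<subseteq> ?V m" for m v using sn[of m] by (auto simp: social_network_iff)
  have fin: "v \<in> ?V m \<Longrightarrow> finite (?N m v)" and deg: "v \<in> ?V m \<Longrightarrow> card (?N m v) \<le> d" for m v
    using adm[of m] by (auto simp: admissible_def)
  have loopfree: "v \<notin> ?N m v" for m v using sn[of m] by (auto simp: social_network_iff)
  have conn: "v \<in> ?V m \<Longrightarrow> \<exists>k. v \<in> nb (?N m) k (r m)" for m v using sn[of m] r[of m] by (auto simp: social_network_iff)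
  have rev: "u \<in> ?V m \<Longrightarrow> w \<in> ?N m u \<Longrightarrow> u \<in> nb (?N m) L w" for m u w using adm[of m] by (auto simp: admissible_def)
  have "\<exists>B. network.profile m0 m1 (G m) (act m) B \<and> (\<forall>u\<in>?V m. \<forall>t\<ge>1. \<forall>g. B u t g \<subseteq> cell m0 B (?N m) u (past (?N m) u t) g \<and>
    (\<not> network.relevant m0 m1 (G m) (act m) u t g \<longrightarrow> B u t g = {}))" for m
  proof -
    interpret E: equilibrium m0 m1 "G m" "act m" by (rule E)
    show ?thesis using E.normal_profile by (simp add: E.relevant_def)
  qed
  then obtain B where B: "\<And>m. network.profile m0 m1 (G m) (act m) (B m) \<and> (\<forall>u\<in>?V m. \<forall>t\<ge>1. \<forall>g. B m u t g \<subseteq> cell m0 (B m) (?N m) u (past (?N m) u t) g \<and>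
    (\<not> network.relevant m0 m1 (G m) (act m) u t g \<longrightarrow> B m u t g = {}))"
    by metis
  have "\<exists>g. \<forall>k. bij_betw g {..<card (nb (?N m) k (r m))} (nb (?N m) k (r m))" for m
    by (rule bfs_labels[of "r m" "?V m"]) (use r closed fin conn in auto)
  then obtain g where g: "\<And>m k. bij_betw (g m) {..<card (nb (?N m) k (r m))} (nb (?N m) k (r m))" by metis
  have nbV: "nb (?N m) k v \<subseteq> ?V m" if "v \<in> ?V m" for m k v by (rule nb_subset) (use that closed in auto)
  have lt: "k < card (nb (?N m) k (r m))" if "k \<le> m" for k m
    by (rule card_nb_ge[of "r m" "?V m"]) (use r closed fin conn big[of m] that in auto)
  have bound: "card (nb (?N m) k (r m)) \<le> (d + 1) ^ k" for k m
    by (rule card_nb_le[of "r m" "?V m"]) (use r closed fin deg in auto)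
  have gin: "g m i \<in> nb (?N m) i (r m)" if "i \<le> m" for i m
    using bij_betwE[OF g[of m i]] lt[OF that] by blast
  have ginV: "g m i \<in> ?V m" if "i \<le> m" for i m using gin[OF that] nbV[OF r] by blast
  have ginj: "inj_on (g m) {..m}" for m
    using inj_on_subset[OF bij_betw_imp_inj_on[OF g[of m m]], of "{..m}"] lt[of m m] by (auto simp: subset_eq)
  \<comment> \<open>Neighbours of label \<open>i\<close> are within distance \<open>Suc i\<close> of
    the root, and that ball has at most \<open>(d + 1) ^ Suc i\<close> agents.\<close>
  have gnb: "?N m (g m i) \<subseteq> g m ` {..<(d + 1) ^ Suc i}" if "i \<le> m" for m i
  proof -
    have "?N m (g m i) \<subseteq> nb (?N m) (Suc i) (r m)" using gin[OF that] by auto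
    also have "\<dots> = g m ` {..<card (nb (?N m) (Suc i) (r m))}" using g[of m "Suc i"] by (simp add: bij_betw_def)
    also have "\<dots> \<subseteq> g m ` {..<(d + 1) ^ Suc i}" using bound[of m "Suc i"] by (intro image_mono) auto
    finally show ?thesis .
  qed
  define F where "F = (UNIV :: nat set) \<times> (UNIV :: nat set) \<times> {\<alpha> :: (nat \<times> nat) set. finite \<alpha>}"
  have cF: "countable F" unfolding F_def by (intro countable_SIGMA countable_Collect_finite) auto
  define rel where "rel = (\<lambda>m u t \<alpha>. network.relevant m0 m1 (G m) (act m) (g m u) t (map_prod (g m) id ` \<alpha>))"
  define wt where "wt = (\<lambda>m u t \<alpha>. others (B m) (?N m) True (g m u) t (map_prod (g m) id ` \<alpha>) /
        (others (B m) (?N m) False (g m u) t (map_prod (g m) id ` \<alpha>) +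
         others (B m) (?N m) True (g m u) t (map_prod (g m) id ` \<alpha>)))"
  define f :: "nat \<Rightarrow> nat \<times> nat + nat \<times> nat \<times> (nat \<times> nat) set + nat \<times> nat \<times> (nat \<times> nat) set \<Rightarrow> real" where
    "f = (\<lambda>m. case_sum (\<lambda>(i, j). of_bool (g m j \<in> ?N m (g m i)))
      (case_sum (\<lambda>(u, t, \<alpha>). of_bool (rel m u t \<alpha>)) (\<lambda>(u, t, \<alpha>). wt m u t \<alpha>)))"
  \<comment> \<open>One diagonal extraction handles three countable families: adjacency of labels,
    relevance of finite histories, and their weights.\<close>
  define S where "S = Inl ` (UNIV :: (nat \<times> nat) set) \<union> Inr ` (Inl ` F \<union> Inr ` F)"
  have "countable S" unfolding S_def using cF by (intro countable_Un countable_image) auto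
  moreover have "norm (f m x) \<le> 1" for m x
  proof -
    have "\<bar>wt m u t \<alpha>\<bar> \<le> 1" for u t \<alpha>
    proof -
      have "0 \<le> a \<Longrightarrow> 0 \<le> b \<Longrightarrow> \<bar>b / (a + b)\<bar> \<le> 1" for a b :: real by (cases "a + b = 0") (auto simp: divide_simps)
      then show ?thesis unfolding wt_def using others_nonneg by blast
    qed
    then show ?thesis by (auto simp: f_def split: sum.splits)
  qed
  ultimately obtain k :: "nat \<Rightarrow> nat" where k: "strict_mono k" and lim: "\<And>x. x \<in> S \<Longrightarrow> \<exists>l. (\<lambda>n. f (k n) x) \<longlonglongrightarrow> l"
    using function_convergent_subsequence[of S f 1] by metis
  have kn: "n \<le> k n" for n by (rule seq_suble[OF k])
  have adj: "settles (\<lambda>n. g (k n) j \<in> ?N (k n) (g (k n) i))" for i j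
  proof -
    have "Inl (i, j) \<in> S" by (simp add: S_def)
    from lim[OF this] show ?thesis by (auto simp: f_def intro: settles_of_bool)
  qed
  have rels: "settles (\<lambda>n. rel (k n) u t \<alpha>)" if "finite \<alpha>" for u t \<alpha>
  proof -
    have "Inr (Inl (u, t, \<alpha>)) \<in> S" using that by (simp add: S_def F_def)
    from lim[OF this] show ?thesis by (auto simp: f_def intro: settles_of_bool)
  qed
  have exq: "\<exists>l. finite \<alpha> \<longrightarrow> (\<lambda>n. wt (k n) u t \<alpha>) \<longlonglongrightarrow> l" for u t \<alpha>
  proof (cases "finite \<alpha>")
    case True
    then have "Inr (Inr (u, t, \<alpha>)) \<in> S" by (simp add: S_def F_def)
    from lim[OF this] show ?thesis by (simp add: f_def)
  qed simp
  define q where "q = (\<lambda>u t \<alpha>. SOME l. finite \<alpha> \<longrightarrow> (\<lambda>n. wt (k n) u t \<alpha>) \<longlonglongrightarrow> l)"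
  have q: "(\<lambda>n. wt (k n) u t \<alpha>) \<longlonglongrightarrow> q u t \<alpha>" if "finite \<alpha>" for u t \<alpha>
    using someI_ex[OF exq, of \<alpha> u t] that unfolding q_def by simp
  define N' where "N' = (\<lambda>i. {j. eventually (\<lambda>n. g (k n) j \<in> ?N (k n) (g (k n) i)) sequentially})"
  have adj': "eventually (\<lambda>n. (g (k n) j \<in> ?N (k n) (g (k n) i)) = (j \<in> N' i)) sequentially" for i j
  proof (cases "j \<in> N' i")
    case True
    then show ?thesis by (simp add: N'_def)
  next
    case False
    then have "eventually (\<lambda>n. g (k n) j \<notin> ?N (k n) (g (k n) i)) sequentially"
      using adj[of j i] unfolding settles_iff N'_def by blast
    then show ?thesis by eventually_elim (use False in blast)
  qed
  have N'_sub: "N' i \<subseteq> {..<(d + 1) ^ Suc i}" for i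
  proof
    fix j assume "j \<in> N' i"
    then have "eventually (\<lambda>n. g (k n) j \<in> ?N (k n) (g (k n) i)) sequentially" by (simp add: N'_def)
    moreover have "eventually (\<lambda>n. n \<ge> i + j + (d + 1) ^ Suc i) sequentially" by (rule eventually_ge_at_top)
    ultimately have "eventually (\<lambda>n. j < (d + 1) ^ Suc i) sequentially"
    proof eventually_elim
      case (elim n)
      have n: "i + j + (d + 1) ^ Suc i \<le> k n" using elim(2) kn[of n] by linarith
      have "g (k n) j \<in> g (k n) ` {..<(d + 1) ^ Suc i}" using gnb[of i "k n"] n elim(1) by auto
      then obtain j' where j': "j' < (d + 1) ^ Suc i" "g (k n) j = g (k n) j'" by auto
      have "j \<in> {..k n}" "j' \<in> {..k n}" using n j'(1) by auto
      with j'(2) have "j = j'" using ginj[of "k n"] by (meson inj_onD)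
      with j'(1) show ?case by simp
    qed
    then show "j \<in> {..<(d + 1) ^ Suc i}" by (simp add: eventually_const)
  qed
  have finN': "finite (N' i)" for i by (rule finite_subset[OF N'_sub]) simp
  have nbr: "eventually (\<lambda>n. ?N (k n) (g (k n) i) = g (k n) ` N' i) sequentially" for i
  proof -
    have "eventually (\<lambda>n. \<forall>j\<in>{..<(d + 1) ^ Suc i}. (g (k n) j \<in> ?N (k n) (g (k n) i)) = (j \<in> N' i)) sequentially"
      by (rule eventually_ball_finite) (use adj' in auto)
    moreover have "eventually (\<lambda>n. n \<ge> i) sequentially" by (rule eventually_ge_at_top)
    ultimately show ?thesis
    proof eventually_elim
      case (elim n)
      have "i \<le> k n" using elim(2) kn[of n] by linarith
      from gnb[OF this] show ?case using elim(1) N'_sub[of i] by blast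
    qed
  qed
  have injJ: "eventually (\<lambda>n. inj_on (g (k n)) J \<and> g (k n) ` J \<subseteq> ?V (k n)) sequentially" if J: "finite J" for J
  proof -
    obtain b where b: "\<And>j. j \<in> J \<Longrightarrow> j \<le> b" using J unfolding finite_nat_set_iff_bounded_le by blast
    have "eventually (\<lambda>n. n \<ge> b) sequentially" by (rule eventually_ge_at_top)
    then show ?thesis
    proof eventually_elim
      case (elim n)
      have le: "j \<le> k n" if "j \<in> J" for j using b[OF that] elim kn[of n] by linarith
      show ?case using inj_on_subset[OF ginj[of "k n"], of J] le ginV by auto
    qed
  qed
  interpret C: converging m0 m1 "\<lambda>n. G (k n)" "\<lambda>n. act (k n)" "\<lambda>n. B (k n)" "\<lambda>n. g (k n)" N' q
  proof (intro converging.intro converging_axioms.intro)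
    show "equilibrium m0 m1 (G (k n)) (act (k n))" for n by (rule E)
    show "network.profile m0 m1 (G (k n)) (act (k n)) (B (k n))" for n using B by blast
    show "B (k n) u t \<alpha> \<subseteq> cell m0 (B (k n)) (?N (k n)) u (past (?N (k n)) u t) \<alpha>"
      if "u \<in> ?V (k n)" "1 \<le> t" for n u t \<alpha> using B[of "k n"] that by blast
    show "B (k n) u t \<alpha> = {}"
      if "u \<in> ?V (k n)" "1 \<le> t" "\<not> network.relevant m0 m1 (G (k n)) (act (k n)) u t \<alpha>" for n u t \<alpha> using B[of "k n"] that by blast
  qed (rule signals_axioms injJ nbr finN' rels[unfolded rel_def] q[unfolded wt_def]; assumption)+
  obtain act' where act': "equilibrium m0 m1 C.limit_graph act'"
    and bl: "\<forall>u t. \<exists>s. strict_mono s \<and> (\<lambda>n. network.bhat m0 m1 (G (k (s n))) (act (k (s n))) (g (k (s n)) u) t)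
      \<longlonglongrightarrow> network.bhat m0 m1 C.limit_graph act' u t"
    using C.limit_equilibrium by blast
  have nbl: "neighbors C.limit_graph = N'" "pverts C.limit_graph = UNIV" by (rule C.neighbors_limit_graph)+
  have loop': "i \<notin> N' i" for i
  proof
    assume "i \<in> N' i"
    then have "eventually (\<lambda>n. g (k n) i \<in> ?N (k n) (g (k n) i)) sequentially" by (simp add: N'_def)
    then have "eventually (\<lambda>n :: nat. False) sequentially" by eventually_elim (use loopfree in blast)
    then show False by simp
  qed
  have deg': "card (N' i) \<le> d" for i
  proof -
    have "finite (insert i (N' i))" using finN'[of i] by simp
    from injJ[OF this] nbr[of i] have "eventually (\<lambda>n. card (N' i) \<le> d) sequentially"
    proof eventually_elim
      case (elim n)
      have "inj_on (g (k n)) (N' i)" using elim(1) by (auto intro: inj_on_subset)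
      then have "card (?N (k n) (g (k n) i)) = card (N' i)" unfolding elim(2) by (rule card_image)
      moreover have "g (k n) i \<in> ?V (k n)" using elim(1) by blast
      ultimately show ?case using deg[of "g (k n) i" "k n"] by simp
    qed
    then show ?thesis by (simp add: eventually_const)
  qed
  have nbt: "eventually (\<lambda>n. nb (?N (k n)) l (g (k n) i) = g (k n) ` nb N' l i) sequentially" for l i
    using C.stable_ball[of l i] by eventually_elim (rule nb_transport, blast)
  have rev': "i \<in> nb N' L j" if j: "j \<in> N' i" for i j
  proof -
    have "finite (insert i (nb N' L j))" using C.finite_nb' by simp
    from injJ[OF this] nbt[of L j] adj'[of j i] have "eventually (\<lambda>n. i \<in> nb N' L j) sequentially"
    proof eventually_elim
      case (elim n)
      have "g (k n) j \<in> ?N (k n) (g (k n) i)" "g (k n) i \<in> ?V (k n)" using elim j by auto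
      then have "g (k n) i \<in> g (k n) ` nb N' L j" using rev elim(2) by blast
      then obtain x where x: "x \<in> nb N' L j" "g (k n) i = g (k n) x" by blast
      moreover have "inj_on (g (k n)) (insert i (nb N' L j))" using elim(1) by blast
      ultimately have "i = x" by (auto dest: inj_onD)
      then show ?case using x(1) by simp
    qed
    then show ?thesis by (simp add: eventually_const)
  qed
  have g0: "g m 0 = r m" for m using gin[of 0 m] by simp
  have from0: "i \<in> nb N' i 0" for i
  proof -
    have "finite (insert i (nb N' i 0))" using C.finite_nb' by simp
    from injJ[OF this] nbt[of i 0] eventually_ge_at_top[of i] have "eventually (\<lambda>n. i \<in> nb N' i 0) sequentially"
    proof eventually_elim
      case (elim n)
      have "i \<le> k n" using elim(3) kn[of n] by linarith
      then have "g (k n) i \<in> g (k n) ` nb N' i 0" using gin[of i "k n"] elim(2) g0 by simp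
      then obtain x where x: "x \<in> nb N' i 0" "g (k n) i = g (k n) x" by blast
      moreover have "inj_on (g (k n)) (insert i (nb N' i 0))" using elim(1) by blast
      ultimately have "i = x" by (auto dest: inj_onD)
      then show ?case using x(1) by simp
    qed
    then show ?thesis by (simp add: eventually_const)
  qed
  \<comment> \<open>Label \<open>i\<close> is within distance \<open>i\<close> from the root
    \<open>0\<close>, and the way back exists in the limit by reversing arcs, whence
    \<open>L * i\<close>. This recovers strong connectivity.\<close>
  have conn': "\<exists>l. j \<in> nb N' l i" for i j
  proof -
    have "0 \<in> nb N' (L * i) i" by (rule nb_rev[of 0 UNIV]) (use rev' from0 in auto)
    with from0[of j] have "j \<in> nb N' (L * i + j) i" by (rule nb_trans)
    then show ?thesis by blast
  qed
  have "social_network C.limit_graph"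
    unfolding social_network_iff nbl using loop' conn' by auto
  moreover have "action_process m0 m1 C.limit_graph act'" using act' by (rule equilibrium.action_process)
  ultimately have "admissible d L C.limit_graph act'"
    unfolding admissible_def nbl using finN' deg' rev' by simp
  moreover have "\<beta> \<le> network.bhat m0 m1 C.limit_graph act' u t" for u t
  proof -
    obtain s where s: "strict_mono s" and l: "(\<lambda>n. network.bhat m0 m1 (G (k (s n))) (act (k (s n))) (g (k (s n)) u) t)
      \<longlonglongrightarrow> network.bhat m0 m1 C.limit_graph act' u t" using bl by blast
    have "\<beta> \<le> network.bhat m0 m1 (G (k (s n))) (act (k (s n))) (g (k (s n)) u) t" if n: "n \<ge> max u t" for n
    proof -
      let ?m = "k (s n)"
      interpret E: equilibrium m0 m1 "G ?m" "act ?m" by (rule E)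
      have m: "u \<le> ?m" "t \<le> ?m" using n seq_suble[OF s, of n] kn[of "s n"] by linarith+
      have "g ?m u \<in> nb (?N ?m) ?m (r ?m)" using gin[OF m(1)] nb_mono[OF m(1)] by blast
      then have "\<beta> \<le> E.bhat (g ?m u) ?m" by (rule bad)
      also have "\<dots> \<le> E.bhat (g ?m u) t" by (rule E.bhat_antimono[OF ginV[OF m(1)] m(2)])
      finally show ?thesis .
    qed
    then show ?thesis using LIMSEQ_le_const[OF l] by blast
  qed
  ultimately show ?thesis by (intro exI[of _ C.limit_graph] exI[of _ act']) (simp add: nbl)
qed

end

subsection \<open>Uniform learning\<close>

context network begin

text \<open>At time 1 nothing has been observed, so the cell of \<open>v\<close> is
  \<open>B v 1 {}\<close> or its complement, and the first actions are independent given the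
  state.\<close>

lemma first_act_law:
  assumes B: "profile B" and J: "finite J" "J \<subseteq> V" "X \<subseteq> J"
  shows "mass V s {\<omega> \<in> space W. \<forall>v\<in>J. act v 1 \<omega> = (v \<in> X)} =
    (\<Prod>v\<in>J. if v \<in> X then measure (mu s) (B v 1 {}) else 1 - measure (mu s) (B v 1 {})) / 2"
proof -
  interpret M: prob_space "mu s" by (rule prob_mu)
  have Bs: "B u t g \<in> sets m0" for u t g using B by (auto simp: profile_def)
  have sp: "snd \<omega> v \<in> space m0" if "\<omega> \<in> space W" "v \<in> J" for \<omega> v using that J(2) by (auto simp: space_world)
  have "{\<omega> \<in> space W. \<forall>v\<in>J. act v 1 \<omega> = (v \<in> X)} = {\<omega> \<in> space W.
      (\<forall>p\<in>J \<times> {1}. act (fst p) (snd p) \<omega> = (p \<in> X \<times> {1})) \<and> (\<forall>v\<in>J. snd \<omega> v \<in> space m0)}"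
    using sp by auto
  also have "mass V s \<dots> = (\<Prod>v\<in>J. measure (mu s) (cell m0 B N v (J \<times> {1}) (X \<times> {1}) \<inter> space m0)) / 2"
    by (rule config_law[OF B]) (use J in \<open>auto simp: past_def\<close>)
  also have "(\<Prod>v\<in>J. measure (mu s) (cell m0 B N v (J \<times> {1}) (X \<times> {1}) \<inter> space m0)) =
      (\<Prod>v\<in>J. if v \<in> X then measure (mu s) (B v 1 {}) else 1 - measure (mu s) (B v 1 {}))"
  proof (rule prod.cong[OF refl])
    fix v assume v: "v \<in> J"
    have "past N v 1 = {}" by (simp add: past_def)
    then have "cell m0 B N v (J \<times> {1}) (X \<times> {1}) \<inter> space m0 = (if v \<in> X then B v 1 {} else space (mu s) - B v 1 {})"
      using v sets.sets_into_space[OF Bs[of v 1 "{}"]] unfolding cell_def by auto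
    then show "measure (mu s) (cell m0 B N v (J \<times> {1}) (X \<times> {1}) \<inter> space m0) =
        (if v \<in> X then measure (mu s) (B v 1 {}) else 1 - measure (mu s) (B v 1 {}))"
      using M.prob_compl[of "B v 1 {}"] Bs[of v 1 "{}"] by simp
  qed
  finally show ?thesis .
qed

lemma bhat_0: "u \<in> V \<Longrightarrow> bhat u 0 \<le> 1"
proof -
  have "past N u 0 = {}" by (simp add: past_def)
  moreover from this have "hst u 0 \<omega> = {}" for \<omega> by (simp add: hist_def)
  ultimately show ?thesis by (simp add: bhat_def bhattacharyya_def mass_space)
qed

end

context equilibrium begin

text \<open>The history at time 2 consists of the first actions of \<open>u\<close> and its
  neighbours. By their independence the coefficient is half a product of binary coefficients, each
  bounded by \<open>sqrt_binary_le\<close>.\<close>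

lemma bhat_2_le:
  assumes u: "u \<in> V" and D: "D \<in> sets m0" and \<delta>: "measure m1 D - measure m0 D = \<delta>" "\<delta> > 0"
  shows "bhat u 2 \<le> (1 - \<delta>\<^sup>2 / 8) ^ card (insert u (N u))"
proof -
  obtain B where B: "profile B" using normal_profile by blast
  define J where "J = insert u (N u)"
  have J: "finite J" "J \<subseteq> V" using finN[OF u] N_sub[OF u] u by (auto simp: J_def)
  define p where "p = (\<lambda>s v. measure (mu s) (B v 1 {}))"
  have p01: "0 \<le> p s v" "p s v \<le> 1" for s v
    using prob_space.prob_le_1[OF prob_mu] by (simp_all add: p_def)
  have diff: "\<delta> \<le> p True v - p False v" if v: "v \<in> J" for v
  proof -
    have vV: "v \<in> V" using v J by blast
    have "mass V s {\<omega> \<in> space W. act v 1 \<omega>} = p s v / 2" for s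
      using first_act_law[OF B, of "{v}" "{v}" s] vV by (simp add: p_def)
    then show ?thesis using act_correct_gain[OF vV le_refl D] \<delta>(1) by (simp add: gain_def)
  qed
  have past: "past N u 2 = J \<times> {1}" by (auto simp: past_def J_def)
  have ev: "{\<omega> \<in> space W. hst u 2 \<omega> = X \<times> {1}} = {\<omega> \<in> space W. \<forall>v\<in>J. act v 1 \<omega> = (v \<in> X)}" if "X \<subseteq> J" for X
    using hist_eq_iff[of "X \<times> {1}" N u 2 act] that unfolding past by auto
  have law: "mass V s {\<omega> \<in> space W. hst u 2 \<omega> = X \<times> {1}} = (\<Prod>v\<in>J. if v \<in> X then p s v else 1 - p s v) / 2"
    if "X \<subseteq> J" for X s
    unfolding ev[OF that] p_def by (rule first_act_law[OF B J that])
  have sqrt_half: "sqrt (a / 2 * (b / 2)) = sqrt (a * b) / 2" for a b :: real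
    using real_sqrt_divide[of "a * b" 4] by simp
  have sqrt_prod: "sqrt (\<Prod>v\<in>J. f v) = (\<Prod>v\<in>J. sqrt (f v))" for f :: "nat \<Rightarrow> real"
    using J(1) by (induction J rule: finite_induct) (auto simp: real_sqrt_mult)
  have pw: "Pow (J \<times> {1 :: nat}) = (\<lambda>X. X \<times> {1}) ` Pow J"
  proof
    show "Pow (J \<times> {1 :: nat}) \<subseteq> (\<lambda>X. X \<times> {1}) ` Pow J"
    proof
      fix g assume "g \<in> Pow (J \<times> {1 :: nat})"
      then have "g = fst ` g \<times> {1}" "fst ` g \<in> Pow J" by force+
      then show "g \<in> (\<lambda>X. X \<times> {1}) ` Pow J" by (rule image_eqI)
    qed
  qed auto
  have "bhat u 2 = (\<Sum>X\<in>Pow J. sqrt (mass V False {\<omega> \<in> space W. hst u 2 \<omega> = X \<times> {1}} *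
      mass V True {\<omega> \<in> space W. hst u 2 \<omega> = X \<times> {1}}))"
    unfolding bhat_def bhattacharyya_def past pw by (subst sum.reindex) (auto simp: inj_on_def)
  also have "\<dots> = (\<Sum>X\<in>Pow J. (\<Prod>v\<in>X. sqrt (p False v * p True v)) *
      (\<Prod>v\<in>J - X. sqrt ((1 - p False v) * (1 - p True v)))) / 2"
    unfolding sum_divide_distrib
  proof (rule sum.cong[OF refl])
    fix X assume "X \<in> Pow J"
    then have X: "X \<subseteq> J" by blast
    have "sqrt (mass V False {\<omega> \<in> space W. hst u 2 \<omega> = X \<times> {1}} * mass V True {\<omega> \<in> space W. hst u 2 \<omega> = X \<times> {1}}) =
        (\<Prod>v\<in>J. if v \<in> X then sqrt (p False v * p True v) else sqrt ((1 - p False v) * (1 - p True v))) / 2"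
      unfolding law[OF X] sqrt_half prod.distrib[symmetric] sqrt_prod
      by (intro arg_cong2[of _ _ _ _ "(/)"] prod.cong) auto
    also have "(\<Prod>v\<in>J. if v \<in> X then sqrt (p False v * p True v) else sqrt ((1 - p False v) * (1 - p True v))) =
        (\<Prod>v\<in>X. sqrt (p False v * p True v)) * (\<Prod>v\<in>J - X. sqrt ((1 - p False v) * (1 - p True v)))"
      using X by (simp add: prod.If_cases[OF J(1)] Int_absorb1 Diff_eq)
    finally show "sqrt (mass V False {\<omega> \<in> space W. hst u 2 \<omega> = X \<times> {1}} * mass V True {\<omega> \<in> space W. hst u 2 \<omega> = X \<times> {1}}) =
        (\<Prod>v\<in>X. sqrt (p False v * p True v)) * (\<Prod>v\<in>J - X. sqrt ((1 - p False v) * (1 - p True v))) / 2" .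
  qed
  \<comment> \<open>The sum over the sets \<open>X\<close> of agents whose first action is 1 is the
    expansion of a product of sums over \<open>J\<close>.\<close>
  also have "\<dots> = (\<Prod>v\<in>J. sqrt (p False v * p True v) + sqrt ((1 - p False v) * (1 - p True v))) / 2"
    by (simp only: prod_add[OF J(1)])
  also have "\<dots> \<le> (\<Prod>v\<in>J. sqrt (p False v * p True v) + sqrt ((1 - p False v) * (1 - p True v)))"
    using p01 by (simp add: prod_nonneg)
  also have "\<dots> \<le> (\<Prod>v\<in>J. 1 - \<delta>\<^sup>2 / 8)"
  proof (rule prod_mono)
    fix v assume v: "v \<in> J"
    have "sqrt (p False v * p True v) + sqrt ((1 - p False v) * (1 - p True v)) \<le> 1 - \<delta>\<^sup>2 / 8"
      by (rule sqrt_binary_le) (use p01 diff[OF v] \<delta>(2) in auto)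
    then show "0 \<le> sqrt (p False v * p True v) + sqrt ((1 - p False v) * (1 - p True v)) \<and>
        sqrt (p False v * p True v) + sqrt ((1 - p False v) * (1 - p True v)) \<le> 1 - \<delta>\<^sup>2 / 8"
      using p01 by simp
  qed
  finally show ?thesis by (simp add: J_def)
qed

end

section \<open>Uniform bounds by iterated improvement\<close>

locale agreeing = signals m0 m1 for m0 m1 :: "'w measure" +
  fixes D :: "'w set" and \<delta> :: real
  assumes agreement: "\<And>G act. social_network G \<Longrightarrow> action_process m0 m1 G act \<Longrightarrow>
      \<exists>A. common_optimal_action_set m0 m1 G act A"
    and D: "D \<in> sets m0" and \<delta>: "measure m1 D - measure m0 D = \<delta>" "\<delta> > 0"
begin

definition rate :: real where "rate = 1 - \<delta>\<^sup>2 / 8"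

lemma rate_bounds: "0 < rate" "rate < 1"
proof -
  have "\<delta> \<le> 1" using prob_space.prob_le_1[OF prob1, of D] \<delta>(1) measure_nonneg[of m0 D] by linarith
  then have "\<delta>\<^sup>2 \<le> 1" using \<delta>(2) by (simp add: power_le_one)
  then show "0 < rate" "rate < 1" using \<delta>(2) by (auto simp: rate_def)
qed

text \<open>\<open>N0\<close>, \<open>T\<close> and \<open>R\<close> must not depend on the network.
  A good agent is required near every root because the improvement step needs one far from a given
  place.\<close>

definition uniform :: "nat \<Rightarrow> nat \<Rightarrow> real \<Rightarrow> bool" where
  "uniform d L \<beta> \<longleftrightarrow> (\<exists>N0 T R. \<forall>G act r. admissible d L G act \<longrightarrow>
     infinite (pverts G) \<or> N0 < card (pverts G) \<longrightarrow> r \<in> pverts G \<longrightarrow>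
     (\<exists>v\<in>nb (neighbors G) R r. network.bhat m0 m1 G act v T \<le> \<beta>))"

lemma uniform_1: "uniform d L 1"
  unfolding uniform_def
proof (rule exI[of _ 0], rule exI[of _ 0], rule exI[of _ 0], intro allI impI)
  fix G act r assume a: "admissible d L G act" and r: "r \<in> pverts G"
  interpret E: equilibrium m0 m1 G act by (rule admissible_equilibrium[OF a])
  show "\<exists>v\<in>nb (neighbors G) 0 r. E.bhat v 0 \<le> 1" using E.bhat_0[OF r] by simp
qed

lemma uniform_mono: "uniform d L \<beta> \<Longrightarrow> \<beta> \<le> \<beta>' \<Longrightarrow> uniform d L \<beta>'"
  unfolding uniform_def by (meson order_trans)

text \<open>A failure provides, for each \<open>m\<close>, a counterexample with \<open>m\<close> as
  size bound, time and radius at once. Their limit is infinite, so both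
  \<open>uniform d L \<beta>\<close> and agreement apply to it, and \<open>bhat_improve\<close> with
  \<open>\<epsilon> / 2\<close> pushes one coefficient strictly below the inherited bound.\<close>

lemma uniform_step:
  assumes "uniform d L \<beta>" and \<epsilon>: "\<epsilon> > 0" shows "uniform d L (rate * \<beta> + \<epsilon>)"
proof (rule ccontr)
  let ?\<beta> = "rate * \<beta> + \<epsilon>"
  obtain N0 T R where H: "\<And>G act r. admissible d L G act \<Longrightarrow> infinite (pverts G) \<or> N0 < card (pverts G) \<Longrightarrow>
      r \<in> pverts G \<Longrightarrow> \<exists>v\<in>nb (neighbors G) R r. network.bhat m0 m1 G act v T \<le> \<beta>"
    using assms(1) unfolding uniform_def by blast
  define P where "P = (\<lambda>m x. case x of (G, act, r) \<Rightarrow> admissible d L G act \<and>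
      (infinite (pverts G) \<or> m < card (pverts G)) \<and> r \<in> pverts G \<and>
      (\<forall>v\<in>nb (neighbors G) m r. ?\<beta> \<le> network.bhat m0 m1 G act v m))"
  assume not: "\<not> uniform d L ?\<beta>"
  have "\<exists>x. P m x" for m
  proof -
    obtain G act r where "admissible d L G act" "infinite (pverts G) \<or> m < card (pverts G)" "r \<in> pverts G"
      "\<not> (\<exists>v\<in>nb (neighbors G) m r. network.bhat m0 m1 G act v m \<le> ?\<beta>)"
      using not unfolding uniform_def by blast
    then have "P m (G, act, r)" by (auto simp: P_def not_le less_imp_le)
    then show ?thesis ..
  qed
  then have "\<exists>x. \<forall>m. P m (x m)" by (intro choice allI)
  then obtain x where "\<forall>m. P m (x m)" ..
  then have P: "P m (x m)" for m ..
  have "\<exists>G' act'. admissible d L G' act' \<and> infinite (pverts G') \<and>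
    (\<forall>u\<in>pverts G'. \<forall>t. ?\<beta> \<le> network.bhat m0 m1 G' act' u t)"
    by (rule compactness[of d L "\<lambda>m. fst (x m)" "\<lambda>m. fst (snd (x m))" "\<lambda>m. snd (snd (x m))"])
      (use P[unfolded P_def case_prod_beta] in blast)+
  then obtain G act where a: "admissible d L G act" and inf: "infinite (pverts G)"
    and ge: "\<And>u t. u \<in> pverts G \<Longrightarrow> ?\<beta> \<le> network.bhat m0 m1 G act u t" by blast
  interpret E: equilibrium m0 m1 G act by (rule admissible_equilibrium[OF a])
  have "social_network G" "action_process m0 m1 G act" using a by (simp_all add: admissible_def)
  from agreement[OF this] obtain A where A: "common_optimal_action_set m0 m1 G act A" ..
  have "\<exists>v\<in>E.V. \<exists>T'. E.bhat v T' \<le> (1 - \<delta>\<^sup>2 / 8) * \<beta> + \<epsilon> / 2"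
  proof (rule E.bhat_improve[OF A inf D \<delta>])
    show "\<And>r. r \<in> E.V \<Longrightarrow> \<exists>v\<in>nb E.N R r. E.bhat v T \<le> \<beta>" by (rule H[OF a]) (use inf in auto)
  qed (use a \<epsilon> in \<open>auto simp: admissible_def\<close>)
  then obtain v T' where v: "v \<in> E.V" "E.bhat v T' \<le> rate * \<beta> + \<epsilon> / 2" unfolding rate_def[symmetric] by blast
  with ge[OF v(1), of T'] \<epsilon> show False by simp
qed

text \<open>The increment \<open>(1 - rate) * (\<beta> / 2)\<close> makes \<open>\<beta> / 2\<close>
  the fixed point of the step, so the excess over it shrinks by the factor \<open>rate\<close> each
  time.\<close>

lemma uniform_pos: assumes "\<beta> > 0" shows "uniform d L \<beta>"
proof -
  have pow: "uniform d L (rate ^ k + \<beta> / 2)" for k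
  proof (induction k)
    case 0
    show ?case by (rule uniform_mono[OF uniform_1]) (use assms in simp)
  next
    case (Suc k)
    have "(1 - rate) * (\<beta> / 2) > 0" using rate_bounds assms by simp
    from uniform_step[OF Suc this] have "uniform d L (rate * (rate ^ k + \<beta> / 2) + (1 - rate) * (\<beta> / 2))" .
    moreover have "rate * (rate ^ k + \<beta> / 2) + (1 - rate) * (\<beta> / 2) = rate ^ Suc k + \<beta> / 2"
      by (simp add: field_simps)
    ultimately show ?case by simp
  qed
  obtain k where "rate ^ k < \<beta> / 2" using real_arch_pow_inv[of "\<beta> / 2" rate] rate_bounds assms by auto
  then show ?thesis by (intro uniform_mono[OF pow[of k]]) simp
qed

text \<open>The degree \<open>d\<close> is chosen so large that more than \<open>d\<close>
  neighbours settle the matter at time 2; the remaining networks have degree at most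
  \<open>d\<close>, where \<open>uniform\<close> applies. Both cases aim at
  \<open>\<epsilon> / 2\<close> since \<open>correct_prob_ge\<close> doubles the
  coefficient.\<close>

lemma correct_uniformly:
  assumes \<epsilon>: "\<epsilon> > 0"
  shows "\<exists>N0. \<forall>G act A. social_network G \<and> finite (pverts G) \<and> N0 < card (pverts G) \<and>
    locally_strongly_connected L G \<and> action_process m0 m1 G act \<and> common_optimal_action_set m0 m1 G act A \<longrightarrow>
    1 - \<epsilon> \<le> measure (world m0 m1 (pverts G)) {\<omega> \<in> space (world m0 m1 (pverts G)). A \<omega> = {fst \<omega>}}"
proof -
  obtain d where d: "rate ^ d < \<epsilon> / 2" using real_arch_pow_inv[of "\<epsilon> / 2" rate] rate_bounds \<epsilon> by auto
  have "uniform d L (\<epsilon> / 2)" by (rule uniform_pos) (use \<epsilon> in simp)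
  then obtain N0 T R where H: "\<And>G act r. admissible d L G act \<Longrightarrow> infinite (pverts G) \<or> N0 < card (pverts G) \<Longrightarrow>
      r \<in> pverts G \<Longrightarrow> \<exists>v\<in>nb (neighbors G) R r. network.bhat m0 m1 G act v T \<le> \<epsilon> / 2"
    unfolding uniform_def by blast
  show ?thesis
  proof (intro exI[of _ N0] allI impI)
    fix G act A
    assume a: "social_network G \<and> finite (pverts G) \<and> N0 < card (pverts G) \<and>
      locally_strongly_connected L G \<and> action_process m0 m1 G act \<and> common_optimal_action_set m0 m1 G act A"
    then have closed: "neighbors G u \<subseteq> pverts G" for u by (auto simp: social_network_iff)
    then have fin: "finite (neighbors G u)" for u using a finite_subset by blast
    have sn: "social_network G" and ap: "action_process m0 m1 G act" using a by simp_all
    interpret E: equilibrium m0 m1 G act by (rule equilibriumI[OF sn fin ap])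
    obtain u t where u: "u \<in> E.V" "E.bhat u t \<le> \<epsilon> / 2"
    proof (cases "\<exists>u\<in>E.V. d < card (E.N u)")
      case True
      then obtain u where u: "u \<in> E.V" "d < card (E.N u)" by blast
      have "card (E.N u) \<le> card (insert u (E.N u))" by (rule card_mono) (use fin in auto)
      then have "rate ^ card (insert u (E.N u)) \<le> rate ^ d" using rate_bounds u(2) by (intro power_decreasing) auto
      then have "E.bhat u 2 \<le> \<epsilon> / 2" using E.bhat_2_le[OF u(1) D \<delta>] d unfolding rate_def[symmetric] by linarith
      with u(1) show thesis by (rule that)
    next
      case False
      then have adm: "admissible d L G act"
        unfolding admissible_def using sn ap fin a locally_strongly_connected_nb[of L G] by (auto simp: not_less)
      obtain r where r: "r \<in> E.V" using E.ne by blast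
      then obtain v where v: "v \<in> nb E.N R r" "E.bhat v T \<le> \<epsilon> / 2" using H[OF adm] a by blast
      then show thesis using that E.nbV[OF r] by blast
    qed
    have "common_optimal_action_set m0 m1 G act A" using a by simp
    from E.correct_prob_ge[OF u this]
    show "1 - \<epsilon> \<le> measure (world m0 m1 (pverts G)) {\<omega> \<in> space (world m0 m1 (pverts G)). A \<omega> = {fst \<omega>}}" by simp
  qed
qed

end

theorem theorem3p49:
  fixes L :: nat and \<mu>\<^sub>0 \<mu>\<^sub>1 :: "'w measure"
  assumes "L > 0"
    and "prob_space \<mu>\<^sub>0" and "prob_space \<mu>\<^sub>1" and "sets \<mu>\<^sub>0 = sets \<mu>\<^sub>1"
    and "absolutely_continuous \<mu>\<^sub>0 \<mu>\<^sub>1" and "absolutely_continuous \<mu>\<^sub>1 \<mu>\<^sub>0"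
    and "\<mu>\<^sub>0 \<noteq> \<mu>\<^sub>1"
    and agreement: "\<And>G act. social_network G \<Longrightarrow> action_process \<mu>\<^sub>0 \<mu>\<^sub>1 G act \<Longrightarrow>
           \<exists>A. common_optimal_action_set \<mu>\<^sub>0 \<mu>\<^sub>1 G act A"
  shows "\<exists>q :: nat \<Rightarrow> real. q \<longlonglongrightarrow> 1 \<and>
           (\<forall>n G act A.
              social_network G \<and> finite (pverts G) \<and> card (pverts G) = n \<and>
              locally_strongly_connected L G \<and>
              action_process \<mu>\<^sub>0 \<mu>\<^sub>1 G act \<and> common_optimal_action_set \<mu>\<^sub>0 \<mu>\<^sub>1 G act A \<longrightarrow>
              measure (world \<mu>\<^sub>0 \<mu>\<^sub>1 (pverts G))
                {\<omega> \<in> space (world \<mu>\<^sub>0 \<mu>\<^sub>1 (pverts G)). A \<omega> = {fst \<omega>}} \<ge> q n)"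
proof -
  have sig: "signals \<mu>\<^sub>0 \<mu>\<^sub>1" by (rule signals.intro) (use assms in simp_all)
  \<comment> \<open>The two laws differ on some event, and either it or its complement is more
    likely under \<open>\<mu>\<^sub>1\<close>.\<close>
  obtain D \<delta> where D: "D \<in> sets \<mu>\<^sub>0" "measure \<mu>\<^sub>1 D - measure \<mu>\<^sub>0 D = \<delta>" "\<delta> > 0"
  proof -
    interpret M0: prob_space \<mu>\<^sub>0 by fact
    interpret M1: prob_space \<mu>\<^sub>1 by fact
    obtain S where S: "S \<in> sets \<mu>\<^sub>0" "emeasure \<mu>\<^sub>0 S \<noteq> emeasure \<mu>\<^sub>1 S"
      using measure_eqI[OF assms(4)] assms(7) by blast
    then have ne: "measure \<mu>\<^sub>0 S \<noteq> measure \<mu>\<^sub>1 S"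
      by (simp add: M0.emeasure_eq_measure M1.emeasure_eq_measure)
    have "measure \<mu>\<^sub>0 (space \<mu>\<^sub>0 - S) = 1 - measure \<mu>\<^sub>0 S" using M0.prob_compl[OF S(1)] by simp
    moreover have "measure \<mu>\<^sub>1 (space \<mu>\<^sub>0 - S) = 1 - measure \<mu>\<^sub>1 S"
      using M1.prob_compl[of S] S(1) assms(4) sets_eq_imp_space_eq[OF assms(4)] by simp
    moreover have "space \<mu>\<^sub>0 - S \<in> sets \<mu>\<^sub>0" using S(1) by blast
    ultimately show thesis
      using that[of S "measure \<mu>\<^sub>1 S - measure \<mu>\<^sub>0 S"] that[of "space \<mu>\<^sub>0 - S" "measure \<mu>\<^sub>0 S - measure \<mu>\<^sub>1 S"] S(1) ne
      by linarith
  qed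
  interpret agreeing \<mu>\<^sub>0 \<mu>\<^sub>1 D \<delta>
    by (intro agreeing.intro agreeing_axioms.intro) (use sig agreement D in auto)
  define correct where "correct = (\<lambda>(G :: nat pair_pre_digraph) (A :: 'w outcome \<Rightarrow> bool set).
    measure (world \<mu>\<^sub>0 \<mu>\<^sub>1 (pverts G)) {\<omega> \<in> space (world \<mu>\<^sub>0 \<mu>\<^sub>1 (pverts G)). A \<omega> = {fst \<omega>}})"
  define valid where "valid = (\<lambda>n (G :: nat pair_pre_digraph) act A. social_network G \<and> finite (pverts G) \<and> card (pverts G) = n \<and>
    locally_strongly_connected L G \<and> action_process \<mu>\<^sub>0 \<mu>\<^sub>1 G act \<and> common_optimal_action_set \<mu>\<^sub>0 \<mu>\<^sub>1 G act A)"
  \<comment> \<open>\<open>q n\<close> will be the infimum of this set. The element 1 keeps the set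
    nonempty when no valid network has \<open>n\<close> agents, and caps the infimum at 1.\<close>
  define C where "C = (\<lambda>n. insert 1 {correct G A | (G :: nat pair_pre_digraph) act A. valid n G act A})"
  have "x \<ge> 0" if "x \<in> C n" for n x using that by (auto simp: C_def correct_def)
  then have bdd: "bdd_below (C n)" for n by (rule bdd_belowI)
  have "(\<lambda>n. Inf (C n)) \<longlonglongrightarrow> 1"
  proof (rule LIMSEQ_I)
    fix \<epsilon> :: real assume "\<epsilon> > 0"
    then have "\<epsilon> / 2 > 0" by simp
    from correct_uniformly[OF this, of L] obtain N0 where
      N0: "\<And>n G act A. valid n G act A \<Longrightarrow> N0 < n \<Longrightarrow> 1 - \<epsilon> / 2 \<le> correct G A"
      unfolding valid_def correct_def by blast
    have "norm (Inf (C n) - 1) < \<epsilon>" if n: "n \<ge> Suc N0" for n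
    proof -
      have "1 - \<epsilon> / 2 \<le> Inf (C n)"
        by (rule cInf_greatest) (use N0[of n] n \<open>\<epsilon> > 0\<close> in \<open>auto simp: C_def\<close>)
      moreover have "Inf (C n) \<le> 1" by (rule cInf_lower[OF _ bdd]) (simp add: C_def)
      ultimately show ?thesis using \<open>\<epsilon> > 0\<close> by simp
    qed
    then show "\<exists>n0. \<forall>n\<ge>n0. norm (Inf (C n) - 1) < \<epsilon>" by blast
  qed
  moreover have "Inf (C n) \<le> correct G A" if "valid n G act A" for n and G :: "nat pair_pre_digraph" and act A
    by (rule cInf_lower[OF _ bdd]) (use that in \<open>auto simp: C_def\<close>)
  ultimately show ?thesis unfolding valid_def correct_def by (intro exI[of _ "\<lambda>n. Inf (C n)"]) blast
qed

end
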